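(* Let $a,b>-1$ with $\alpha:=a+b>-1$, and let $n\ge0$ be an integer. For $z\in\mathbb C\setminus(-\infty,0]$ the auxiliary functions of the second kind admit the $G$-function representation $$p_n^{(2)}(z):=-\int_0^\infty\!\!\int_0^\infty\frac{p_n(x)\,x^ay^be^{-x-y}\,dx\,dy}{(x+y)(z+y)}=(-1)^{n+1}\pi_n\;G^{3,1}_{2,3}\!\left(\left.{-n,\ \alpha+n+1\atop 0,\ \alpha,\ b}\;\right|z\right).$$
   Context: $p_n,q_n$ are the polynomials of exact degree $n$ with identical positive leading coefficients such that $\int_0^\infty\!\int_0^\infty\frac{x^ay^be^{-x-y}}{x+y}p_\ell(x)q_m(y)\,dx\,dy=\delta_{\ell m}$, and $$\pi_n=\sqrt{2n+\alpha+1}\,\sqrt{\frac{\Gamma(a+n+1)}{\Gamma(b+n+1)}}.$$ The Meijer $G$-function (for $p\le q$, $0\le m\le q$, $0\le n\le p$) is $$G^{m,n}_{p,q}\!\left(\left.{a_1,\dots,a_p\atop b_1,\dots,b_q}\right|z\right)=\int_\gamma\frac{du}{2\pi i}\,\frac{\prod_{j=1}^m\Gamma(b_j+u)\prod_{j=1}^n\Gamma(1-a_j-u)}{\prod_{j=m+1}^q\Gamma(1-b_j-u)\prod_{j=n+1}^p\Gamma(a_j+u)}\,z^{-u},$$ where $\gamma$ originates at $-\infty$ in the lower half-plane, returns to $-\infty$ in the upper half-plane, encircles all poles of the $\Gamma(b_j+u)$, $j\le m$, and none of the poles of the $\Gamma(1-a_j-u)$, $j\le n$; $z^{-u}$ is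 the principal branch, with cut along $z<0$. *)

theory Defs
  imports "HOL-Complex_Analysis.Complex_Analysis"
begin

definition cauchy_laguerre_weight :: "real \<Rightarrow> real \<Rightarrow> real \<Rightarrow> real \<Rightarrow> real" where
  "cauchy_laguerre_weight a b x y = x powr a * y powr b * exp (- x - y) / (x + y)"

definition cauchy_laguerre_biorthogonal ::
    "real \<Rightarrow> real \<Rightarrow> (nat \<Rightarrow> real poly) \<Rightarrow> (nat \<Rightarrow> real poly) \<Rightarrow> bool" where
  "cauchy_laguerre_biorthogonal a b p q \<longleftrightarrow>
     (\<forall>n. degree (p n) = n \<and> degree (q n) = n \<and>
          lead_coeff (p n) = lead_coeff (q n) \<and> lead_coeff (p n) > 0) \<and>
     (\<forall>l m. (LINT (x, y):{0<..} \<times> {0<..}|lborel.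
               cauchy_laguerre_weight a b x y * poly (p l) x * poly (q m) y)
            = (if l = m then 1 else 0))"

definition second_kind_2 :: "real \<Rightarrow> real \<Rightarrow> real poly \<Rightarrow> complex \<Rightarrow> complex" where
  "second_kind_2 a b P z =
     - (LINT (x, y):{0<..} \<times> {0<..}|lborel.
          of_real (poly P x * cauchy_laguerre_weight a b x y) / (z + of_real y))"

definition cauchy_laguerre_pi :: "real \<Rightarrow> real \<Rightarrow> nat \<Rightarrow> real" where
  "cauchy_laguerre_pi a b n =
     sqrt (2 * real n + (a + b) + 1) * sqrt (Gamma (a + real n + 1) / Gamma (b + real n + 1))"

text \<open>
  Meijer's function \<open>G\<close> with upper parameters \<open>as\<close> and lower parameters \<open>bs\<close>, so that
  \<open>p = length as\<close> and \<open>q = length bs\<close>; list positions start at \<open>0\<close>. Since \<^const>\<open>Gamma\<close> is \<open>0\<close> at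
  its poles and division by \<open>0\<close> gives \<open>0\<close>, the reciprocal Gamma factors have their correct
  value \<open>0\<close> there.
\<close>

definition meijer_integrand ::
    "nat \<Rightarrow> nat \<Rightarrow> complex list \<Rightarrow> complex list \<Rightarrow> complex \<Rightarrow> complex \<Rightarrow> complex" where
  "meijer_integrand m n as bs z u =
     ((\<Prod>j\<in>{0..<m}. Gamma (bs ! j + u)) * (\<Prod>j\<in>{0..<n}. Gamma (1 - as ! j - u))) /
     ((\<Prod>j\<in>{m..<length bs}. Gamma (1 - bs ! j - u)) * (\<Prod>j\<in>{n..<length as}. Gamma (as ! j + u)))
     * z powr (- u)"

definition meijer_left_poles :: "nat \<Rightarrow> complex list \<Rightarrow> complex set" where
  "meijer_left_poles m bs = {u. \<exists>j<m. bs ! j + u \<in> \<int>\<^sub>\<le>\<^sub>0}"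

definition meijer_right_poles :: "nat \<Rightarrow> complex list \<Rightarrow> complex set" where
  "meijer_right_poles n as = {u. \<exists>j<n. 1 - as ! j - u \<in> \<int>\<^sub>\<le>\<^sub>0}"

text \<open>
  A contour is a curve \<open>\<gamma>\<close> defined on the whole real line; \<open>\<gamma> \<circ> linepath s t\<close> is its piece between
  the parameters \<open>s\<close> and \<open>t\<close>. Coming from and returning to \<open>-\<infinity>\<close> means that the real part tends
  to \<open>-\<infinity>\<close> while the imaginary part stays bounded. Encircling a point is expressed by the winding
  number of long pieces of \<open>\<gamma>\<close>, closed by a segment joining their ends; that segment moves off
  to \<open>-\<infinity>\<close>. Having positive distance from the poles, rather than merely avoiding them, keeps the
  two ends from approaching the poles, which would endanger the convergence of the integral.
\<close>

definition meijer_contour ::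
    "nat \<Rightarrow> nat \<Rightarrow> complex list \<Rightarrow> complex list \<Rightarrow> (real \<Rightarrow> complex) \<Rightarrow> bool" where
  "meijer_contour m n as bs \<gamma> \<longleftrightarrow>
     (\<forall>s t. s < t \<longrightarrow> valid_path (\<gamma> \<circ> linepath s t)) \<and>
     filterlim (\<lambda>t. Re (\<gamma> t)) at_bot at_bot \<and> (\<forall>\<^sub>F t in at_bot. Im (\<gamma> t) < 0) \<and>
     filterlim (\<lambda>t. Re (\<gamma> t)) at_bot at_top \<and> (\<forall>\<^sub>F t in at_top. Im (\<gamma> t) > 0) \<and>
     bounded (range (\<lambda>t. Im (\<gamma> t))) \<and>
     (\<exists>d>0. \<forall>t. \<forall>c \<in> meijer_left_poles m bs \<union> meijer_right_poles n as. d \<le> dist (\<gamma> t) c) \<and>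
     (\<forall>c \<in> meijer_left_poles m bs. \<forall>\<^sub>F (s, t) in at_bot \<times>\<^sub>F at_top.
        winding_number ((\<gamma> \<circ> linepath s t) +++ linepath (\<gamma> t) (\<gamma> s)) c = 1) \<and>
     (\<forall>c \<in> meijer_right_poles n as. \<forall>\<^sub>F (s, t) in at_bot \<times>\<^sub>F at_top.
        winding_number ((\<gamma> \<circ> linepath s t) +++ linepath (\<gamma> t) (\<gamma> s)) c = 0)"

text \<open>
  The integral over \<open>\<gamma>\<close> is improper, with both ends tending to \<open>-\<infinity>\<close> independently. By Cauchy's
  theorem its value does not depend on the choice of \<open>\<gamma>\<close>; the definition presupposes this.
\<close>

definition meijer_G ::
    "nat \<Rightarrow> nat \<Rightarrow> complex list \<Rightarrow> complex list \<Rightarrow> complex \<Rightarrow> complex" where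
  "meijer_G m n as bs z =
     (THE w. \<exists>\<gamma>. meijer_contour m n as bs \<gamma> \<and>
        ((\<lambda>(s, t). contour_integral (\<gamma> \<circ> linepath s t) (meijer_integrand m n as bs z)
                     / (2 * of_real pi * \<i>)) \<longlongrightarrow> w) (at_bot \<times>\<^sub>F at_top))"

end

theory Submission
  imports Defs
begin

text \<open>
  Apart from the factors \<open>\<pi> / sin (\<pi>u)\<close> and \<open>z\<^sup>-\<^sup>u\<close>, the integrand of the \<open>G\<close>-function is a multiple of
  the Mellin transform, in the variable \<open>y\<close>, of the function that is paired with \<open>1 / (z + y)\<close> on the left. Indeed, since
  \<open>e\<^bsup>-(x+y)\<^esup> / (x + y)\<close> is the integral of \<open>e\<^bsup>-\<tau>(x+y)\<^esup>\<close> over \<open>\<tau> > 1\<close>, the moments of the Cauchy-Laguerre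
  weight are \<open>\<Gamma>(a+i+1) \<Gamma>(s) / (a+i+s)\<close> (\<open>Cauchy_Gamma_integral\<close>). The Mellin transform of
  a polynomial of degree \<open>n\<close> is therefore \<open>\<Gamma>(s)\<close> times a rational function with poles at
  \<open>s = -a, ..., -a-n\<close>. Orthogonality to \<open>1, y, ..., y\<^sup>n\<^sup>-\<^sup>1\<close> means that this rational function vanishes
  at \<open>s = b+1, ..., b+n\<close>; this determines it up to a factor, and partial fractions give the
  polynomial back. The normalisation and the common leading coefficient of \<open>p n\<close> and \<open>q n\<close> fix the factor
  (\<open>biorthogonal_eq_cl_poly\<close>). The substitution \<open>s = b + u\<close> turns the
  Mellin transform into the remaining factors of the integrand of \<open>G\<close>.

  The factor \<open>\<pi> / sin (\<pi>u)\<close> is in turn the Mellin transform of \<open>1 / (1 + y)\<close>. By Parseval's formula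
  (\<open>Mellin_Parseval\<close>) the function of the second kind is, up to a constant factor, the integral of the
  integrand over a vertical line \<open>Re u = c\<close> that separates the two families of poles.

  It remains to bend this line into a contour that comes from \<open>-\<infinity>\<close> and returns there. To the left the
  integrand decays faster than any exponential, and on vertical lines it decays because
  \<open>\<bar>arg z\<bar> < \<pi>\<close> (\<open>Phi_bound\<close>). A contour is cut off at an abscissa \<open>-X\<close> and closed by a vertical segment;
  the resulting loop has the same winding numbers about all poles as the rectangle
  \<open>[-X, c] \<times> [-X, X]\<close>, so by the residue theorem both have the same integral, and all sides of the
  rectangle but the right one contribute little (\<open>contour_integral_near_vertical_line\<close>). This
  holds for every admissible contour, which makes the definite description that defines \<open>meijer_G\<close>
  meaningful; one contour with a convergent integral is exhibited (\<open>meijer_contour_bowl\<close>,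
  \<open>meijer_G_eq_vertical_integral\<close>).
\<close>

section \<open>Growth of the Gamma function and of the sine\<close>

lemma norm_Gamma_le_Gamma_Re:
  assumes "Re w > 0"
  shows "cmod (Gamma w) \<le> Gamma (Re w)"
proof -
  have 1: "((\<lambda>t. of_real t powr (w - 1) / of_real (exp t)) has_integral Gamma w) {0..}"
    using Gamma_integral_complex[OF assms] .
  have 2: "((\<lambda>t. t powr (Re w - 1) / exp t) has_integral Gamma (Re w)) {0..}"
    using Gamma_integral_real[OF assms] .
  have "cmod (integral {0..} (\<lambda>t. of_real t powr (w - 1) / of_real (exp t)))
      \<le> integral {0..} (\<lambda>t. t powr (Re w - 1) / exp t)"
    by (intro integral_norm_bound_integral has_integral_integrable[OF 1] has_integral_integrable[OF 2])
      (auto simp: norm_divide norm_powr_real_powr' powr_def)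
  then show ?thesis using 1 2 by (simp add: integral_unique)
qed

text \<open>
  The recurrence \<open>\<Gamma>(w) = \<Gamma>(w + 1) / w\<close> gains a factor of at least \<open>e\<^sup>K\<close> per unit step to the left as soon
  as \<open>\<bar>w\<bar> \<ge> e\<^sup>K\<close>. It starts from a strip in which \<open>\<Gamma>(w)\<close>, away from the poles, is compared with
  \<open>\<Gamma>(w + M + 1)\<close> in the right half-plane.
\<close>

lemma Gamma_superexponential_decay:
  fixes r K D :: real
  assumes "D > 0"
  obtains C where "C \<ge> 0"
    "\<And>w. Re w \<le> r \<Longrightarrow> (\<And>k::nat. D \<le> cmod (w + of_nat k)) \<Longrightarrow> cmod (Gamma w) \<le> C * exp (K * Re w)"
proof -
  \<comment> \<open>Left of \<open>-M\<close> the modulus of \<open>w\<close> exceeds \<open>e\<^sup>K\<close>.\<close>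
  define M where "M = nat \<lceil>exp K\<rceil> + 1"
  have M: "real M \<ge> exp K" "real M \<ge> 1" unfolding M_def by linarith+
  have "continuous_on {1..\<bar>r\<bar> + M + 1} (Gamma :: real \<Rightarrow> real)"
    by (rule continuous_on_Gamma) (auto elim!: nonpos_Ints_cases)
  then have "bounded (Gamma ` {1..\<bar>r\<bar> + real M + 1})"
    by (intro compact_imp_bounded compact_continuous_image) auto
  then obtain B where B: "B > 0" "\<And>x. x \<in> {1..\<bar>r\<bar> + real M + 1} \<Longrightarrow> \<bar>Gamma x\<bar> \<le> B"
    by (fastforce simp: bounded_pos)
  define C where "C = B / D ^ (M + 1) * exp (\<bar>K\<bar> * (M + \<bar>r\<bar>))"
  have C0: "C \<ge> 0" using B assms by (simp add: C_def)
  have base: "cmod (Gamma w) \<le> C * exp (K * Re w)"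
    if "Re w \<le> \<bar>r\<bar>" "Re w \<ge> - real M" and D: "\<And>k::nat. D \<le> cmod (w + of_nat k)" for w
  proof -
    have w: "w \<notin> \<int>\<^sub>\<le>\<^sub>0"
    proof
      assume "w \<in> \<int>\<^sub>\<le>\<^sub>0"
      then obtain k where "w = - of_nat k" by (auto elim!: nonpos_Ints_cases')
      with D[of k] assms show False by simp
    qed
    have "D ^ (M + 1) = (\<Prod>i<M + 1. D)" by simp
    also have "\<dots> \<le> (\<Prod>i<M + 1. cmod (w + of_nat i))"
      by (intro prod_mono) (use D assms in auto)
    also have "\<dots> = cmod (pochhammer w (M + 1))"
      by (simp only: pochhammer_prod prod_norm lessThan_atLeast0)
    finally have P: "D ^ (M + 1) \<le> cmod (pochhammer w (M + 1))" .
    then have nz: "pochhammer w (M + 1) \<noteq> 0"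
      using zero_less_power[OF assms, of "M + 1"] by (metis linorder_not_le norm_zero)
    have "Gamma w = Gamma (w + of_nat (M + 1)) / pochhammer w (M + 1)"
      using pochhammer_Gamma[OF w, of "M + 1"] w nz
      by (simp add: Gamma_eq_zero_iff field_simps)
    then have "cmod (Gamma w) = cmod (Gamma (w + of_nat (M + 1))) / cmod (pochhammer w (M + 1))"
      by (simp only: norm_divide)
    also have "\<dots> \<le> B / D ^ (M + 1)"
    proof (intro frac_le P)
      have "cmod (Gamma (w + of_nat (M + 1))) \<le> Gamma (Re w + real (M + 1))"
        using norm_Gamma_le_Gamma_Re[of "w + of_nat (M + 1)"] that by simp
      also have "\<dots> \<le> B" using B(2)[of "Re w + real (M + 1)"] that by simp
      finally show "cmod (Gamma (w + of_nat (M + 1))) \<le> B" .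
    qed (use B assms in auto)
    also have "\<dots> = B / D ^ (M + 1) * 1" by simp
    also have "\<dots> \<le> B / D ^ (M + 1) * (exp (\<bar>K\<bar> * (M + \<bar>r\<bar>)) * exp (K * Re w))"
    proof (intro mult_left_mono)
      have "\<bar>K * Re w\<bar> \<le> \<bar>K\<bar> * (M + \<bar>r\<bar>)"
        unfolding abs_mult by (intro mult_left_mono) (use that in auto)
      then show "1 \<le> exp (\<bar>K\<bar> * (M + \<bar>r\<bar>)) * exp (K * Re w)"
        by (simp flip: exp_add)
    qed (use B assms in auto)
    finally show ?thesis by (simp add: C_def mult_ac)
  qed
  have step: "cmod (Gamma w) \<le> C * exp (K * Re w)"
    if "Re w \<le> \<bar>r\<bar>" "Re w \<ge> - real M - real m" and D: "\<And>k::nat. D \<le> cmod (w + of_nat k)" for w m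
    using that
  proof (induction m arbitrary: w)
    case 0
    then show ?case using base by simp
  next
    case (Suc m)
    show ?case
    proof (cases "Re w \<ge> - real M")
      case True
      then show ?thesis using base Suc by blast
    next
      case False
      have D': "D \<le> cmod (w + 1 + of_nat k)" for k
        using Suc.prems(3)[of "Suc k"] by (simp add: add_ac)
      have IH: "cmod (Gamma (w + 1)) \<le> C * exp (K * Re (w + 1))"
        using Suc.IH[of "w + 1"] Suc.prems False D' M by force
      have w: "w \<notin> \<int>\<^sub>\<le>\<^sub>0"
      proof
        assume "w \<in> \<int>\<^sub>\<le>\<^sub>0"
        then obtain k where "w = - of_nat k" by (auto elim!: nonpos_Ints_cases')
        with Suc.prems(3)[of k] assms show False by simp
      qed
      have big: "exp K \<le> cmod w"
        using abs_Re_le_cmod[of w] False M by linarith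
      then have "w \<noteq> 0" using exp_gt_zero[of K] by auto
      have "cmod (Gamma w) = cmod (Gamma (w + 1)) / cmod w"
        using Gamma_plus1[OF w] \<open>w \<noteq> 0\<close> by (simp add: norm_mult)
      also have "\<dots> \<le> C * exp (K * Re (w + 1)) / exp K"
        by (intro frac_le IH big) (use C0 in auto)
      also have "\<dots> = C * exp (K * Re w)"
        by (simp add: algebra_simps exp_add)
      finally show ?thesis .
    qed
  qed
  show ?thesis
  proof (rule that[OF C0])
    fix w assume w: "Re w \<le> r" and D: "\<And>k::nat. D \<le> cmod (w + of_nat k)"
    obtain m :: nat where "- real M - Re w \<le> m" using real_arch_simple by blast
    then show "cmod (Gamma w) \<le> C * exp (K * Re w)"
      using step[of w m] w D by force
  qed
qed

text \<open>
  For \<open>\<bar>Im u\<bar> \<ge> 1\<close> this follows from the closed formula for \<open>\<bar>sin w\<bar>\<^sup>2\<close>; for smaller imaginary part periodicity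
  reduces it to a compact set on which the sine has no zeros.
\<close>

lemma sin_pi_lower_bound:
  fixes D :: real
  assumes "D > 0"
  obtains \<kappa> where "\<kappa> > 0"
    "\<And>u. (\<And>k::int. D \<le> cmod (u - of_int k)) \<Longrightarrow> \<kappa> * exp (pi * \<bar>Im u\<bar>) \<le> cmod (sin (of_real pi * u))"
proof -
  define S where "S = {u. \<bar>Re u\<bar> \<le> 1/2 \<and> \<bar>Im u\<bar> \<le> 1 \<and> D \<le> cmod u}"
  have "closed S" unfolding S_def
    by (intro closed_Collect_conj closed_Collect_le continuous_intros)
  moreover have "bounded S"
  proof (rule boundedI)
    fix u assume "u \<in> S"
    then show "cmod u \<le> 2" using cmod_le[of u] by (auto simp: S_def)
  qed
  ultimately have S: "compact S" by (simp add: compact_eq_bounded_closed)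
  have nz: "sin (of_real pi * u) \<noteq> 0" if "u \<in> S" for u
  proof
    assume "sin (of_real pi * u) = 0"
    then obtain k :: int where "of_real pi * u = of_real (of_int k * pi)"
      by (auto simp: sin_eq_0)
    then have "of_real pi * u = of_real pi * of_int k" by simp
    then have "u = of_int k" by (subst (asm) mult_cancel_left) auto
    moreover from this have "k = 0" using that by (auto simp: S_def)
    ultimately show False using that assms by (auto simp: S_def)
  qed
  obtain m where m: "m > 0" "\<And>u. u \<in> S \<Longrightarrow> m \<le> cmod (sin (of_real pi * u))"
  proof (cases "S = {}")
    case True
    then show ?thesis using that[of 1] by auto
  next
    case False
    have "continuous_on S (\<lambda>u. cmod (sin (of_real pi * u)))" by (intro continuous_intros)
    from continuous_attains_inf[OF S False this] nz that show ?thesis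
      by (metis zero_less_norm_iff)
  qed
  define \<kappa> where "\<kappa> = min (1/4) (m * exp (- pi))"
  show ?thesis
  proof (rule that)
    show "\<kappa> > 0" using m by (simp add: \<kappa>_def)
    fix u assume D: "\<And>k::int. D \<le> cmod (u - of_int k)"
    show "\<kappa> * exp (pi * \<bar>Im u\<bar>) \<le> cmod (sin (of_real pi * u))"
    proof (cases "\<bar>Im u\<bar> \<le> 1")
      case True
      define k where "k = round (Re u)"
      have "u - of_int k \<in> S"
        using True D[of k] of_int_round_abs_le[of "Re u"] by (auto simp: S_def k_def abs_minus_commute)
      from m(2)[OF this] have "m \<le> cmod (sin (of_real pi * u - of_real (pi * of_int k)))"
        by (simp add: algebra_simps)
      also have "\<dots> = cmod (sin (of_real pi * u))"
      proof -
        have "sin (pi * of_int k) = 0" by (simp add: sin_int_times_real mult.commute)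
        moreover from this have "\<bar>cos (pi * of_int k)\<bar> = 1"
          using sin_zero_abs_cos_one by blast
        ultimately show ?thesis
          unfolding sin_diff by (simp only: sin_of_real cos_of_real norm_mult) (simp add: norm_mult)
      qed
      finally have "m \<le> cmod (sin (of_real pi * u))" .
      moreover have "\<kappa> * exp (pi * \<bar>Im u\<bar>) \<le> m * exp (- pi) * exp pi"
        by (intro mult_mono) (use True m in \<open>auto simp: \<kappa>_def\<close>)
      ultimately show ?thesis by (simp add: mult.assoc flip: exp_add)
    next
      case False
      let ?E = "exp (pi * \<bar>Im u\<bar>)"
      have "3 \<le> 1 + pi * \<bar>Im u\<bar>"
        using mult_mono[of 2 pi 1 "\<bar>Im u\<bar>"] False pi_ge_two by simp
      also have "\<dots> \<le> ?E" by (rule exp_ge_add_one_self)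
      finally have E3: "3 \<le> ?E" .
      have E: "?E\<^sup>2 \<le> exp (2 * (pi * Im u)) + inverse (exp (2 * (pi * Im u)))"
        by (cases "Im u \<ge> 0") (auto simp: exp_minus[symmetric] exp_double[symmetric])
      have "(?E / 4)\<^sup>2 = ?E\<^sup>2 / 16" by (simp add: power_divide)
      also have "\<dots> \<le> (?E\<^sup>2 - 2) / 4"
        using mult_mono[OF E3 E3] by (simp add: power2_eq_square)
      also have "\<dots> \<le> (cmod (sin (of_real pi * u)))\<^sup>2"
        using E unfolding norm_sin_squared
        by (simp add: divide_right_mono) (smt (verit) cos_le_one)
      finally have "?E / 4 \<le> cmod (sin (of_real pi * u))"
        by (rule power2_le_imp_le) auto
      moreover have "\<kappa> * ?E \<le> 1/4 * ?E" by (intro mult_right_mono) (auto simp: \<kappa>_def)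
      ultimately show ?thesis by linarith
    qed
  qed
qed

section \<open>The integrand of the G-function\<close>

lemma abs_Im_Ln_less_pi:
  assumes "w \<notin> \<real>\<^sub>\<le>\<^sub>0"
  shows "\<bar>Im (Ln w)\<bar> < pi"
proof -
  have "w \<noteq> 0" using assms by auto
  then have "Im (Ln w) \<noteq> pi" using assms Im_Ln_eq_pi by (auto simp: complex_nonpos_Reals_iff)
  then show ?thesis using mpi_less_Im_Ln[OF \<open>w \<noteq> 0\<close>] Im_Ln_le_pi[OF \<open>w \<noteq> 0\<close>] by linarith
qed

lemma norm_powr_uminus_le:
  assumes "w \<noteq> 0"
  shows "cmod (w powr (- u)) \<le> exp (- ln (cmod w) * Re u) * exp (\<bar>Im (Ln w)\<bar> * \<bar>Im u\<bar>)"
proof -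
  have "cmod (w powr (- u)) = exp (- ln (cmod w) * Re u + Im u * Im (Ln w))"
    using assms by (simp add: powr_def norm_exp_eq_Re mult_ac)
  moreover have "Im u * Im (Ln w) \<le> \<bar>Im (Ln w)\<bar> * \<bar>Im u\<bar>"
    by (metis abs_ge_self abs_mult mult.commute)
  ultimately show ?thesis by (simp flip: exp_add)
qed

text \<open>
  The inequalities for \<open>c\<close> say that the line \<open>Re u = c\<close> has all poles of \<open>\<Gamma>(u)\<close>, \<open>\<Gamma>(\<alpha> + u)\<close>, \<open>\<Gamma>(b + u)\<close> on its left
  and the poles of \<open>\<Gamma>(n + 1 - u)\<close> on its right. The number \<open>\<eta>\<close> introduced below is the rate of decay of
  the integrand in vertical direction: \<open>1 / sin (\<pi>u)\<close> contributes \<open>\<pi>\<close>, of which \<open>z\<^sup>-\<^sup>u\<close> uses up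
  \<open>\<bar>arg z\<bar>\<close>.
\<close>

locale cauchy_laguerre_G =
  fixes \<alpha> b c :: real and n :: nat and z :: complex
  assumes c: "0 < c" "c < 1" "- \<alpha> < c" "- b < c"
    and z: "z \<notin> \<real>\<^sub>\<le>\<^sub>0"
begin

abbreviation "upper \<equiv> [- of_nat n, of_real \<alpha> + of_nat n + 1 :: complex]"
abbreviation "lower \<equiv> [0, of_real \<alpha>, of_real b :: complex]"
definition "left = meijer_left_poles 3 lower"
definition "right = meijer_right_poles 1 upper"
abbreviation "poles \<equiv> left \<union> right"
definition "\<Phi> = meijer_integrand 3 1 upper lower z"
abbreviation "\<eta> \<equiv> pi - \<bar>Im (Ln z)\<bar>"

lemma left_pole_iff:
  "u \<in> left \<longleftrightarrow> u \<in> \<int>\<^sub>\<le>\<^sub>0 \<or> of_real \<alpha> + u \<in> \<int>\<^sub>\<le>\<^sub>0 \<or> of_real b + u \<in> \<int>\<^sub>\<le>\<^sub>0"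
  by (auto simp: left_def meijer_left_poles_def numeral_3_eq_3 less_Suc_eq ex_disj_distrib)

lemma right_pole_iff: "u \<in> right \<longleftrightarrow> of_nat n + 1 - u \<in> \<int>\<^sub>\<le>\<^sub>0"
  by (simp add: right_def meijer_right_poles_def add.commute)

lemma left_pole_real: "u \<in> left \<Longrightarrow> Im u = 0 \<and> Re u < c"
  using c by (auto simp: left_pole_iff complex_eq_iff elim!: nonpos_Ints_cases')

lemma right_pole_real: "u \<in> right \<Longrightarrow> Im u = 0 \<and> Re u \<ge> 1"
  by (auto simp: right_pole_iff complex_eq_iff elim!: nonpos_Ints_cases')

lemma closed_poles: "closed poles"
proof -
  have "poles = (\<lambda>u. u) -` \<int>\<^sub>\<le>\<^sub>0 \<union> (\<lambda>u. of_real \<alpha> + u) -` \<int>\<^sub>\<le>\<^sub>0 \<union> (\<lambda>u. of_real b + u) -` \<int>\<^sub>\<le>\<^sub>0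
        \<union> (\<lambda>u. of_nat n + 1 - u) -` \<int>\<^sub>\<le>\<^sub>0"
    by (auto simp: left_pole_iff right_pole_iff)
  also have "closed \<dots>"
    by (intro closed_Un continuous_closed_vimage continuous_intros) auto
  finally show ?thesis .
qed

lemma finite_poles_ball: "finite (poles \<inter> ball 0 M)"
proof -
  define N where "N = nat \<lceil>M + \<bar>\<alpha>\<bar> + \<bar>b\<bar> + n + 1\<rceil>"
  have le: "k \<le> N" if "cmod u < M" "x + s * u = - of_nat k" "cmod x \<le> \<bar>\<alpha>\<bar> + \<bar>b\<bar> + n + 1" "cmod s = 1"
    for u x s :: complex and k
  proof -
    have "real k = cmod (x + s * u)" using that by simp
    also have "\<dots> \<le> cmod x + cmod (s * u)" by (rule norm_triangle_ineq)
    finally show ?thesis using that by (simp add: norm_mult N_def) linarith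
  qed
  have "poles \<inter> ball 0 M \<subseteq> (\<lambda>k. - of_nat k) ` {..N} \<union> (\<lambda>k. - of_nat k - of_real \<alpha>) ` {..N}
     \<union> (\<lambda>k. - of_nat k - of_real b) ` {..N} \<union> (\<lambda>k. of_nat n + 1 + of_nat k) ` {..N}"
    (is "_ \<subseteq> ?A \<union> ?B \<union> ?C \<union> ?D")
  proof
    fix u assume "u \<in> poles \<inter> ball 0 M"
    then have M: "cmod u < M" and "u \<in> left \<or> u \<in> right" by auto
    then consider k where "u = - of_nat k" | k where "of_real \<alpha> + u = - of_nat k"
      | k where "of_real b + u = - of_nat k" | k where "of_nat n + 1 - u = - of_nat k"
      by (auto simp: left_pole_iff right_pole_iff elim!: nonpos_Ints_cases')
    then show "u \<in> ?A \<union> ?B \<union> ?C \<union> ?D"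
    proof cases
      case (1 k)
      then have "k \<le> N" using le[OF M, of 0 1 k] by simp
      with 1 show ?thesis by blast
    next
      case (2 k)
      then have "k \<le> N" using le[OF M, of "of_real \<alpha>" 1 k] by simp
      moreover have "u = - of_nat k - of_real \<alpha>" using 2 by (simp add: algebra_simps)
      ultimately show ?thesis by blast
    next
      case (3 k)
      then have "k \<le> N" using le[OF M, of "of_real b" 1 k] by simp
      moreover have "u = - of_nat k - of_real b" using 3 by (simp add: algebra_simps)
      ultimately show ?thesis by blast
    next
      case (4 k)
      have "cmod (of_nat n + 1) = real n + 1"
        using norm_of_nat[of "n + 1", where 'a = complex] by (simp only: of_nat_add of_nat_1)
      then have "k \<le> N" using le[OF M, of "of_nat n + 1" "-1" k] 4 by simp
      moreover have "u = of_nat n + 1 + of_nat k" using 4 by (simp add: algebra_simps)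
      ultimately show ?thesis by blast
    qed
  qed
  then show ?thesis by (rule finite_subset) auto
qed

lemma z_nonzero: "z \<noteq> 0" using z by auto

lemma eta_pos: "\<eta> > 0"
  using abs_Im_Ln_less_pi[OF z] by simp

lemma Phi_altdef:
  "\<Phi> u = Gamma u * Gamma (of_real \<alpha> + u) * Gamma (of_real b + u) * Gamma (of_nat n + 1 - u)
     * rGamma (of_real \<alpha> + of_nat n + 1 + u) * z powr (- u)"
  by (simp add: \<Phi>_def meijer_integrand_def numeral_3_eq_3 rGamma_inverse_Gamma divide_inverse add_ac mult_ac)

lemma holomorphic_Phi: "\<Phi> holomorphic_on - poles"
proof -
  have "(\<lambda>u. Gamma u * Gamma (of_real \<alpha> + u) * Gamma (of_real b + u) * Gamma (of_nat n + 1 - u)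
     * rGamma (of_real \<alpha> + of_nat n + 1 + u) * z powr (- u)) holomorphic_on - poles"
    by (intro holomorphic_intros) (auto simp: left_pole_iff right_pole_iff z_nonzero)
  then show ?thesis by (simp add: Phi_altdef [abs_def])
qed

text \<open>
  By the reflection formula \<open>\<Gamma>(u) \<Gamma>(n + 1 - u)\<close> is \<open>\<pi> / sin (\<pi>u)\<close> times a polynomial, and the two Gamma
  factors that involve \<open>\<alpha>\<close> leave a rational function. The restriction to \<open>Re u < 1\<close> keeps \<open>u\<close> away from
  \<open>1, ..., n\<close>, where the product on the right is \<open>0\<close> by convention while \<open>\<Phi>\<close> has a finite value.
\<close>

lemma Phi_sine_form:
  assumes "u \<notin> left" "Re u < 1"
  shows "\<Phi> u = pochhammer (1 - u) n / pochhammer (of_real \<alpha> + u) (n + 1)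
           * (of_real pi / sin (of_real pi * u)) * Gamma (of_real b + u) * z powr (- u)"
proof -
  have "1 - u \<notin> \<int>\<^sub>\<le>\<^sub>0"
    using assms by (auto simp: complex_eq_iff elim!: nonpos_Ints_cases')
  then have 1: "Gamma (of_nat n + 1 - u) = pochhammer (1 - u) n * Gamma (1 - u)"
    using pochhammer_Gamma[of "1 - u" n] by (simp add: Gamma_eq_zero_iff field_simps)
  have "of_real \<alpha> + u \<notin> \<int>\<^sub>\<le>\<^sub>0" using assms by (auto simp: left_pole_iff)
  then have 2: "Gamma (of_real \<alpha> + u) * rGamma (of_real \<alpha> + of_nat n + 1 + u)
      = 1 / pochhammer (of_real \<alpha> + u) (n + 1)"
    using pochhammer_Gamma[of "of_real \<alpha> + u" "n + 1"]
    by (simp add: rGamma_inverse_Gamma divide_inverse add_ac)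
  have "\<Phi> u = (Gamma u * Gamma (1 - u)) * pochhammer (1 - u) n *
     (Gamma (of_real \<alpha> + u) * rGamma (of_real \<alpha> + of_nat n + 1 + u)) * Gamma (of_real b + u) * z powr (- u)"
    unfolding Phi_altdef 1 by (simp only: mult_ac)
  then show ?thesis unfolding 2 Gamma_reflection_complex by (simp add: mult_ac)
qed

text \<open>
  The single estimate behind all limits: \<open>e\<^bsup>Re u\<^esup>\<close> makes everything far to the left negligible, and
  \<open>e\<^bsup>-\<eta>\<bar>Im u\<bar>\<^esup>\<close> everything far up or down. For given parameters the constant depends only on the distance \<open>D\<close> kept from the poles.
\<close>

lemma Phi_bound:
  assumes "D > 0"
  obtains C where "C \<ge> 0"
    "\<And>u. Re u \<le> c \<Longrightarrow> (\<And>p. p \<in> left \<Longrightarrow> D \<le> dist u p) \<Longrightarrow>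
        cmod (\<Phi> u) \<le> C * exp (Re u) * exp (- \<eta> * \<bar>Im u\<bar>)"
proof -
  define d where "d = min D (1 - c)"
  have d: "d > 0" "d \<le> D" "d \<le> 1 - c" using assms c by (auto simp: d_def)
  \<comment> \<open>The rate asked of \<open>\<Gamma>(b + u)\<close> absorbs \<open>\<bar>z\<bar>\<^bsup>-Re u\<^esup>\<close> and leaves \<open>e\<^bsup>Re u\<^esup>\<close>.\<close>
  define l where "l = 1 + ln (cmod z)"
  obtain C1 where C1: "C1 \<ge> 0" "\<And>w. Re w \<le> b + c \<Longrightarrow> (\<And>k::nat. d \<le> cmod (w + of_nat k))
       \<Longrightarrow> cmod (Gamma w) \<le> C1 * exp (l * Re w)"
    using Gamma_superexponential_decay[OF d(1)] by metis
  obtain \<kappa> where \<kappa>: "\<kappa> > 0" "\<And>u. (\<And>k::int. d \<le> cmod (u - of_int k))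
       \<Longrightarrow> \<kappa> * exp (pi * \<bar>Im u\<bar>) \<le> cmod (sin (of_real pi * u))"
    using sin_pi_lower_bound[OF d(1)] by metis
  \<comment> \<open>\<open>Q\<close> bounds the quotient of the \<open>j\<close>-th factors of the two Pochhammer symbols.\<close>
  define Q where "Q = 1 + (\<bar>\<alpha>\<bar> + 2 * real n + 1) / d"
  have Q: "Q \<ge> 1" using d by (simp add: Q_def)
  define C where "C = Q ^ n / d * (pi / \<kappa>) * (C1 * exp (l * b))"
  show ?thesis
  proof (rule that)
    show "C \<ge> 0" using Q d \<kappa> C1 by (auto simp: C_def)
    fix u assume u: "Re u \<le> c" and far: "\<And>p. p \<in> left \<Longrightarrow> D \<le> dist u p"
    have "u \<notin> left" using far[of u] assms by auto
    have far_int: "d \<le> cmod (u - of_int k)" for k :: int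
    proof (cases "k \<le> 0")
      case True
      then have "of_int k \<in> left" by (simp add: left_pole_iff nonpos_Ints_of_int)
      then show ?thesis using far d by (force simp: dist_norm)
    next
      case False
      then have "1 - c \<le> \<bar>Re (u - of_int k)\<bar>" using u by simp
      also have "\<dots> \<le> cmod (u - of_int k)" by (rule abs_Re_le_cmod)
      finally show ?thesis using d by simp
    qed
    have far_shift: "d \<le> cmod (of_real s + u + of_nat k)" if "s = \<alpha> \<or> s = b" for k :: nat and s
    proof -
      have "- of_real s - of_nat k \<in> left" using that by (auto simp: left_pole_iff)
      from far[OF this] show ?thesis using d by (simp add: dist_norm algebra_simps)
    qed
    have sin: "cmod (of_real pi / sin (of_real pi * u)) \<le> pi / \<kappa> * exp (- pi * \<bar>Im u\<bar>)"
    proof -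
      have "cmod (of_real pi / sin (of_real pi * u)) \<le> pi / (\<kappa> * exp (pi * \<bar>Im u\<bar>))"
        unfolding norm_divide using \<kappa>(1) by (intro frac_le \<kappa>(2) far_int) auto
      then show ?thesis by (simp add: exp_minus field_simps)
    qed
    have gam: "cmod (Gamma (of_real b + u)) \<le> C1 * exp (l * b) * exp (l * Re u)"
      using C1(2)[of "of_real b + u"] u far_shift[of b] by (simp add: exp_add algebra_simps)
    have rat: "cmod (pochhammer (1 - u) n / pochhammer (of_real \<alpha> + u) (n + 1)) \<le> Q ^ n / d"
    proof -
      have factor: "cmod (1 - u + of_nat j) \<le> Q * cmod (of_real \<alpha> + u + of_nat j)" if "j < n" for j
      proof -
        let ?v = "of_real \<alpha> + u + of_nat j"
        have "1 - u + of_nat j = of_real (\<alpha> + 2 * real j + 1) - ?v" by simp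
        also have "cmod \<dots> \<le> \<bar>\<alpha> + 2 * real j + 1\<bar> + cmod ?v"
          by (metis norm_triangle_ineq4 norm_of_real)
        also have "\<bar>\<alpha> + 2 * real j + 1\<bar> \<le> \<bar>\<alpha>\<bar> + 2 * real n + 1" using that by linarith
        also have "\<dots> \<le> (\<bar>\<alpha>\<bar> + 2 * real n + 1) * (cmod ?v / d)"
          using far_shift[of \<alpha> j] d mult_left_mono[of 1 "cmod ?v / d" "\<bar>\<alpha>\<bar> + 2 * real n + 1"] by simp
        finally show ?thesis by (simp add: Q_def algebra_simps add_divide_distrib)
      qed
      have "cmod (pochhammer (1 - u) n) \<le> Q ^ n * cmod (pochhammer (of_real \<alpha> + u) n)"
      proof -
        have "cmod (pochhammer (1 - u) n) = (\<Prod>j<n. cmod (1 - u + of_nat j))"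
          by (simp only: pochhammer_prod prod_norm lessThan_atLeast0)
        also have "\<dots> \<le> (\<Prod>j<n. Q * cmod (of_real \<alpha> + u + of_nat j))"
          by (intro prod_mono) (auto simp: factor)
        also have "\<dots> = Q ^ n * cmod (pochhammer (of_real \<alpha> + u) n)"
          by (simp only: pochhammer_prod prod_norm lessThan_atLeast0 prod.distrib prod_constant card_lessThan card_atLeastLessThan diff_zero)
        finally show ?thesis .
      qed
      moreover have "pochhammer (of_real \<alpha> + u) n \<noteq> 0"
      proof
        assume "pochhammer (of_real \<alpha> + u) n = 0"
        then obtain k where "of_real \<alpha> + u = - of_nat k" by (auto simp: pochhammer_eq_0_iff)
        then show False using far_shift[of \<alpha> k] d by simp
      qed
      ultimately have 1: "cmod (pochhammer (1 - u) n / pochhammer (of_real \<alpha> + u) n) \<le> Q ^ n"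
        by (simp add: norm_divide divide_le_eq)
      have "cmod (pochhammer (1 - u) n / pochhammer (of_real \<alpha> + u) (n + 1)) =
         cmod (pochhammer (1 - u) n / pochhammer (of_real \<alpha> + u) n) / cmod (of_real \<alpha> + u + of_nat n)"
        by (simp add: pochhammer_Suc norm_divide norm_mult)
      also have "\<dots> \<le> Q ^ n / d"
        using Q d by (intro frac_le 1 far_shift) auto
      finally show ?thesis .
    qed
    have "cmod (\<Phi> u) \<le> Q ^ n / d * (pi / \<kappa> * exp (- pi * \<bar>Im u\<bar>)) * (C1 * exp (l * b) * exp (l * Re u))
          * (exp (- ln (cmod z) * Re u) * exp (\<bar>Im (Ln z)\<bar> * \<bar>Im u\<bar>))"
      unfolding Phi_sine_form[OF \<open>u \<notin> left\<close> order.strict_trans1[OF u c(2)]] norm_mult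
      by (intro mult_mono order_trans[OF _ rat] sin gam norm_powr_uminus_le z_nonzero) (use Q d \<kappa> C1 in \<open>auto simp: norm_mult norm_divide\<close>)
    also have "\<dots> = C * (exp (l * Re u) * exp (- ln (cmod z) * Re u)) * (exp (- pi * \<bar>Im u\<bar>) * exp (\<bar>Im (Ln z)\<bar> * \<bar>Im u\<bar>))"
      by (simp add: C_def mult_ac)
    also have "exp (l * Re u) * exp (- ln (cmod z) * Re u) = exp (Re u)"
      by (simp add: l_def algebra_simps flip: exp_add)
    also have "exp (- pi * \<bar>Im u\<bar>) * exp (\<bar>Im (Ln z)\<bar> * \<bar>Im u\<bar>) = exp (- \<eta> * \<bar>Im u\<bar>)"
      by (simp add: algebra_simps flip: exp_add)
    finally show "cmod (\<Phi> u) \<le> C * exp (Re u) * exp (- \<eta> * \<bar>Im u\<bar>)" .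
  qed
qed

end

section \<open>Winding numbers of truncated contours\<close>

lemma piece_eq_subpath:
  fixes \<gamma> :: "real \<Rightarrow> complex"
  assumes "A < B"
  shows "\<gamma> \<circ> linepath s t = subpath ((s - A) / (B - A)) ((t - A) / (B - A)) (\<gamma> \<circ> linepath A B)"
proof
  fix x
  have "linepath A B (((t - A) / (B - A) - (s - A) / (B - A)) * x + (s - A) / (B - A)) = linepath s t x"
    using assms by (simp add: linepath_def divide_simps) (simp add: algebra_simps)
  then show "(\<gamma> \<circ> linepath s t) x
      = subpath ((s - A) / (B - A)) ((t - A) / (B - A)) (\<gamma> \<circ> linepath A B) x"
    by (simp add: subpath_def)
qed

lemma path_image_piece:
  fixes \<gamma> :: "real \<Rightarrow> complex"
  assumes "s \<le> t"
  shows "path_image (\<gamma> \<circ> linepath s t) = \<gamma> ` {s..t}"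
proof -
  have "path_image (\<gamma> \<circ> linepath s t) = \<gamma> ` closed_segment s t"
    by (simp only: path_image_compose path_image_linepath)
  then show ?thesis using assms by (simp add: closed_segment_eq_real_ivl)
qed

lemma contour_integral_piece_combine:
  fixes \<gamma> :: "real \<Rightarrow> complex"
  assumes "valid_path (\<gamma> \<circ> linepath A B)" "f contour_integrable_on (\<gamma> \<circ> linepath A B)" "A < B"
    and "{r, s, t} \<subseteq> {A..B}"
  shows "contour_integral (\<gamma> \<circ> linepath r s) f + contour_integral (\<gamma> \<circ> linepath s t) f
       = contour_integral (\<gamma> \<circ> linepath r t) f"
  unfolding piece_eq_subpath[OF assms(3), of \<gamma> r s] piece_eq_subpath[OF assms(3), of \<gamma> s t]
    piece_eq_subpath[OF assms(3), of \<gamma> r t]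
  by (rule contour_integral_subpath_combine) (use assms in \<open>auto simp: divide_simps\<close>)

lemma continuous_on_piece:
  fixes \<gamma> :: "real \<Rightarrow> complex"
  assumes "valid_path (\<gamma> \<circ> linepath s t)" "s < t"
  shows "continuous_on {s..t} \<gamma>"
proof -
  have "continuous_on {0..1} (\<gamma> \<circ> linepath s t)"
    using assms(1) valid_path_imp_path path_def by blast
  then have "continuous_on {s..t} (\<lambda>x. (\<gamma> \<circ> linepath s t) ((x - s) / (t - s)))"
    by (rule continuous_on_compose2) (use assms(2) in \<open>auto intro!: continuous_intros simp: divide_simps\<close>)
  moreover have "linepath s t ((x - s) / (t - s)) = x" for x
    using assms(2) by (simp add: linepath_def divide_simps) (simp add: algebra_simps)
  ultimately show ?thesis by simp
qed

text \<open>
  A branch of the logarithm of \<open>\<sigma> (p - u)\<close>, with \<open>\<sigma> = \<plusminus>1\<close>, is a primitive of \<open>1 / (u - p)\<close> off the ray that starts at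
  \<open>p\<close> and points to the right (\<open>\<sigma> = 1\<close>) or to the left (\<open>\<sigma> = -1\<close>). All winding numbers below are
  computed with these two branches.
\<close>

lemma has_contour_integral_inverse_off_ray:
  assumes "valid_path g" "\<sigma> \<noteq> 0" "\<And>u. u \<in> path_image g \<Longrightarrow> \<sigma> * (p - u) \<notin> \<real>\<^sub>\<le>\<^sub>0"
  shows "((\<lambda>u. 1 / (u - p)) has_contour_integral
      (Ln (\<sigma> * (p - pathfinish g)) - Ln (\<sigma> * (p - pathstart g)))) g"
proof (rule contour_integral_primitive[OF _ assms(1) subset_refl])
  fix u assume "u \<in> path_image g"
  then have "\<sigma> * (p - u) \<notin> \<real>\<^sub>\<le>\<^sub>0" by (rule assms(3))
  moreover from this have "p \<noteq> u" by auto
  ultimately show "((\<lambda>u. Ln (\<sigma> * (p - u))) has_field_derivative 1 / (u - p)) (at u within path_image g)"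
    using assms(2) by (auto intro!: derivative_eq_intros simp: divide_simps)
qed

lemma winding_number_off_ray:
  assumes "valid_path g" "pathfinish g = pathstart g" "\<sigma> \<noteq> 0"
    "\<And>u. u \<in> path_image g \<Longrightarrow> \<sigma> * (p - u) \<notin> \<real>\<^sub>\<le>\<^sub>0"
  shows "winding_number g p = 0"
proof -
  have "p \<notin> path_image g" using assms(4)[of p] by auto
  then show ?thesis
    using has_contour_integral_inverse_off_ray[OF assms(1,3,4)] assms(2)
    by (simp add: winding_number_valid_path[OF assms(1)] contour_integral_unique)
qed

lemma not_nonpos_Reals_if:
  "Im w \<noteq> 0 \<or> Re w > 0 \<Longrightarrow> w \<notin> \<real>\<^sub>\<le>\<^sub>0"
  by (auto simp: complex_nonpos_Reals_iff)

abbreviation contour_loop :: "(real \<Rightarrow> complex) \<Rightarrow> real \<Rightarrow> real \<Rightarrow> real \<Rightarrow> complex" where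
  "contour_loop \<gamma> s t \<equiv> (\<gamma> \<circ> linepath s t) +++ linepath (\<gamma> t) (\<gamma> s)"

text \<open>
  The pieces of the contour between \<open>s'\<close> and \<open>s\<close> and between \<open>t\<close> and \<open>t'\<close> lie off the real axis, and the closing
  segments lie to the left of \<open>p\<close>. So all of them avoid the ray to the right of \<open>p\<close>, one logarithm
  serves for all, and its boundary terms cancel.
\<close>

lemma winding_number_contour_loop_transfer:
  assumes valid: "\<And>s t. s < t \<Longrightarrow> valid_path (\<gamma> \<circ> linepath s t)"
    and order: "s' < s" "s < t" "t < t'"
    and below: "\<And>\<tau>. \<tau> \<le> s \<Longrightarrow> Im (\<gamma> \<tau>) < 0" and above: "\<And>\<tau>. t \<le> \<tau> \<Longrightarrow> Im (\<gamma> \<tau>) > 0"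
    and p: "Im p = 0" "p \<notin> range \<gamma>"
    and ends: "Re (\<gamma> s) < Re p" "Re (\<gamma> t) < Re p" "Re (\<gamma> s') < Re p" "Re (\<gamma> t') < Re p"
  shows "winding_number (contour_loop \<gamma> s t) p = winding_number (contour_loop \<gamma> s' t') p"
proof -
  let ?f = "\<lambda>u. 1 / (u - p)"
  have seg: "(?f has_contour_integral Ln (p - \<gamma> x) - Ln (p - \<gamma> y)) (linepath (\<gamma> y) (\<gamma> x))"
    and off: "p \<notin> closed_segment (\<gamma> y) (\<gamma> x)"
    if "Re (\<gamma> x) < Re p" "Re (\<gamma> y) < Re p" for x y
  proof -
    have "convex {u. Re u < Re p}" by (rule convex_halfspace_Re_lt)
    then have sub: "closed_segment (\<gamma> y) (\<gamma> x) \<subseteq> {u. Re u < Re p}"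
      using that by (intro closed_segment_subset) auto
    then show "p \<notin> closed_segment (\<gamma> y) (\<gamma> x)" by auto
    have "1 * (p - u) \<notin> \<real>\<^sub>\<le>\<^sub>0" if "u \<in> closed_segment (\<gamma> y) (\<gamma> x)" for u
      using sub that by (intro not_nonpos_Reals_if) auto
    then show "(?f has_contour_integral Ln (p - \<gamma> x) - Ln (p - \<gamma> y)) (linepath (\<gamma> y) (\<gamma> x))"
      using has_contour_integral_inverse_off_ray[of "linepath (\<gamma> y) (\<gamma> x)" 1 p] by simp
  qed
  have integrable: "?f contour_integrable_on (\<gamma> \<circ> linepath x y)" if "x < y" for x y
    by (rule contour_integrable_holomorphic_simple[of _ "- {p}"])
      (use p valid that in \<open>auto intro!: holomorphic_intros simp: path_image_piece\<close>)
  have tail: "contour_integral (\<gamma> \<circ> linepath x y) ?f = Ln (p - \<gamma> y) - Ln (p - \<gamma> x)"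
    if "x < y" "y \<le> s \<or> t \<le> x" for x y
  proof -
    have "1 * (p - u) \<notin> \<real>\<^sub>\<le>\<^sub>0" if u: "u \<in> path_image (\<gamma> \<circ> linepath x y)" for u
    proof -
      obtain \<tau> where \<tau>: "u = \<gamma> \<tau>" "x \<le> \<tau>" "\<tau> \<le> y"
        using u \<open>x < y\<close> path_image_piece[of x y \<gamma>] by auto
      have "\<tau> \<le> s \<or> t \<le> \<tau>" using \<tau> \<open>y \<le> s \<or> t \<le> x\<close> by linarith
      then have "Im u \<noteq> 0" using below[of \<tau>] above[of \<tau>] \<tau>(1) by force
      then show ?thesis using p(1) by (intro not_nonpos_Reals_if) simp
    qed
    then have "(?f has_contour_integral Ln (p - \<gamma> y) - Ln (p - \<gamma> x)) (\<gamma> \<circ> linepath x y)"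
      using has_contour_integral_inverse_off_ray[of "\<gamma> \<circ> linepath x y" 1 p] valid that
      by (simp add: pathstart_compose pathfinish_compose)
    then show ?thesis by (rule contour_integral_unique)
  qed
  have loop: "winding_number (contour_loop \<gamma> x y) p = 1 / (2 * of_real pi * \<i>) *
      (contour_integral (\<gamma> \<circ> linepath x y) ?f + (Ln (p - \<gamma> x) - Ln (p - \<gamma> y)))"
    if "x < y" "Re (\<gamma> x) < Re p" "Re (\<gamma> y) < Re p" for x y
  proof -
    have "valid_path (contour_loop \<gamma> x y)"
      using valid that by (intro valid_path_join) (auto simp: pathfinish_compose)
    moreover have "p \<notin> path_image (contour_loop \<gamma> x y)"
      using p off that by (auto simp: path_image_join pathfinish_compose path_image_piece)
    ultimately have "winding_number (contour_loop \<gamma> x y) p = 1 / (2 * of_real pi * \<i>) *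
       contour_integral (contour_loop \<gamma> x y) ?f"
      by (simp add: winding_number_valid_path)
    also have "contour_integral (contour_loop \<gamma> x y) ?f =
      contour_integral (\<gamma> \<circ> linepath x y) ?f + contour_integral (linepath (\<gamma> y) (\<gamma> x)) ?f"
      using seg[OF that(2,3)] integrable valid that
      by (intro contour_integral_join) (auto intro: has_contour_integral_integrable)
    finally show ?thesis unfolding contour_integral_unique[OF seg[OF that(2,3)]] .
  qed
  have comb: "contour_integral (\<gamma> \<circ> linepath x y) ?f + contour_integral (\<gamma> \<circ> linepath y w) ?f
       = contour_integral (\<gamma> \<circ> linepath x w) ?f" if "{x, y, w} \<subseteq> {s'..t'}" for x y w
    using order that by (intro contour_integral_piece_combine valid integrable) auto
  have "contour_integral (\<gamma> \<circ> linepath s' t') ?f =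
     contour_integral (\<gamma> \<circ> linepath s' s) ?f + contour_integral (\<gamma> \<circ> linepath s t) ?f
     + contour_integral (\<gamma> \<circ> linepath t t') ?f"
    using comb[of s' s t] comb[of s' t t'] order by simp
  then show ?thesis
    using loop[of s t] loop[of s' t'] order ends tail[of s' s] tail[of t t'] by simp
qed

context cauchy_laguerre_G
begin

section \<open>From an arbitrary contour to a vertical line\<close>

text \<open>
  The left poles have at most three fractional parts, namely those of \<open>0\<close>, \<open>-\<alpha>\<close> and \<open>-b\<close>. A shift \<open>\<delta>\<close>
  that misses them puts infinitely many vertical lines at a common distance from all left poles.
\<close>

lemma vertical_line_far_from_left_poles:
  obtains \<delta> D where "0 < \<delta>" "\<delta> < 1" "D > 0"
    "\<And>(N::nat) u p. Re u = - (real N + \<delta>) \<Longrightarrow> p \<in> left \<Longrightarrow> D \<le> dist u p"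
proof -
  have "infinite {0<..<1::real}" by (simp add: infinite_Ioo)
  moreover have "finite {frac \<alpha>, frac b}" by simp
  ultimately obtain \<delta> where \<delta>: "0 < \<delta>" "\<delta> < 1" "\<delta> \<noteq> frac \<alpha>" "\<delta> \<noteq> frac b"
    by (metis (no_types, lifting) finite_subset greaterThanLessThan_iff insert_iff subsetI)
  define g where "g x = \<bar>\<delta> - x - of_int (round (\<delta> - x))\<bar>" for x
  have g_min: "g x \<le> \<bar>\<delta> - x - of_int m\<bar>" for x m
    unfolding g_def using round_diff_minimal[of "\<delta> - x" m] by (simp add: abs_minus_commute)
  have g_pos: "g x > 0" if "\<delta> \<noteq> frac x" for x
  proof (rule ccontr)
    assume "\<not> g x > 0"
    then have "\<delta> = x + of_int (round (\<delta> - x))" by (simp add: g_def)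
    then have "frac \<delta> = frac x" by (metis frac_add_of_int_right)
    with that \<delta> show False by (simp add: frac_eq)
  qed
  define D where "D = min (g 0) (min (g \<alpha>) (g b))"
  show ?thesis
  proof (rule that[of \<delta> D])
    show "D > 0" using g_pos \<delta> by (simp add: D_def)
    fix N :: nat and u p assume u: "Re u = - (real N + \<delta>)" and p: "p \<in> left"
    have "g x \<le> \<bar>Re u - Re p\<bar>" if "of_real x + p = - of_nat k" for x k
    proof -
      have "Re p = - x - real k" using that by (simp add: complex_eq_iff)
      then have "\<bar>Re u - Re p\<bar> = \<bar>\<delta> - x - of_int (int k - int N)\<bar>"
        using u by simp
      then show ?thesis using g_min[of x "int k - int N"] by simp
    qed
    from this[of 0] this[of \<alpha>] this[of b] p have "D \<le> \<bar>Re u - Re p\<bar>"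
      unfolding left_pole_iff D_def by (fastforce elim!: nonpos_Ints_cases' simp: min_le_iff_disj)
    also have "\<dots> \<le> dist u p" using abs_Re_le_cmod[of "u - p"] by (simp add: dist_norm)
    finally show "D \<le> dist u p" .
  qed (use \<delta> in auto)
qed

lemma contour_avoids_poles:
  assumes "meijer_contour 3 1 upper lower \<gamma>"
  shows "\<gamma> x \<notin> poles"
proof
  assume *: "\<gamma> x \<in> poles"
  obtain d where d: "d > 0" "\<forall>t. \<forall>c\<in>poles. d \<le> dist (\<gamma> t) c"
    using assms unfolding meijer_contour_def left_def right_def by blast
  from d(2) * have "d \<le> dist (\<gamma> x) (\<gamma> x)" by blast
  with d(1) show False by simp
qed

text \<open>
  The winding numbers agree pole by pole. About a pole to the left of \<open>-X\<close> both are \<open>0\<close>: the loop meets the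
  real axis only where \<open>Re \<gamma> > -X\<close> or on the closing segment. About a pole to the right of \<open>-X\<close> the
  winding number of the loop does not change when \<open>s\<close> and \<open>t\<close> move outwards, so it has the value that the
  definition of a contour prescribes in the limit. The hypothesis that the ends of the contour lie in the
  lower and in the upper half-plane is essential: otherwise a contour could wind about
  remote poles more and more often.
\<close>

lemma contour_integral_loop_eq_rectangle:
  assumes contour: "meijer_contour 3 1 upper lower \<gamma>"
    and order: "s < S" "S < T" "T < t"
    and below: "\<And>\<tau>. \<tau> \<le> S \<Longrightarrow> Im (\<gamma> \<tau>) < 0" and above: "\<And>\<tau>. T \<le> \<tau> \<Longrightarrow> Im (\<gamma> \<tau>) > 0"
    and X: "Re (\<gamma> s) = - X" "Re (\<gamma> t) = - X" "X > 0"
    and mid: "\<And>\<tau>. S \<le> \<tau> \<Longrightarrow> \<tau> \<le> T \<Longrightarrow> Re (\<gamma> \<tau>) > - X"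
    and nopole: "\<And>u. Re u = - X \<Longrightarrow> u \<notin> left"
  shows "contour_integral (contour_loop \<gamma> s t) \<Phi>
       = contour_integral (rectpath (Complex (- X) (- X)) (Complex c X)) \<Phi>"
proof -
  let ?C = "contour_loop \<gamma> s t" and ?R = "rectpath (Complex (- X) (- X)) (Complex c X)"
  have valid: "\<And>s t. s < t \<Longrightarrow> valid_path (\<gamma> \<circ> linepath s t)"
    using contour by (simp add: meijer_contour_def)
  have "s < t" using order by simp
  have avoid: "p \<notin> range \<gamma>" if "p \<in> poles" for p
    using that contour_avoids_poles[OF contour] by auto
  have real: "Im p = 0" if "p \<in> poles" for p
    using that left_pole_real right_pole_real by blast
  have offX: "Re p \<noteq> - X" if "p \<in> poles" for p
    using that nopole right_pole_real[of p] X by force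
  have seg: "Re u = - X" if "u \<in> closed_segment (\<gamma> t) (\<gamma> s)" for u
    using that X by (auto simp: closed_segment_same_Re)
  have validC: "valid_path ?C"
    using valid \<open>s < t\<close> by (intro valid_path_join) (auto simp: pathfinish_compose)
  have imgC: "path_image ?C = \<gamma> ` {s..t} \<union> closed_segment (\<gamma> t) (\<gamma> s)"
    using \<open>s < t\<close> by (subst path_image_join) (auto simp: pathfinish_compose path_image_piece)
  have closedC: "pathfinish ?C = pathstart ?C" by (simp add: pathstart_compose)
  have imgR: "path_image ?R \<subseteq> cbox (Complex (- X) (- X)) (Complex c X)"
    using X c by (intro path_image_rectpath_subset_cbox) auto
  have avoidC: "p \<notin> path_image ?C" if "p \<in> poles" for p
    using avoid[OF that] offX[OF that] seg imgC by auto
  have avoidR: "p \<notin> path_image ?R" if "p \<in> poles" for p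
  proof -
    have "Re p \<noteq> c" using that left_pole_real[of p] right_pole_real[of p] c by force
    then show ?thesis
      using X c real[OF that] offX[OF that] by (subst path_image_rectpath) auto
  qed
  have same_winding: "winding_number ?C p = winding_number ?R p" if p: "p \<in> poles" for p
  proof (cases "Re p < - X")
    case True
    have 1: "winding_number ?R p = 0"
      using True X c by (intro winding_number_rectpath_outside) (auto simp: in_cbox_complex_iff)
    have "winding_number ?C p = 0"
    proof (rule winding_number_off_ray[OF validC closedC, of "-1"])
      fix u assume "u \<in> path_image ?C"
      then consider "u \<in> closed_segment (\<gamma> t) (\<gamma> s)" | \<tau> where "u = \<gamma> \<tau>" "\<tau> \<in> {s..t}"
        unfolding imgC by blast
      then show "- 1 * (p - u) \<notin> \<real>\<^sub>\<le>\<^sub>0"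
      proof cases
        case 1
        then show ?thesis using seg True by (intro not_nonpos_Reals_if) auto
      next
        case 2
        then show ?thesis using below[of \<tau>] above[of \<tau>] mid[of \<tau>] real[OF p] True
          by (intro not_nonpos_Reals_if) force
      qed
    qed simp
    with 1 show ?thesis by simp
  next
    case False
    with offX[OF p] have gt: "- X < Re p" by simp
    define w where "w = winding_number ?R p"
    have w: "w = (if p \<in> left then 1 else 0)"
    proof (cases "p \<in> left")
      case True
      then show ?thesis unfolding w_def using gt left_pole_real[OF True] X
        by (subst winding_number_rectpath) (auto simp: in_box_complex_iff)
    next
      case False
      then have "p \<in> right" using p by auto
      then show ?thesis unfolding w_def using False right_pole_real[of p] X c
        by (subst winding_number_rectpath_outside) (auto simp: in_cbox_complex_iff)
    qed
    have "left \<inter> right = {}" using left_pole_real right_pole_real c by fastforce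
    then have "\<forall>\<^sub>F (s, t) in at_bot \<times>\<^sub>F at_top. winding_number (contour_loop \<gamma> s t) p = w"
      using contour p unfolding meijer_contour_def w left_def right_def by auto
    then obtain P Q where P: "eventually P at_bot" and Q: "eventually Q at_top"
      and PQ: "\<And>s t. P s \<Longrightarrow> Q t \<Longrightarrow> winding_number (contour_loop \<gamma> s t) p = w"
      unfolding eventually_prod_filter by auto
    have "filterlim (\<lambda>t. Re (\<gamma> t)) at_bot at_bot" "filterlim (\<lambda>t. Re (\<gamma> t)) at_bot at_top"
      using contour by (auto simp: meijer_contour_def)
    then have "\<forall>\<^sub>F \<tau> in at_bot. Re (\<gamma> \<tau>) < Re p" "\<forall>\<^sub>F \<tau> in at_top. Re (\<gamma> \<tau>) < Re p"
      by (auto simp: filterlim_at_bot_dense)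
    with P Q have "\<forall>\<^sub>F \<tau> in at_bot. P \<tau> \<and> Re (\<gamma> \<tau>) < Re p \<and> \<tau> < s"
       "\<forall>\<^sub>F \<tau> in at_top. Q \<tau> \<and> Re (\<gamma> \<tau>) < Re p \<and> t < \<tau>"
      using eventually_gt_at_bot[of s] eventually_gt_at_top[of t] by (simp_all add: eventually_conj_iff)
    then have "\<exists>\<tau>. P \<tau> \<and> Re (\<gamma> \<tau>) < Re p \<and> \<tau> < s" "\<exists>\<tau>. Q \<tau> \<and> Re (\<gamma> \<tau>) < Re p \<and> t < \<tau>"
      by (auto dest!: eventually_happens)
    then obtain s' t' where s't': "P s'" "Re (\<gamma> s') < Re p" "s' < s"
        "Q t'" "Re (\<gamma> t') < Re p" "t < t'"
      by blast
    have "winding_number ?C p = winding_number (contour_loop \<gamma> s' t') p"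
      by (rule winding_number_contour_loop_transfer[OF valid])
        (use s't' \<open>s < t\<close> order below above real[OF p] avoid[OF p] X gt in auto)
    also have "\<dots> = w" using PQ s't' by blast
    finally show ?thesis by (simp add: w_def)
  qed
  have "compact (path_image ?C \<union> path_image ?R)"
    using validC by (intro compact_Un compact_path_image) (auto simp: valid_path_imp_path)
  then obtain M where M: "path_image ?C \<union> path_image ?R \<subseteq> ball 0 M"
    using bounded_subset_ballD compact_imp_bounded by blast
  have residues: "contour_integral g \<Phi>
      = 2 * pi * \<i> * (\<Sum>p\<in>poles \<inter> ball 0 M. winding_number g p * residue \<Phi> p)"
    if "valid_path g" "pathfinish g = pathstart g" "path_image g \<subseteq> ball 0 M" "path_image g \<inter> poles = {}" for g
  proof (rule Residue_theorem[of "ball 0 M"])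
    show "\<Phi> holomorphic_on ball 0 M - poles \<inter> ball 0 M"
      by (rule holomorphic_on_subset[OF holomorphic_Phi]) auto
    show "\<forall>p. p \<notin> ball 0 M \<longrightarrow> winding_number g p = 0"
      using that by (intro allI impI winding_number_zero_outside[of g "ball 0 M"])
        (auto simp: valid_path_imp_path)
  qed (use that in \<open>auto simp: finite_poles_ball\<close>)
  have "contour_integral ?C \<Phi> = 2 * pi * \<i> * (\<Sum>p\<in>poles \<inter> ball 0 M. winding_number ?C p * residue \<Phi> p)"
    using validC closedC M avoidC by (intro residues) auto
  also have "\<dots> = 2 * pi * \<i> * (\<Sum>p\<in>poles \<inter> ball 0 M. winding_number ?R p * residue \<Phi> p)"
    using same_winding by simp
  also have "\<dots> = contour_integral ?R \<Phi>"
    using M avoidR by (intro residues[symmetric]) auto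
  finally show ?thesis .
qed

end

context cauchy_laguerre_G
begin

lemma holomorphic_contour_integrable_Phi:
  assumes "valid_path g" "path_image g \<inter> poles = {}"
  shows "\<Phi> contour_integrable_on g"
  by (rule contour_integrable_holomorphic_simple[OF holomorphic_Phi])
    (use assms open_Compl[OF closed_poles] in auto)

lemma contour_crosses_level:
  assumes contour: "meijer_contour 3 1 upper lower \<gamma>" and "S < T"
    and "\<And>\<tau>. S \<le> \<tau> \<Longrightarrow> \<tau> \<le> T \<Longrightarrow> Re (\<gamma> \<tau>) > x"
  obtains s t where "s < S" "T < t" "Re (\<gamma> s) = x" "Re (\<gamma> t) = x"
proof -
  have cont: "continuous_on {u..v} (\<lambda>\<tau>. Re (\<gamma> \<tau>))" if "u < v" for u v
    using contour that unfolding meijer_contour_def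
    by (intro continuous_intros continuous_on_piece) auto
  have lim: "filterlim (\<lambda>t. Re (\<gamma> t)) at_bot at_bot" "filterlim (\<lambda>t. Re (\<gamma> t)) at_bot at_top"
    using contour by (auto simp: meijer_contour_def)
  have "\<forall>\<^sub>F \<tau> in at_bot. Re (\<gamma> \<tau>) < x \<and> \<tau> < S" "\<forall>\<^sub>F \<tau> in at_top. Re (\<gamma> \<tau>) < x \<and> T < \<tau>"
    using lim by (auto simp: filterlim_at_bot_dense eventually_conj_iff eventually_gt_at_bot eventually_gt_at_top)
  then have "\<exists>\<tau>. Re (\<gamma> \<tau>) < x \<and> \<tau> < S" "\<exists>\<tau>. Re (\<gamma> \<tau>) < x \<and> T < \<tau>"
    by (auto dest!: eventually_happens)
  then obtain s' t' where s't': "Re (\<gamma> s') < x" "s' < S" "Re (\<gamma> t') < x" "T < t'" by blast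
  have ST: "Re (\<gamma> S) > x" "Re (\<gamma> T) > x" using assms by auto
  obtain s where s: "s' \<le> s" "s \<le> S" "Re (\<gamma> s) = x"
    using IVT'[of "\<lambda>\<tau>. Re (\<gamma> \<tau>)" s' x S] s't' ST cont[of s' S] by auto
  obtain t where t: "T \<le> t" "t \<le> t'" "Re (\<gamma> t) = x"
    using IVT2'[of "\<lambda>\<tau>. Re (\<gamma> \<tau>)" t' x T] s't' ST cont[of T t'] by auto
  have "s \<noteq> S" "t \<noteq> T" using s t ST by auto
  then show ?thesis using that[of s t] s t by auto
qed

text \<open>
  Since \<open>s\<close>, \<open>t\<close> and \<open>Y\<close> can be taken arbitrarily far out, any limit of the integrals over \<open>\<gamma>\<close> must be the limit
  of the integrals over the vertical segments. Rectangles of height \<open>2X\<close> and left abscissa \<open>-X\<close>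
  suffice: the left side has length \<open>2X\<close> but an integrand of order \<open>e\<^bsup>-X\<^esup>\<close>, the horizontal sides
  have length \<open>X + c\<close> and an integrand of order \<open>e\<^bsup>-\<eta>X\<^esup>\<close>.
\<close>

lemma contour_integral_near_vertical_line:
  assumes contour: "meijer_contour 3 1 upper lower \<gamma>" and "e > 0"
  obtains s t Y where "s \<le> s0" "t0 \<le> t" "Y0 \<le> Y"
    "cmod (contour_integral (\<gamma> \<circ> linepath s t) \<Phi>
        - contour_integral (linepath (Complex c (- Y)) (Complex c Y)) \<Phi>) < e"
proof -
  obtain \<delta> D where \<delta>: "0 < \<delta>" "\<delta> < 1" and D: "D > 0"
    "\<And>(N::nat) u p. Re u = - (real N + \<delta>) \<Longrightarrow> p \<in> left \<Longrightarrow> D \<le> dist u p"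
    using vertical_line_far_from_left_poles by blast
  obtain C where C: "C \<ge> 0"
    "\<And>u. Re u \<le> c \<Longrightarrow> (\<And>p. p \<in> left \<Longrightarrow> min D 1 \<le> dist u p) \<Longrightarrow>
        cmod (\<Phi> u) \<le> C * exp (Re u) * exp (- \<eta> * \<bar>Im u\<bar>)"
    using Phi_bound[of "min D 1"] D by auto
  have "bounded (range (\<lambda>t. Im (\<gamma> t)))" using contour by (simp add: meijer_contour_def)
  then obtain H where H: "\<And>t. \<bar>Im (\<gamma> t)\<bar> \<le> H" by (auto simp: bounded_iff)
  \<comment> \<open>The bounds for the left side, for the segment that closes the loop, and for the two horizontal sides.\<close>
  define E where "E X = C * exp (- X) * (2 * X) + C * exp (- X) * (2 * H)
       + 2 * (C * exp c * exp (- \<eta> * X) * (X + c))" for X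
  have "((\<lambda>X. exp (- k * X) * (X + c)) \<longlongrightarrow> 0) at_top" if "k > 0" for k :: real
    using that by real_asymp
  from this[OF eta_pos] have *: "((\<lambda>X. exp (- \<eta> * X) * (X + c)) \<longlongrightarrow> 0) at_top" .
  have "((\<lambda>X::real. exp (- X) * X) \<longlongrightarrow> 0) at_top" "((\<lambda>X::real. exp (- X)) \<longlongrightarrow> 0) at_top"
    by real_asymp+
  then have "((\<lambda>X. 2 * C * (exp (- X) * X) + 2 * C * H * exp (- X)
      + 2 * C * exp c * (exp (- \<eta> * X) * (X + c))) \<longlongrightarrow> 2 * C * 0 + 2 * C * H * 0 + 2 * C * exp c * 0) at_top"
    by (intro tendsto_add tendsto_mult tendsto_const *)
  then have "(E \<longlongrightarrow> 0) at_top" unfolding E_def by (simp add: mult_ac)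
  then have "\<forall>\<^sub>F X in at_top. E X < e" using \<open>e > 0\<close> by (rule order_tendstoD)
  then obtain X0 where X0: "\<And>X. X0 \<le> X \<Longrightarrow> E X < e" by (auto simp: eventually_at_top_linorder)
  have "\<forall>\<^sub>F t in at_bot. Im (\<gamma> t) < 0" "\<forall>\<^sub>F t in at_top. Im (\<gamma> t) > 0"
    using contour by (auto simp: meijer_contour_def)
  then obtain S' T' where S': "\<And>\<tau>. \<tau> \<le> S' \<Longrightarrow> Im (\<gamma> \<tau>) < 0" and T': "\<And>\<tau>. T' \<le> \<tau> \<Longrightarrow> Im (\<gamma> \<tau>) > 0"
    by (auto simp: eventually_at_bot_linorder eventually_at_top_linorder)
  define S T where "S = min S' (min s0 t0)" and "T = max T' (max t0 (S + 1))"
  have ST: "S < T" "S \<le> s0" "T \<ge> t0" by (auto simp: S_def T_def)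
  have below: "\<And>\<tau>. \<tau> \<le> S \<Longrightarrow> Im (\<gamma> \<tau>) < 0" and above: "\<And>\<tau>. T \<le> \<tau> \<Longrightarrow> Im (\<gamma> \<tau>) > 0"
    using S' T' by (auto simp: S_def T_def)
  have valid: "\<And>s t. s < t \<Longrightarrow> valid_path (\<gamma> \<circ> linepath s t)"
    using contour by (simp add: meijer_contour_def)
  have "compact (\<gamma> ` {S..T})"
    using ST by (intro compact_continuous_image continuous_on_piece valid) auto
  then obtain R where R: "\<And>\<tau>. S \<le> \<tau> \<Longrightarrow> \<tau> \<le> T \<Longrightarrow> cmod (\<gamma> \<tau>) \<le> R"
    using compact_imp_bounded bounded_iff by (metis atLeastAtMost_iff imageI)
  define N where "N = nat \<lceil>\<bar>X0\<bar> + \<bar>Y0\<bar> + \<bar>R\<bar> + 1\<rceil>"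
  define X where "X = real N + \<delta>"
  have X: "X \<ge> X0" "X \<ge> Y0" "X > R" "X > 1" 
  proof -
    have "\<bar>X0\<bar> + \<bar>Y0\<bar> + \<bar>R\<bar> + 1 \<le> real N" unfolding N_def by (rule real_nat_ceiling_ge)
    then show "X \<ge> X0" "X \<ge> Y0" "X > R" "X > 1" using \<delta> unfolding X_def by linarith+
  qed
  have mid: "Re (\<gamma> \<tau>) > - X" if "S \<le> \<tau>" "\<tau> \<le> T" for \<tau>
    using R[OF that] X abs_Re_le_cmod[of "\<gamma> \<tau>"] by linarith
  obtain s t where st: "s < S" "T < t" "Re (\<gamma> s) = - X" "Re (\<gamma> t) = - X"
    using contour_crosses_level[OF contour ST(1), of "- X"] mid by auto
  let ?a1 = "Complex (- X) (- X)" and ?a2 = "Complex c (- X)" and ?a3 = "Complex c X" and ?a4 = "Complex (- X) X"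
  have loop_eq: "contour_integral (contour_loop \<gamma> s t) \<Phi> = contour_integral (rectpath ?a1 ?a3) \<Phi>"
  proof (rule contour_integral_loop_eq_rectangle[OF contour st(1) ST(1) st(2) below above st(3,4)])
    show "u \<notin> left" if "Re u = - X" for u
      using D(2)[of u N u] D(1) that by (auto simp: X_def)
  qed (use X mid in auto)
  have on_line: "cmod (\<Phi> u) \<le> C * exp (- X)" if "Re u = - X" for u
  proof -
    have "cmod (\<Phi> u) \<le> C * exp (Re u) * exp (- \<eta> * \<bar>Im u\<bar>)"
      using that X c D(2)[of u N] by (intro C(2)) (auto simp: X_def min_le_iff_disj)
    also have "\<dots> \<le> C * exp (Re u) * 1"
    proof (intro mult_left_mono)
      have "- \<eta> * \<bar>Im u\<bar> \<le> 0" using eta_pos by (intro mult_nonpos_nonneg) auto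
      then show "exp (- \<eta> * \<bar>Im u\<bar>) \<le> 1" by simp
    qed (use C(1) in auto)
    finally show ?thesis using that by simp
  qed
  have on_side: "cmod (\<Phi> u) \<le> C * exp c * exp (- \<eta> * X)" if "\<bar>Im u\<bar> = X" "Re u \<le> c" for u
  proof -
    have "1 \<le> dist u p" if "p \<in> left" for p
      using abs_Im_le_cmod[of "u - p"] left_pole_real[OF that] X \<open>\<bar>Im u\<bar> = X\<close> by (auto simp: dist_norm)
    then have "cmod (\<Phi> u) \<le> C * exp (Re u) * exp (- \<eta> * \<bar>Im u\<bar>)"
      using that by (intro C(2)) (auto simp: min_le_iff_disj)
    also have "\<dots> \<le> C * exp c * exp (- \<eta> * \<bar>Im u\<bar>)"
      using C(1) that by (intro mult_mono) auto
    finally show ?thesis using that by simp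
  qed
  have left_line: "u \<notin> poles" if "Re u = - X" for u
    using D(2)[of u N u] D(1) that X right_pole_real[of u] by (auto simp: X_def)
  have side: "u \<notin> poles" if "\<bar>Im u\<bar> = X" for u
    using that X left_pole_real[of u] right_pole_real[of u] by auto
  have mid_line: "u \<notin> poles" if "Re u = c" for u
    using that c left_pole_real[of u] right_pole_real[of u] by auto
  have seg_re: "Re u = x" if "u \<in> closed_segment v w" "Re v = x" "Re w = x" for u v w x
    using that by (auto simp: closed_segment_same_Re)
  have seg_im: "Im u = y \<and> Re u \<le> c" if "u \<in> closed_segment v w" "Im v = y" "Im w = y" "Re v \<le> c" "Re w \<le> c" for u v w y
    using that by (auto simp: closed_segment_same_Im closed_segment_eq_real_ivl split: if_splits)
  have int: "\<Phi> contour_integrable_on linepath ?a1 ?a2" "\<Phi> contour_integrable_on linepath ?a2 ?a3"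
    "\<Phi> contour_integrable_on linepath ?a3 ?a4" "\<Phi> contour_integrable_on linepath ?a4 ?a1"
    "\<Phi> contour_integrable_on linepath (\<gamma> t) (\<gamma> s)"
  proof -
    show "\<Phi> contour_integrable_on linepath ?a1 ?a2" "\<Phi> contour_integrable_on linepath ?a3 ?a4"
      using seg_im[of _ ?a1 ?a2 "- X"] seg_im[of _ ?a3 ?a4 X] side X c
      by (auto intro!: holomorphic_contour_integrable_Phi)
    show "\<Phi> contour_integrable_on linepath ?a2 ?a3" "\<Phi> contour_integrable_on linepath ?a4 ?a1"
      "\<Phi> contour_integrable_on linepath (\<gamma> t) (\<gamma> s)"
      using seg_re[of _ ?a2 ?a3 c] seg_re[of _ ?a4 ?a1 "- X"] seg_re[of _ "\<gamma> t" "\<gamma> s" "- X"] mid_line left_line st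
      by (auto intro!: holomorphic_contour_integrable_Phi)
  qed
  have int_piece: "\<Phi> contour_integrable_on (\<gamma> \<circ> linepath s t)"
    using valid[of s t] contour_avoids_poles[OF contour] st ST
    by (intro holomorphic_contour_integrable_Phi) (auto simp: path_image_piece)
  have rect: "contour_integral (rectpath ?a1 ?a3) \<Phi> = contour_integral (linepath ?a1 ?a2) \<Phi>
      + contour_integral (linepath ?a2 ?a3) \<Phi> + contour_integral (linepath ?a3 ?a4) \<Phi>
      + contour_integral (linepath ?a4 ?a1) \<Phi>"
    using int by (simp add: rectpath_def Let_def contour_integrable_joinI valid_path_join add.assoc)
  have loop: "contour_integral (contour_loop \<gamma> s t) \<Phi>
      = contour_integral (\<gamma> \<circ> linepath s t) \<Phi> + contour_integral (linepath (\<gamma> t) (\<gamma> s)) \<Phi>"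
    using int int_piece valid[of s t] st ST by (intro contour_integral_join) auto
  have b1: "cmod (contour_integral (linepath ?a1 ?a2) \<Phi>) \<le> C * exp c * exp (- \<eta> * X) * (X + c)"
  proof -
    have "cmod (contour_integral (linepath ?a1 ?a2) \<Phi>) \<le> C * exp c * exp (- \<eta> * X) * cmod (?a2 - ?a1)"
      using seg_im[of _ ?a1 ?a2 "- X"] on_side C(1) X c by (intro contour_integral_bound_linepath int) auto
    also have "?a2 - ?a1 = of_real (X + c)" by (simp add: complex_eq_iff)
    finally show ?thesis using X c by (simp del: of_real_add)
  qed
  have b3: "cmod (contour_integral (linepath ?a3 ?a4) \<Phi>) \<le> C * exp c * exp (- \<eta> * X) * (X + c)"
  proof -
    have "cmod (contour_integral (linepath ?a3 ?a4) \<Phi>) \<le> C * exp c * exp (- \<eta> * X) * cmod (?a4 - ?a3)"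
      using seg_im[of _ ?a3 ?a4 X] on_side C(1) X c by (intro contour_integral_bound_linepath int) auto
    also have "?a4 - ?a3 = - of_real (X + c)" by (simp add: complex_eq_iff)
    finally show ?thesis using X c by (simp del: of_real_add)
  qed
  have b4: "cmod (contour_integral (linepath ?a4 ?a1) \<Phi>) \<le> C * exp (- X) * (2 * X)"
  proof -
    have "cmod (contour_integral (linepath ?a4 ?a1) \<Phi>) \<le> C * exp (- X) * cmod (?a1 - ?a4)"
      using seg_re[of _ ?a4 ?a1 "- X"] on_line C(1) by (intro contour_integral_bound_linepath int) auto
    also have "?a1 - ?a4 = - (\<i> * of_real (2 * X))" by (simp add: complex_eq_iff)
    finally show ?thesis using X by (simp add: norm_mult)
  qed
  have b5: "cmod (contour_integral (linepath (\<gamma> t) (\<gamma> s)) \<Phi>) \<le> C * exp (- X) * (2 * H)"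
  proof -
    have "cmod (contour_integral (linepath (\<gamma> t) (\<gamma> s)) \<Phi>) \<le> C * exp (- X) * cmod (\<gamma> s - \<gamma> t)"
      using seg_re[of _ "\<gamma> t" "\<gamma> s" "- X"] st on_line C(1) by (intro contour_integral_bound_linepath int) auto
    also have "cmod (\<gamma> s - \<gamma> t) \<le> \<bar>Re (\<gamma> s - \<gamma> t)\<bar> + \<bar>Im (\<gamma> s - \<gamma> t)\<bar>" by (rule cmod_le)
    also have "\<dots> \<le> 2 * H" using H[of s] H[of t] st by simp
    finally show ?thesis using C(1) by (simp add: mult_left_mono)
  qed
  have norm_sum4: "cmod (u + v + w - x) \<le> cmod u + cmod v + cmod w + cmod x" for u v w x
    using norm_triangle_ineq4[of "u + v + w" x] norm_triangle_ineq[of "u + v" w] norm_triangle_ineq[of u v]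
    by linarith
  have "contour_integral (\<gamma> \<circ> linepath s t) \<Phi> - contour_integral (linepath ?a2 ?a3) \<Phi>
    = contour_integral (linepath ?a1 ?a2) \<Phi> + contour_integral (linepath ?a3 ?a4) \<Phi>
      + contour_integral (linepath ?a4 ?a1) \<Phi> - contour_integral (linepath (\<gamma> t) (\<gamma> s)) \<Phi>"
    using loop rect loop_eq by (simp add: algebra_simps)
  then have "cmod (contour_integral (\<gamma> \<circ> linepath s t) \<Phi> - contour_integral (linepath ?a2 ?a3) \<Phi>)
    \<le> cmod (contour_integral (linepath ?a1 ?a2) \<Phi>) + cmod (contour_integral (linepath ?a3 ?a4) \<Phi>)
      + cmod (contour_integral (linepath ?a4 ?a1) \<Phi>) + cmod (contour_integral (linepath (\<gamma> t) (\<gamma> s)) \<Phi>)"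
    by (simp only: norm_sum4)
  also have "\<dots> \<le> E X" using b1 b3 b4 b5 unfolding E_def by linarith
  also have "\<dots> < e" using X0 X by simp
  finally show ?thesis using that[of s t X] st ST X by simp
qed

end

section \<open>An explicit contour and the value of the G-function\<close>

lemma contour_integral_piece_bound:
  fixes \<gamma> :: "real \<Rightarrow> complex" and G g :: "real \<Rightarrow> real"
  assumes "x < y" and f: "f contour_integrable_on (\<gamma> \<circ> linepath x y)"
    and deriv: "\<And>\<tau>. (\<gamma> has_vector_derivative \<gamma>' \<tau>) (at \<tau>)"
    and G: "\<And>\<tau>. x \<le> \<tau> \<Longrightarrow> \<tau> \<le> y \<Longrightarrow> (G has_real_derivative g \<tau>) (at \<tau>)"
    and bound: "\<And>\<tau>. x \<le> \<tau> \<Longrightarrow> \<tau> \<le> y \<Longrightarrow> cmod (f (\<gamma> \<tau>)) * cmod (\<gamma>' \<tau>) \<le> g \<tau>"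
  shows "cmod (contour_integral (\<gamma> \<circ> linepath x y) f) \<le> G y - G x"
proof -
  let ?l = "\<lambda>u. x + u * (y - x)"
  have l: "linepath x y u = ?l u" for u by (simp add: linepath_def algebra_simps)
  have range: "x \<le> ?l u" "?l u \<le> y" if "u \<in> {0..1}" for u
  proof -
    have "0 \<le> u * (y - x)" "u * (y - x) \<le> 1 * (y - x)"
      using that \<open>x < y\<close> by (auto intro!: mult_right_mono)
    then show "x \<le> ?l u" "?l u \<le> y" by auto
  qed
  have d: "((\<gamma> \<circ> linepath x y) has_vector_derivative (y - x) *\<^sub>R \<gamma>' (?l u)) (at u)" for u
    unfolding comp_def l
    by (rule vector_diff_chain_at[of ?l "y - x" u \<gamma> "\<gamma>' (?l u)", unfolded comp_def])
      (auto intro!: derivative_eq_intros deriv)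
  then have vd: "vector_derivative (\<gamma> \<circ> linepath x y) (at u) = (y - x) *\<^sub>R \<gamma>' (?l u)" for u
    by (rule vector_derivative_at)
  have "((\<lambda>u. (y - x) * g (?l u)) has_integral G (?l 1) - G (?l 0)) {0..1}"
  proof (rule fundamental_theorem_of_calculus)
    fix u :: real assume "u \<in> {0..1}"
    then have "(G has_real_derivative g (?l u)) (at (?l u))" using range by (intro G) auto
    moreover have "(?l has_real_derivative y - x) (at u)" by (auto intro!: derivative_eq_intros)
    ultimately have "((\<lambda>u. G (?l u)) has_real_derivative g (?l u) * (y - x)) (at u)"
      by (rule DERIV_chain2)
    then show "((\<lambda>u. G (?l u)) has_vector_derivative (y - x) * g (?l u)) (at u within {0..1})"
      by (simp add: mult.commute has_real_derivative_iff_has_vector_derivative has_vector_derivative_at_within)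
  qed simp
  then have I: "((\<lambda>u. (y - x) * g (?l u)) has_integral G y - G x) {0..1}" by simp
  have "contour_integral (\<gamma> \<circ> linepath x y) f
    = integral {0..1} (\<lambda>u. f ((\<gamma> \<circ> linepath x y) u) * vector_derivative (\<gamma> \<circ> linepath x y) (at u))"
    by (rule contour_integral_integral)
  also have "cmod \<dots> \<le> integral {0..1} (\<lambda>u. (y - x) * g (?l u))"
  proof (rule integral_norm_bound_integral)
    show "(\<lambda>u. f ((\<gamma> \<circ> linepath x y) u) * vector_derivative (\<gamma> \<circ> linepath x y) (at u)) integrable_on {0..1}"
      using f by (simp add: contour_integrable_on)
    show "(\<lambda>u. (y - x) * g (?l u)) integrable_on {0..1}" using I by blast
    fix u :: real assume "u \<in> {0..1}"
    then have "cmod (f (\<gamma> (?l u))) * cmod (\<gamma>' (?l u)) \<le> g (?l u)" using range by (intro bound) auto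
    then show "cmod (f ((\<gamma> \<circ> linepath x y) u) * vector_derivative (\<gamma> \<circ> linepath x y) (at u)) \<le> (y - x) * g (?l u)"
      using \<open>x < y\<close> unfolding vd by (simp add: l norm_mult mult.left_commute)
  qed
  also have "\<dots> = G y - G x" using I by (rule integral_unique)
  finally show ?thesis .
qed

context cauchy_laguerre_G
begin

text \<open>
  A smooth contour that crosses the real axis once, at \<open>c\<close>, and whose ends approach the lines
  \<open>Im u = \<plusminus>\<pi>/2\<close>.
\<close>

definition bowl :: "real \<Rightarrow> complex" where
  "bowl t = Complex (c - t\<^sup>2) (arctan t)"

lemma has_vector_derivative_bowl:
  "(bowl has_vector_derivative Complex (- 2 * t) (1 / (1 + t\<^sup>2))) (at t)"
  unfolding bowl_def has_vector_derivative_complex_iff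
  by (auto intro!: derivative_eq_intros simp: divide_inverse)

lemma valid_path_bowl: "valid_path (bowl \<circ> linepath s t)"
proof -
  have "(bowl \<circ> linepath s t) C1_differentiable_on {0..1}"
    unfolding C1_differentiable_on_def
  proof (intro exI conjI ballI)
    fix u :: real
    have l: "linepath s t = (\<lambda>u. s + u * (t - s))" by (auto simp: linepath_def algebra_simps)
    show "((bowl \<circ> linepath s t) has_vector_derivative
        (t - s) *\<^sub>R Complex (- 2 * (s + u * (t - s))) (1 / (1 + (s + u * (t - s))\<^sup>2))) (at u)"
      unfolding l
    proof (rule vector_diff_chain_at)
      show "((\<lambda>u. s + u * (t - s)) has_vector_derivative t - s) (at u)"
        by (auto intro!: derivative_eq_intros)
    qed (rule has_vector_derivative_bowl)
  next
    have "1 + (s + u * (t - s))\<^sup>2 > 0" for u by (intro add_pos_nonneg) auto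
    then have "1 + (s + u * (t - s))\<^sup>2 \<noteq> 0" for u by (metis less_irrefl)
    then show "continuous_on {0..1} (\<lambda>u. (t - s) *\<^sub>R Complex (- 2 * (s + u * (t - s))) (1 / (1 + (s + u * (t - s))\<^sup>2)))"
      unfolding Complex_eq by (intro continuous_intros) auto
  qed
  then show ?thesis
    by (simp add: valid_path_def C1_differentiable_imp_piecewise)
qed

lemma bowl_off_axis: "t \<noteq> 0 \<Longrightarrow> Im (bowl t) \<noteq> 0" "t > 0 \<Longrightarrow> Im (bowl t) > 0" "t < 0 \<Longrightarrow> Im (bowl t) < 0"
  by (simp_all add: bowl_def)

lemma bowl_far_from_poles: "\<exists>d>0. \<forall>t. \<forall>p\<in>poles. d \<le> dist (bowl t) p"
proof -
  define m where "m = max 0 (max (- \<alpha>) (- b))"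
  have m: "m < c" using c by (simp add: m_def)
  have left_le: "Re p \<le> m" if "p \<in> left" for p
    using that by (auto simp: left_pole_iff complex_eq_iff m_def elim!: nonpos_Ints_cases')
  define h where "h = (c - m) / 2"
  have h: "h > 0" using m by (simp add: h_def)
  define d where "d = min h (min (arctan (sqrt h)) (1 - c))"
  have "d \<le> dist (bowl t) p" if "p \<in> poles" for t p
  proof (cases "p \<in> right")
    case True
    have "1 - c \<le> - Re (bowl t - p)"
      using right_pole_real[OF True] by (simp add: bowl_def add_increasing2)
    also have "\<dots> \<le> \<bar>Re (bowl t - p)\<bar>" by simp
    also have "\<dots> \<le> dist (bowl t) p" unfolding dist_norm by (rule abs_Re_le_cmod)
    finally show ?thesis by (simp add: d_def)
  next
    case False
    then have p: "p \<in> left" using that by simp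
    show ?thesis
    proof (cases "\<bar>t\<bar> \<le> sqrt h")
      case True
      then have "t\<^sup>2 \<le> h" using h by (metis abs_ge_zero power2_abs power_mono real_sqrt_pow2 less_imp_le)
      then have "h \<le> Re (bowl t - p)" using left_le[OF p] by (simp add: bowl_def h_def field_simps)
      also have "\<dots> \<le> dist (bowl t) p" unfolding dist_norm by (rule complex_Re_le_cmod)
      finally show ?thesis by (simp add: d_def)
    next
      case False
      then have "arctan (sqrt h) \<le> arctan \<bar>t\<bar>" by (simp add: arctan_le_iff)
      also have "\<dots> = \<bar>Im (bowl t - p)\<bar>"
        using left_pole_real[OF p] by (simp add: bowl_def abs_if arctan_minus)
      also have "\<dots> \<le> dist (bowl t) p" unfolding dist_norm by (rule abs_Im_le_cmod)
      finally show ?thesis by (simp add: d_def)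
    qed
  qed
  moreover have "d > 0" using h c by (simp add: d_def)
  ultimately show ?thesis by blast
qed

text \<open>
  The bowl itself avoids the ray to the left of \<open>p\<close>, the closing segment the ray to the right. The
  branches of the logarithm that belong to the two rays differ by \<open>\<pi>\<i>\<close> above the real axis and by \<open>-\<pi>\<i>\<close>
  below it.
\<close>

lemma winding_number_bowl_loop_left:
  assumes p: "p \<in> left" and st: "s < 0" "0 < t" "Re (bowl s) < Re p" "Re (bowl t) < Re p"
  shows "winding_number (contour_loop bowl s t) p = 1"
proof -
  let ?f = "\<lambda>u. 1 / (u - p)"
  have img: "path_image (bowl \<circ> linepath s t) = bowl ` {s..t}"
    using st by (simp add: path_image_piece)
  have piece: "- 1 * (p - u) \<notin> \<real>\<^sub>\<le>\<^sub>0" if u: "u \<in> path_image (bowl \<circ> linepath s t)" for u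
  proof -
    obtain \<tau> where \<tau>: "u = bowl \<tau>" using u img by auto
    have "Im u \<noteq> 0 \<or> Re u = c" using \<tau> bowl_off_axis(1)[of \<tau>] by (cases "\<tau> = 0") (auto simp: bowl_def)
    then show ?thesis using left_pole_real[OF p] by (intro not_nonpos_Reals_if) auto
  qed
  have seg: "1 * (p - u) \<notin> \<real>\<^sub>\<le>\<^sub>0" if u: "u \<in> closed_segment (bowl t) (bowl s)" for u
  proof -
    have "closed_segment (bowl t) (bowl s) \<subseteq> {u. Re u < Re p}"
      using st by (intro closed_segment_subset convex_halfspace_Re_lt) auto
    then show ?thesis using u by (intro not_nonpos_Reals_if) auto
  qed
  have "p \<notin> path_image (bowl \<circ> linepath s t)" using piece[of p] by auto
  moreover have "p \<notin> closed_segment (bowl t) (bowl s)" using seg[of p] by auto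
  ultimately have "p \<notin> path_image (contour_loop bowl s t)"
    by (subst path_image_join) (auto simp: pathfinish_compose)
  moreover have "valid_path (contour_loop bowl s t)"
    using valid_path_bowl by (intro valid_path_join) (auto simp: pathfinish_compose)
  ultimately have w: "winding_number (contour_loop bowl s t) p
      = 1 / (2 * of_real pi * \<i>) * contour_integral (contour_loop bowl s t) ?f"
    by (simp add: winding_number_valid_path)
  have 1: "(?f has_contour_integral Ln (- 1 * (p - bowl t)) - Ln (- 1 * (p - bowl s))) (bowl \<circ> linepath s t)"
    using has_contour_integral_inverse_off_ray[of "bowl \<circ> linepath s t" "- 1" p] valid_path_bowl piece
    by (simp add: pathstart_compose pathfinish_compose)
  have 2: "(?f has_contour_integral Ln (1 * (p - bowl s)) - Ln (1 * (p - bowl t))) (linepath (bowl t) (bowl s))"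
    using has_contour_integral_inverse_off_ray[of "linepath (bowl t) (bowl s)" 1 p] seg by simp
  have "(?f has_contour_integral (Ln (- 1 * (p - bowl t)) - Ln (- 1 * (p - bowl s)))
     + (Ln (1 * (p - bowl s)) - Ln (1 * (p - bowl t)))) (contour_loop bowl s t)"
    by (intro has_contour_integral_join 1 2 valid_path_bowl) auto
  then have "contour_integral (contour_loop bowl s t) ?f = (Ln (- (p - bowl t)) - Ln (- (p - bowl s)))
     + (Ln (p - bowl s) - Ln (p - bowl t))"
    by (simp add: contour_integral_unique)
  moreover have "Ln (- q) = Ln q + \<i> * of_real pi" if "Im q < 0" for q
    using Ln_minus[of q] that by force
  from this[of "p - bowl t"] have "Ln (- (p - bowl t)) = Ln (p - bowl t) + \<i> * of_real pi"
    using bowl_off_axis st left_pole_real[OF p] by simp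
  moreover have "Ln (- q) = Ln q - \<i> * of_real pi" if "Im q > 0" for q
    using Ln_minus[of q] that by force
  from this[of "p - bowl s"] have "Ln (- (p - bowl s)) = Ln (p - bowl s) - \<i> * of_real pi"
    using bowl_off_axis st left_pole_real[OF p] by simp
  ultimately have "contour_integral (contour_loop bowl s t) ?f = 2 * of_real pi * \<i>" by simp
  then show ?thesis using w by simp
qed

lemma winding_number_bowl_loop_right:
  assumes p: "p \<in> right" and st: "s < t"
  shows "winding_number (contour_loop bowl s t) p = 0"
proof (rule winding_number_off_ray[of _ 1])
  show "valid_path (contour_loop bowl s t)"
    using valid_path_bowl by (intro valid_path_join) (auto simp: pathfinish_compose)
  show "pathfinish (contour_loop bowl s t) = pathstart (contour_loop bowl s t)"
    by (simp add: pathstart_compose)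
  fix u assume "u \<in> path_image (contour_loop bowl s t)"
  then have "u \<in> bowl ` {s..t} \<union> closed_segment (bowl t) (bowl s)"
    using st by (subst (asm) path_image_join) (auto simp: pathfinish_compose path_image_piece)
  moreover have "closed_segment (bowl t) (bowl s) \<subseteq> {u. Re u \<le> c}"
    by (intro closed_segment_subset convex_halfspace_Re_le) (auto simp: bowl_def)
  ultimately have "Re u \<le> c" by (auto simp: bowl_def)
  then show "1 * (p - u) \<notin> \<real>\<^sub>\<le>\<^sub>0"
    using right_pole_real[OF p] c by (intro not_nonpos_Reals_if) auto
qed simp

lemma meijer_contour_bowl: "meijer_contour 3 1 upper lower bowl"
  unfolding meijer_contour_def left_def[symmetric] right_def[symmetric]
proof (intro conjI allI impI ballI)
  show "valid_path (bowl \<circ> linepath s t)" for s t by (rule valid_path_bowl)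
  have lim: "filterlim (\<lambda>t::real. c - t\<^sup>2) at_bot at_bot" "filterlim (\<lambda>t::real. c - t\<^sup>2) at_bot at_top"
    by real_asymp+
  then show re: "filterlim (\<lambda>t. Re (bowl t)) at_bot at_bot" "filterlim (\<lambda>t. Re (bowl t)) at_bot at_top"
    by (simp_all add: bowl_def)
  show "\<forall>\<^sub>F t in at_bot. Im (bowl t) < 0"
    using eventually_gt_at_bot[of 0] by eventually_elim (simp add: bowl_off_axis)
  show "\<forall>\<^sub>F t in at_top. 0 < Im (bowl t)"
    using eventually_gt_at_top[of 0] by eventually_elim (simp add: bowl_off_axis)
  show "bounded (range (\<lambda>t. Im (bowl t)))"
  proof (rule boundedI)
    fix x assume "x \<in> range (\<lambda>t. Im (bowl t))"
    then obtain t where "x = arctan t" by (auto simp: bowl_def)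
    then show "norm x \<le> pi / 2"
      using arctan_lbound[of t] arctan_ubound[of t] by (simp add: abs_le_iff)
  qed
  show "\<exists>d>0. \<forall>t. \<forall>p\<in>poles. d \<le> dist (bowl t) p" by (rule bowl_far_from_poles)
  fix p
  show "\<forall>\<^sub>F (s, t) in at_bot \<times>\<^sub>F at_top. winding_number (contour_loop bowl s t) p = 1" if p: "p \<in> left"
  proof -
    have ev: "\<forall>\<^sub>F s in at_bot. Re (bowl s) < Re p \<and> s < 0" "\<forall>\<^sub>F t in at_top. Re (bowl t) < Re p \<and> 0 < t"
      using re eventually_gt_at_bot[of 0] eventually_gt_at_top[of 0]
      by (auto simp: filterlim_at_bot_dense eventually_conj_iff)
    show ?thesis unfolding eventually_prod_filter
      by (rule exI[of _ "\<lambda>s. Re (bowl s) < Re p \<and> s < 0"],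
          rule exI[of _ "\<lambda>t. Re (bowl t) < Re p \<and> 0 < t"])
        (use ev winding_number_bowl_loop_left[OF p] in auto)
  qed
  show "\<forall>\<^sub>F (s, t) in at_bot \<times>\<^sub>F at_top. winding_number (contour_loop bowl s t) p = 0" if p: "p \<in> right"
    unfolding eventually_prod_filter
    by (rule exI[of _ "\<lambda>s. s < 0"], rule exI[of _ "\<lambda>t. 0 < t"])
      (use eventually_gt_at_bot[of 0] eventually_gt_at_top[of 0] winding_number_bowl_loop_right[OF p] in auto)
qed

text \<open>
  On the tails \<open>\<bar>\<Phi>\<bar>\<close> is of order \<open>e ^ (-\<tau>\<^sup>2)\<close> while the speed of the bowl is at most \<open>3\<bar>\<tau>\<bar>\<close>; the product is, up to a
  constant, the derivative of \<open>\<plusminus>e ^ (-\<tau>\<^sup>2)\<close>.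
\<close>

lemma bowl_tail_bound:
  obtains K where "\<And>x y. x < y \<Longrightarrow> y \<le> - 1 \<or> 1 \<le> x \<Longrightarrow>
    cmod (contour_integral (bowl \<circ> linepath x y) \<Phi>) \<le> K * (exp (- x\<^sup>2) + exp (- y\<^sup>2))"
proof -
  obtain C where C: "C \<ge> 0"
    "\<And>u. Re u \<le> c \<Longrightarrow> (\<And>p. p \<in> left \<Longrightarrow> pi / 4 \<le> dist u p) \<Longrightarrow>
        cmod (\<Phi> u) \<le> C * exp (Re u) * exp (- \<eta> * \<bar>Im u\<bar>)"
    \<comment> \<open>For \<open>\<bar>\<tau>\<bar> \<ge> 1\<close> the bowl has distance at least \<open>arctan 1 = \<pi>/4\<close> from the real axis.\<close>
    using Phi_bound[of "pi / 4"] by auto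
  have bound: "cmod (\<Phi> (bowl \<tau>)) * cmod (Complex (- 2 * \<tau>) (1 / (1 + \<tau>\<^sup>2)))
      \<le> 3 * C * exp c * \<bar>\<tau>\<bar> * exp (- \<tau>\<^sup>2)" if "\<bar>\<tau>\<bar> \<ge> 1" for \<tau>
  proof -
    have "pi / 4 \<le> dist (bowl \<tau>) p" if p: "p \<in> left" for p
    proof -
      have "arctan 1 \<le> arctan \<bar>\<tau>\<bar>" using \<open>\<bar>\<tau>\<bar> \<ge> 1\<close> by (simp only: arctan_le_iff)
      also have "\<dots> = \<bar>Im (bowl \<tau> - p)\<bar>"
        using left_pole_real[OF p] by (simp add: bowl_def abs_if arctan_minus)
      also have "\<dots> \<le> dist (bowl \<tau>) p" unfolding dist_norm by (rule abs_Im_le_cmod)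
      finally show ?thesis by (simp add: arctan_one)
    qed
    then have "cmod (\<Phi> (bowl \<tau>)) \<le> C * exp (Re (bowl \<tau>)) * exp (- \<eta> * \<bar>Im (bowl \<tau>)\<bar>)"
      by (intro C(2)) (simp_all add: bowl_def)
    also have "\<dots> \<le> C * exp (Re (bowl \<tau>)) * 1"
    proof (intro mult_left_mono)
      have "- \<eta> * \<bar>Im (bowl \<tau>)\<bar> \<le> 0" using eta_pos by (intro mult_nonpos_nonneg) auto
      then show "exp (- \<eta> * \<bar>Im (bowl \<tau>)\<bar>) \<le> 1" by simp
    qed (use C(1) in auto)
    also have "\<dots> = C * exp c * exp (- \<tau>\<^sup>2)" by (simp add: bowl_def exp_diff exp_minus divide_inverse)
    finally have 1: "cmod (\<Phi> (bowl \<tau>)) \<le> C * exp c * exp (- \<tau>\<^sup>2)" .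
    have "cmod (Complex (- 2 * \<tau>) (1 / (1 + \<tau>\<^sup>2))) \<le> \<bar>- 2 * \<tau>\<bar> + \<bar>1 / (1 + \<tau>\<^sup>2)\<bar>"
      using cmod_le[of "Complex (- 2 * \<tau>) (1 / (1 + \<tau>\<^sup>2))"] by simp
    also have "\<bar>1 / (1 + \<tau>\<^sup>2)\<bar> \<le> 1" by (simp add: add_pos_nonneg)
    also have "\<bar>- 2 * \<tau>\<bar> + 1 \<le> 3 * \<bar>\<tau>\<bar>" using that by (simp add: abs_mult)
    finally have 2: "cmod (Complex (- 2 * \<tau>) (1 / (1 + \<tau>\<^sup>2))) \<le> 3 * \<bar>\<tau>\<bar>" by simp
    have "cmod (\<Phi> (bowl \<tau>)) * cmod (Complex (- 2 * \<tau>) (1 / (1 + \<tau>\<^sup>2)))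
      \<le> C * exp c * exp (- \<tau>\<^sup>2) * (3 * \<bar>\<tau>\<bar>)"
      by (intro mult_mono 1 2) (use C(1) in auto)
    then show ?thesis by (simp add: mult_ac)
  qed
  define K where "K = 3 / 2 * C * exp c"
  have K: "K \<ge> 0" using C(1) by (simp add: K_def)
  show ?thesis
  proof (rule that[of K])
    fix x y :: real assume xy: "x < y" "y \<le> - 1 \<or> 1 \<le> x"
    define \<sigma> where "\<sigma> = (if 1 \<le> x then 1 else - 1 :: real)"
    have \<sigma>: "\<sigma> * \<tau> = \<bar>\<tau>\<bar>" "\<bar>\<tau>\<bar> \<ge> 1" if "x \<le> \<tau>" "\<tau> \<le> y" for \<tau>
      using that xy by (auto simp: \<sigma>_def)
    have "cmod (contour_integral (bowl \<circ> linepath x y) \<Phi>) \<le> - \<sigma> * K * exp (- y\<^sup>2) - (- \<sigma> * K * exp (- x\<^sup>2))"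
    proof (rule contour_integral_piece_bound[where \<gamma>' = "\<lambda>\<tau>. Complex (- 2 * \<tau>) (1 / (1 + \<tau>\<^sup>2))" and g = "\<lambda>\<tau>. 3 * C * exp c * (\<sigma> * \<tau>) * exp (- \<tau>\<^sup>2)"])
      show "\<Phi> contour_integrable_on (bowl \<circ> linepath x y)"
        using xy contour_avoids_poles[OF meijer_contour_bowl] valid_path_bowl
        by (intro holomorphic_contour_integrable_Phi) (auto simp: path_image_piece)
      show "((\<lambda>\<tau>. - \<sigma> * K * exp (- \<tau>\<^sup>2)) has_real_derivative 3 * C * exp c * (\<sigma> * \<tau>) * exp (- \<tau>\<^sup>2)) (at \<tau>)" for \<tau>
        by (auto intro!: derivative_eq_intros simp: K_def)
      show "cmod (\<Phi> (bowl \<tau>)) * cmod (Complex (- 2 * \<tau>) (1 / (1 + \<tau>\<^sup>2)))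
          \<le> 3 * C * exp c * (\<sigma> * \<tau>) * exp (- \<tau>\<^sup>2)" if "x \<le> \<tau>" "\<tau> \<le> y" for \<tau>
        using bound[OF \<sigma>(2)[OF that]] \<sigma>(1)[OF that] by simp
    qed (use xy has_vector_derivative_bowl in auto)
    also have "\<dots> \<le> K * (exp (- x\<^sup>2) + exp (- y\<^sup>2))"
      using K by (auto simp: \<sigma>_def algebra_simps)
    finally show "cmod (contour_integral (bowl \<circ> linepath x y) \<Phi>) \<le> K * (exp (- x\<^sup>2) + exp (- y\<^sup>2))" .
  qed
qed

text \<open>
  Uniqueness is \<open>contour_integral_near_vertical_line\<close>. For the bowl that lemma yields the limit only
  along suitable pairs of parameters; the bound for the tails extends it to all pairs.
\<close>

theorem meijer_G_eq_vertical_integral: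
  assumes V: "((\<lambda>Y. contour_integral (linepath (Complex c (- Y)) (Complex c Y)) \<Phi>) \<longlongrightarrow> V) at_top"
  shows "meijer_G 3 1 upper lower z = V / (2 * of_real pi * \<i>)"
proof -
  define I where "I \<gamma> s t = contour_integral (\<gamma> \<circ> linepath s t) \<Phi>"
    for \<gamma> :: "real \<Rightarrow> complex" and s t
  have near: "\<exists>s\<le>s0. \<exists>t\<ge>t0. dist (I \<gamma> s t) V < e"
    if \<gamma>: "meijer_contour 3 1 upper lower \<gamma>" and "e > 0" for \<gamma> e s0 t0
  proof -
    have "\<forall>\<^sub>F Y in at_top. dist (contour_integral (linepath (Complex c (- Y)) (Complex c Y)) \<Phi>) V < e / 2"
      using tendstoD[OF V, of "e / 2"] \<open>e > 0\<close> by simp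
    then obtain Y0 where Y0: "\<And>Y. Y0 \<le> Y \<Longrightarrow>
        dist (contour_integral (linepath (Complex c (- Y)) (Complex c Y)) \<Phi>) V < e / 2"
      by (auto simp: eventually_at_top_linorder)
    have "e / 2 > 0" using \<open>e > 0\<close> by simp
    then obtain s t Y where "s \<le> s0" "t0 \<le> t" "Y0 \<le> Y"
      "cmod (I \<gamma> s t - contour_integral (linepath (Complex c (- Y)) (Complex c Y)) \<Phi>) < e / 2"
      using contour_integral_near_vertical_line[OF \<gamma>] unfolding I_def by metis
    with Y0 show ?thesis
      using dist_triangle_half_r[of _ "I \<gamma> s t" e V] dist_triangle_half_l by (metis dist_commute dist_norm)
  qed
  have unique: "w = V / (2 * of_real pi * \<i>)"
    if \<gamma>: "meijer_contour 3 1 upper lower \<gamma>"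
      and w: "((\<lambda>(s, t). I \<gamma> s t / (2 * of_real pi * \<i>)) \<longlongrightarrow> w) (at_bot \<times>\<^sub>F at_top)" for \<gamma> w
  proof -
    define W where "W = w * (2 * of_real pi * \<i>)"
    have "((\<lambda>x. (case x of (s, t) \<Rightarrow> I \<gamma> s t / (2 * of_real pi * \<i>)) * (2 * of_real pi * \<i>)) \<longlongrightarrow> W) (at_bot \<times>\<^sub>F at_top)"
      unfolding W_def by (intro tendsto_mult w tendsto_const)
    then have W: "((\<lambda>(s, t). I \<gamma> s t) \<longlongrightarrow> W) (at_bot \<times>\<^sub>F at_top)"
      by (simp add: case_prod_unfold)
    have "W = V"
    proof (rule ccontr)
      assume "W \<noteq> V"
      define e where "e = dist W V / 2"
      have "e > 0" using \<open>W \<noteq> V\<close> by (simp add: e_def)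
      from tendstoD[OF W this] obtain P Q where "eventually P at_bot" "eventually Q at_top"
        and PQ: "\<And>s t. P s \<Longrightarrow> Q t \<Longrightarrow> dist (I \<gamma> s t) W < e"
        unfolding eventually_prod_filter by auto
      then obtain s0 t0 where "\<And>s. s \<le> s0 \<Longrightarrow> P s" "\<And>t. t0 \<le> t \<Longrightarrow> Q t"
        by (auto simp: eventually_at_bot_linorder eventually_at_top_linorder)
      with near[OF \<gamma> \<open>e > 0\<close>, of s0 t0] PQ obtain s t where "dist (I \<gamma> s t) V < e" "dist (I \<gamma> s t) W < e"
        by blast
      then have "dist W V < e + e" by (metis dist_commute dist_triangle_less_add)
      then show False by (simp add: e_def)
    qed
    moreover have "w = W / (2 * of_real pi * \<i>)" by (simp add: W_def)
    ultimately show ?thesis by simp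
  qed
  have exists: "((\<lambda>(s, t). I bowl s t / (2 * of_real pi * \<i>)) \<longlongrightarrow> V / (2 * of_real pi * \<i>)) (at_bot \<times>\<^sub>F at_top)"
  proof -
    obtain K where K: "\<And>x y. x < y \<Longrightarrow> y \<le> - 1 \<or> 1 \<le> x \<Longrightarrow> cmod (I bowl x y) \<le> K * (exp (- x\<^sup>2) + exp (- y\<^sup>2))"
      using bowl_tail_bound unfolding I_def by metis
    have "((\<lambda>(s, t). I bowl s t) \<longlongrightarrow> V) (at_bot \<times>\<^sub>F at_top)"
    proof (rule tendstoI)
      fix e :: real assume "e > 0"
      have "((\<lambda>x::real. K * (exp (- x\<^sup>2) + exp (- x\<^sup>2))) \<longlongrightarrow> 0) at_top" by real_asymp
      then have "\<forall>\<^sub>F x in at_top. K * (exp (- x\<^sup>2) + exp (- x\<^sup>2)) < e / 3"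
        by (rule order_tendstoD) (use \<open>e > 0\<close> in simp)
      moreover have "\<forall>\<^sub>F x::real in at_top. 1 \<le> x" by (rule eventually_ge_at_top)
      ultimately have "\<forall>\<^sub>F x::real in at_top. 1 \<le> x \<and> K * (exp (- x\<^sup>2) + exp (- x\<^sup>2)) < e / 3"
        by eventually_elim simp
      then obtain T where T: "1 \<le> T" "K * (exp (- T\<^sup>2) + exp (- T\<^sup>2)) < e / 3"
        using eventually_happens by fastforce
      have "0 \<le> K * (exp (- 1\<^sup>2) + exp (- 2\<^sup>2))"
        using order_trans[OF norm_ge_zero K[of 1 2]] by simp
      moreover have "(0::real) < exp (- 1\<^sup>2) + exp (- 2\<^sup>2)" by (intro add_pos_pos exp_gt_zero)
      ultimately have "K \<ge> 0" by (metis mult_neg_pos not_le)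
      have tail: "cmod (I bowl x y) < e / 3" if "x \<le> y" "y \<le> - T \<or> T \<le> x" for x y
      proof (cases "x = y")
        case True
        have "I bowl x x = 0"
          unfolding I_def by (simp add: contour_integral_integral comp_def linepath_refl)
        then show ?thesis using True \<open>e > 0\<close> by simp
      next
        case False
        have "T\<^sup>2 \<le> x\<^sup>2" "T\<^sup>2 \<le> y\<^sup>2"
          using that T(1) by (auto simp flip: abs_le_square_iff)
        then have "K * (exp (- x\<^sup>2) + exp (- y\<^sup>2)) \<le> K * (exp (- T\<^sup>2) + exp (- T\<^sup>2))"
          using \<open>K \<ge> 0\<close> by (intro mult_left_mono add_mono) auto
        with K[of x y] that False T show ?thesis by auto
      qed
      have "dist (I bowl s t) V < e" if st: "s \<le> - T" "T \<le> t" for s t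
      proof -
        have "e / 3 > 0" using \<open>e > 0\<close> by simp
        from near[OF meijer_contour_bowl this, of s t] obtain s' t' where
          s't': "s' \<le> s" "t \<le> t'" "dist (I bowl s' t') V < e / 3" by blast
        have "s' < t'" using s't' st T by linarith
        moreover have "\<Phi> contour_integrable_on (bowl \<circ> linepath s' t')"
          using \<open>s' < t'\<close> contour_avoids_poles[OF meijer_contour_bowl] valid_path_bowl
          by (intro holomorphic_contour_integrable_Phi) (auto simp: path_image_piece)
        ultimately have comb: "I bowl x y + I bowl y w = I bowl x w" if "{x, y, w} \<subseteq> {s'..t'}" for x y w
          unfolding I_def using that by (intro contour_integral_piece_combine valid_path_bowl)
        have "I bowl s' t' = I bowl s' s + I bowl s t + I bowl t t'"
          using comb[of s' s t] comb[of s' t t'] s't' st T by simp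
        then have eq: "I bowl s t - V = (I bowl s' t' - V) - I bowl s' s - I bowl t t'" by simp
        have "cmod (I bowl s t - V) \<le> cmod (I bowl s' t' - V) + cmod (I bowl s' s) + cmod (I bowl t t')"
          unfolding eq
          using norm_triangle_ineq4[of "(I bowl s' t' - V) - I bowl s' s" "I bowl t t'"]
            norm_triangle_ineq4[of "I bowl s' t' - V" "I bowl s' s"] by linarith
        moreover have "cmod (I bowl s' s) < e / 3" "cmod (I bowl t t') < e / 3"
          using s't' st tail[of s' s] tail[of t t'] by auto
        ultimately show ?thesis using s't'(3) by (simp add: dist_norm)
      qed
      then show "\<forall>\<^sub>F x in at_bot \<times>\<^sub>F at_top. dist (case x of (s, t) \<Rightarrow> I bowl s t) V < e"
        unfolding eventually_prod_filter
        by (intro exI[of _ "\<lambda>s. s \<le> - T"] exI[of _ "\<lambda>t. T \<le> t"])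
          (auto simp: eventually_le_at_bot eventually_ge_at_top)
    qed
    then have "((\<lambda>x. (case x of (s, t) \<Rightarrow> I bowl s t) / (2 * of_real pi * \<i>)) \<longlongrightarrow> V / (2 * of_real pi * \<i>)) (at_bot \<times>\<^sub>F at_top)"
      by (intro tendsto_divide tendsto_const) auto
    then show ?thesis by (simp add: case_prod_unfold)
  qed
  show ?thesis
    unfolding meijer_G_def
  proof (rule the_equality)
    show "\<exists>\<gamma>. meijer_contour 3 1 upper lower \<gamma> \<and>
      ((\<lambda>(s, t). contour_integral (\<gamma> \<circ> linepath s t) (meijer_integrand 3 1 upper lower z)
          / (2 * of_real pi * \<i>)) \<longlongrightarrow> V / (2 * of_real pi * \<i>)) (at_bot \<times>\<^sub>F at_top)"
      using exists meijer_contour_bowl unfolding I_def \<Phi>_def by blast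
  qed (use unique in \<open>auto simp: I_def \<Phi>_def\<close>)
qed

end

section \<open>The Mellin transform of the Stieltjes kernel\<close>

lemma integrable_exp_neg_abs:
  assumes "k > (0::real)"
  shows "integrable lborel (\<lambda>y. exp (- k * \<bar>y\<bar>))"
proof -
  have "(\<lambda>y. exp (- k * y)) integrable_on {0..}"
    by (rule integrable_on_exp_minus_to_infinity[OF assms])
  then have "(\<lambda>y. exp (- k * y)) absolutely_integrable_on {0..}"
    by (intro nonnegative_absolutely_integrable_1) auto
  then have "integrable lborel (\<lambda>y. indicator {0..} y *\<^sub>R exp (- k * y))"
    unfolding set_integrable_def by (subst (asm) integrable_completion) auto
  moreover from lborel_integrable_real_affine[OF this, of "-1" 0]
  have "integrable lborel (\<lambda>y. indicator {0..} (- y) *\<^sub>R exp (k * y))" by simp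
  ultimately have "integrable lborel (\<lambda>y. indicator {0..} y *\<^sub>R exp (- k * y) + indicator {0..} (- y) *\<^sub>R exp (k * y))"
    by (rule Bochner_Integration.integrable_add)
  then show ?thesis
    by (rule Bochner_Integration.integrable_bound) (auto simp: indicator_def abs_if)
qed

lemma tendsto_integral_symmetric_interval:
  fixes f :: "real \<Rightarrow> complex"
  assumes f: "integrable lborel f"
  shows "((\<lambda>Y. integral {- Y..Y} f) \<longlongrightarrow> (LINT y|lborel. f y)) at_top"
proof -
  have [measurable]: "f \<in> borel_measurable borel" using borel_measurable_integrable[OF f] by simp
  have eq: "integral {- Y..Y} f = (LINT y|lborel. indicator {- Y..Y} y *\<^sub>R f y)" for Y
  proof -
    have "set_integrable lborel {- Y..Y} f"
      unfolding set_integrable_def by (rule integrable_mult_indicator[OF _ f]) simp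
    from set_borel_integral_eq_integral(2)[OF this] show ?thesis
      by (simp add: set_lebesgue_integral_def)
  qed
  have "((\<lambda>Y. LINT y|lborel. indicator {- Y..Y} y *\<^sub>R f y) \<longlongrightarrow> (LINT y|lborel. f y)) at_top"
  proof (rule integral_dominated_convergence_at_top[where w = "\<lambda>y. norm (f y)"])
    show "AE y in lborel. ((\<lambda>Y. indicator {- Y..Y} y *\<^sub>R f y) \<longlongrightarrow> f y) at_top"
    proof (intro AE_I2 tendsto_eventually)
      fix y :: real
      show "\<forall>\<^sub>F Y in at_top. indicator {- Y..Y} y *\<^sub>R f y = f y"
        using eventually_ge_at_top[of "\<bar>y\<bar>"] by eventually_elim (auto simp: indicator_def)
    qed
  qed (use f in \<open>auto simp: indicator_def\<close>)
  then show ?thesis by (simp add: eq)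
qed

definition sine_kernel :: "complex \<Rightarrow> complex \<Rightarrow> complex" where
  "sine_kernel w u = of_real pi / sin (of_real pi * u) * w powr (- u)"

lemma sin_pi_nonzero:
  assumes "u \<noteq> 0" "- 1 < Re u" "Re u < 1"
  shows "sin (of_real pi * u) \<noteq> 0"
proof
  assume "sin (of_real pi * u) = 0"
  then obtain k :: int where "of_real pi * u = of_real (of_int k * pi)"
    by (auto simp: sin_eq_0)
  then have "of_real pi * u = of_real pi * of_int k" by simp
  then have "u = of_int k" by (subst (asm) mult_cancel_left) auto
  moreover from this have "k = 0" using assms by auto
  ultimately show False using assms by auto
qed

lemma holomorphic_sine_kernel:
  assumes "w \<noteq> 0"
  shows "sine_kernel w holomorphic_on {u. - 1 < Re u \<and> Re u < 1} - {0}"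
  unfolding sine_kernel_def using assms sin_pi_nonzero by (intro holomorphic_intros) auto

lemma sine_kernel_shift: "w \<noteq> 0 \<Longrightarrow> sine_kernel w (u - 1) = - w * sine_kernel w u"
proof -
  assume "w \<noteq> 0"
  have "sin (of_real pi * (u - 1)) = - sin (of_real pi * u)"
    by (simp add: algebra_simps sin_diff sin_of_real cos_of_real)
  moreover have "w powr (- (u - 1)) = w * w powr (- u)"
    using \<open>w \<noteq> 0\<close> powr_add[of w 1 "- u"] by simp
  ultimately show ?thesis by (simp add: sine_kernel_def)
qed

lemma residue_sine_kernel:
  assumes "w \<noteq> 0"
  shows "residue (sine_kernel w) 0 = 1"
proof (rule residue_simple'[of "{u. - 1 < Re u \<and> Re u < 1}"])
  show "open {u. - 1 < Re u \<and> Re u < 1}"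
    by (intro open_Collect_conj open_Collect_less continuous_intros)
  have "((\<lambda>u. sin (of_real pi * u)) has_field_derivative of_real pi) (at (0::complex))"
    by (auto intro!: derivative_eq_intros)
  then have "((\<lambda>u::complex. sin (of_real pi * u) / u) \<longlongrightarrow> of_real pi) (at 0)"
    by (simp add: has_field_derivative_iff)
  moreover have "((\<lambda>u. exp (- u * Ln w)) \<longlongrightarrow> exp (- 0 * Ln w)) (at 0)"
    by (intro tendsto_intros)
  then have "((\<lambda>u. w powr (- u)) \<longlongrightarrow> 1) (at 0)" using assms by (simp add: powr_def)
  ultimately have "((\<lambda>u. of_real pi / (sin (of_real pi * u) / u) * w powr (- u))
      \<longlongrightarrow> of_real pi / of_real pi * 1) (at 0)"
    by (intro tendsto_intros) auto
  then show "((\<lambda>u. sine_kernel w u * (u - 0)) \<longlongrightarrow> 1) (at 0)"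
    using assms by (simp add: sine_kernel_def mult_ac)
qed (use holomorphic_sine_kernel assms in auto)

text \<open>
  The three alternatives for \<open>u\<close> are the places where the sides of the rectangle with vertices
  \<open>c - 1 \<plusminus> Y\<i>\<close> and \<open>c \<plusminus> Y\<i>\<close> run; all of them keep a fixed distance from the integers.
\<close>

lemma sine_kernel_bound:
  assumes w: "w \<notin> \<real>\<^sub>\<le>\<^sub>0" and c: "0 < c" "c < 1"
  obtains C k where "C \<ge> 0" "k > 0"
    "\<And>u. \<bar>Re u\<bar> \<le> 1 \<Longrightarrow> Re u = c \<or> Re u = c - 1 \<or> \<bar>Im u\<bar> \<ge> 1 \<Longrightarrow>
        cmod (sine_kernel w u) \<le> C * exp (- k * \<bar>Im u\<bar>)"
proof -
  have "w \<noteq> 0" using w by auto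
  define D where "D = min c (1 - c)"
  have D: "D > 0" "D \<le> c" "D \<le> 1 - c" using c by (auto simp: D_def)
  obtain \<kappa> where \<kappa>: "\<kappa> > 0" "\<And>u. (\<And>k::int. D \<le> cmod (u - of_int k))
       \<Longrightarrow> \<kappa> * exp (pi * \<bar>Im u\<bar>) \<le> cmod (sin (of_real pi * u))"
    using sin_pi_lower_bound[OF D(1)] by metis
  define k where "k = pi - \<bar>Im (Ln w)\<bar>"
  have "k > 0" using abs_Im_Ln_less_pi[OF w] by (simp add: k_def)
  define C where "C = pi / \<kappa> * exp \<bar>ln (cmod w)\<bar>"
  show ?thesis
  proof (rule that)
    show "C \<ge> 0" "k > 0" using \<kappa> \<open>k > 0\<close> by (auto simp: C_def)
    fix u assume u: "\<bar>Re u\<bar> \<le> 1" "Re u = c \<or> Re u = c - 1 \<or> \<bar>Im u\<bar> \<ge> 1"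
    have far: "D \<le> cmod (u - of_int j)" for j :: int
    proof (cases "\<bar>Im u\<bar> \<ge> 1")
      case True
      then have "D \<le> \<bar>Im (u - of_int j)\<bar>" using D c by simp
      also have "\<dots> \<le> cmod (u - of_int j)" by (rule abs_Im_le_cmod)
      finally show ?thesis .
    next
      case False
      then obtain i :: int where i: "Re u = c - of_int i" using u(2) by (metis of_int_0 of_int_1 diff_zero)
      have "D \<le> \<bar>c - of_int (i + j)\<bar>"
      proof (cases "i + j \<le> 0")
        case True
        then have "(of_int (i + j) :: real) \<le> 0" by simp
        then show ?thesis using D c by linarith
      next
        case False
        then have "(of_int (i + j) :: real) \<ge> 1" by simp
        then show ?thesis using D c by linarith
      qed
      also have "\<dots> = \<bar>Re (u - of_int j)\<bar>" using i by simp
      also have "\<dots> \<le> cmod (u - of_int j)" by (rule abs_Re_le_cmod)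
      finally show ?thesis .
    qed
    have 1: "cmod (of_real pi / sin (of_real pi * u)) \<le> pi / (\<kappa> * exp (pi * \<bar>Im u\<bar>))"
      unfolding norm_divide using \<kappa>(1) by (intro frac_le \<kappa>(2) far) auto
    have "- ln (cmod w) * Re u \<le> \<bar>ln (cmod w)\<bar> * \<bar>Re u\<bar>"
      by (metis abs_ge_self abs_minus_cancel abs_mult)
    also have "\<dots> \<le> \<bar>ln (cmod w)\<bar> * 1" using u by (intro mult_left_mono) auto
    finally have "exp (- ln (cmod w) * Re u) * exp (\<bar>Im (Ln w)\<bar> * \<bar>Im u\<bar>)
        \<le> exp (\<bar>ln (cmod w)\<bar> + \<bar>Im (Ln w)\<bar> * \<bar>Im u\<bar>)"
      by (simp flip: exp_add)
    with norm_powr_uminus_le[OF \<open>w \<noteq> 0\<close>, of u]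
    have 2: "cmod (w powr (- u)) \<le> exp (\<bar>ln (cmod w)\<bar> + \<bar>Im (Ln w)\<bar> * \<bar>Im u\<bar>)"
      by (rule order_trans)
    have "cmod (sine_kernel w u) \<le> pi / (\<kappa> * exp (pi * \<bar>Im u\<bar>)) * exp (\<bar>ln (cmod w)\<bar> + \<bar>Im (Ln w)\<bar> * \<bar>Im u\<bar>)"
      unfolding sine_kernel_def norm_mult[of "_ / _"] by (intro mult_mono 1 2) (use \<kappa> in auto)
    also have "\<dots> = C * exp (- k * \<bar>Im u\<bar>)"
      by (simp add: C_def k_def exp_add exp_diff exp_minus algebra_simps divide_inverse)
    finally show "cmod (sine_kernel w u) \<le> C * exp (- k * \<bar>Im u\<bar>)" .
  qed
qed

text \<open>
  Shifting the line of integration by \<open>-1\<close> multiplies the kernel by \<open>-w\<close>, and between the two lines there is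
  one pole, with residue \<open>1\<close>. Hence the integral \<open>J\<close> along \<open>Re u = c\<close> satisfies
  \<open>J - (-w) J = 2\<pi>\<close>.
\<close>

lemma sine_kernel_integral:
  assumes w: "w \<notin> \<real>\<^sub>\<le>\<^sub>0" and c: "0 < c" "c < 1"
  shows "integrable lborel (\<lambda>y. sine_kernel w (Complex c y))"
    and "(LINT y|lborel. sine_kernel w (Complex c y)) = 2 * of_real pi / (1 + w)"
proof -
  have "w \<noteq> 0" using w by auto
  define S where "S = {u. - 1 < Re u \<and> Re u < 1}"
  have S: "open S" "connected S"
  proof -
    show "open S" unfolding S_def by (intro open_Collect_conj open_Collect_less continuous_intros)
    have "S = {u. Re u > - 1} \<inter> {u. Re u < 1}" by (auto simp: S_def)
    then show "connected S"
      by (simp add: convex_connected convex_Int convex_halfspace_Re_gt convex_halfspace_Re_lt)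
  qed
  obtain C k where C: "C \<ge> 0" "k > 0"
    "\<And>u. \<bar>Re u\<bar> \<le> 1 \<Longrightarrow> Re u = c \<or> Re u = c - 1 \<or> \<bar>Im u\<bar> \<ge> 1 \<Longrightarrow>
        cmod (sine_kernel w u) \<le> C * exp (- k * \<bar>Im u\<bar>)"
    using sine_kernel_bound[OF w c] by metis
  have holo: "sine_kernel w holomorphic_on S - {0}"
    unfolding S_def by (rule holomorphic_sine_kernel[OF \<open>w \<noteq> 0\<close>])
  have "continuous_on UNIV (\<lambda>y. sine_kernel w (Complex c y))"
    unfolding Complex_eq
    by (rule continuous_on_compose2[OF holomorphic_on_imp_continuous_on[OF holo]])
      (use c in \<open>auto intro!: continuous_intros simp: S_def complex_eq_iff\<close>)
  then have meas: "(\<lambda>y. sine_kernel w (Complex c y)) \<in> borel_measurable borel"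
    by (rule borel_measurable_continuous_onI)
  show int: "integrable lborel (\<lambda>y. sine_kernel w (Complex c y))"
  proof (rule Bochner_Integration.integrable_bound)
    show "integrable lborel (\<lambda>y. C * exp (- k * \<bar>y\<bar>))"
      by (intro integrable_mult_right integrable_exp_neg_abs C(2))
    show "AE y in lborel. cmod (sine_kernel w (Complex c y)) \<le> norm (C * exp (- k * \<bar>y\<bar>))"
      using C(3)[of "Complex c _"] c C(1) by (intro AE_I2) (auto simp: abs_mult)
  qed (use meas in simp)
  define J where "J Y = integral {- Y..Y} (\<lambda>y. sine_kernel w (Complex c y))" for Y
  define B where "B Y = contour_integral (linepath (Complex (c - 1) (- Y)) (Complex c (- Y))) (sine_kernel w)" for Y
  define T where "T Y = contour_integral (linepath (Complex c Y) (Complex (c - 1) Y)) (sine_kernel w)" for Y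
  have rect: "\<i> * (1 + w) * J Y + (B Y + T Y) = 2 * of_real pi * \<i>" if Y: "Y > 0" for Y
  proof -
    let ?a1 = "Complex (c - 1) (- Y)" and ?a2 = "Complex c (- Y)" and ?a3 = "Complex c Y" and ?a4 = "Complex (c - 1) Y"
    let ?R = "rectpath ?a1 ?a3"
    have img: "path_image ?R \<subseteq> S - {0}"
      using c Y by (subst path_image_rectpath) (auto simp: S_def)
    have "winding_number ?R 0 = 1"
      using c Y by (intro winding_number_rectpath) (auto simp: in_box_complex_iff)
    moreover have "contour_integral ?R (sine_kernel w) = 2 * pi * \<i> * (\<Sum>p\<in>{0}. winding_number ?R p * residue (sine_kernel w) p)"
    proof (rule Residue_theorem[OF S])
      show "\<forall>u. u \<notin> S \<longrightarrow> winding_number ?R u = 0"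
        using c Y by (intro allI impI winding_number_rectpath_outside) (auto simp: in_cbox_complex_iff S_def)
    qed (use img holo in auto)
    ultimately have R: "contour_integral ?R (sine_kernel w) = 2 * of_real pi * \<i>"
      using residue_sine_kernel[OF \<open>w \<noteq> 0\<close>] by simp
    have seg: "path_image (linepath ?a1 ?a2) \<subseteq> S - {0}" "path_image (linepath ?a2 ?a3) \<subseteq> S - {0}"
      "path_image (linepath ?a3 ?a4) \<subseteq> S - {0}" "path_image (linepath ?a4 ?a1) \<subseteq> S - {0}"
      using img by (auto simp: rectpath_def Let_def path_image_join)
    have int: "sine_kernel w contour_integrable_on linepath ?a1 ?a2" "sine_kernel w contour_integrable_on linepath ?a2 ?a3"
      "sine_kernel w contour_integrable_on linepath ?a3 ?a4" "sine_kernel w contour_integrable_on linepath ?a4 ?a1"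
      using seg S(1) by (auto intro!: contour_integrable_holomorphic_simple[OF holo])
    have "contour_integral ?R (sine_kernel w) = B Y + contour_integral (linepath ?a2 ?a3) (sine_kernel w)
        + T Y + contour_integral (linepath ?a4 ?a1) (sine_kernel w)"
      using int by (simp add: rectpath_def Let_def contour_integrable_joinI valid_path_join add.assoc B_def T_def)
    also have "contour_integral (linepath ?a2 ?a3) (sine_kernel w) = \<i> * J Y"
      unfolding J_def using Y by (intro contour_integral_linepath_same_Re) auto
    also have "contour_integral (linepath ?a4 ?a1) (sine_kernel w) = - contour_integral (linepath ?a1 ?a4) (sine_kernel w)"
      using int(4) by (metis contour_integral_reverse_linepath contour_integrable_reversepath_eq
          continuous_on_subset holo holomorphic_on_imp_continuous_on path_image_linepath seg(4))
    also have "contour_integral (linepath ?a1 ?a4) (sine_kernel w)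
        = \<i> * integral {- Y..Y} (\<lambda>y. sine_kernel w (Complex (c - 1) y))"
      using Y by (intro contour_integral_linepath_same_Re) auto
    also have "(\<lambda>y. sine_kernel w (Complex (c - 1) y)) = (\<lambda>y. - w * sine_kernel w (Complex c y))"
    proof
      fix y
      have "Complex (c - 1) y = Complex c y - 1" by (simp add: complex_eq_iff)
      then show "sine_kernel w (Complex (c - 1) y) = - w * sine_kernel w (Complex c y)"
        using sine_kernel_shift[OF \<open>w \<noteq> 0\<close>] by simp
    qed
    also have "integral {- Y..Y} (\<lambda>y. - w * sine_kernel w (Complex c y)) = - w * J Y"
      unfolding J_def by (rule integral_mult_right)
    finally show ?thesis using R by (simp add: algebra_simps)
  qed
  have small: "cmod (B Y + T Y) \<le> 2 * C * exp (- k * Y)" if Y: "Y \<ge> 1" for Y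
  proof -
    have "cmod (contour_integral (linepath v v') (sine_kernel w)) \<le> C * exp (- k * Y)"
      if "v = Complex x y" "v' = Complex x' y" "\<bar>y\<bar> = Y" "{x, x'} = {c - 1, c}" for v v' x x' y
    proof -
      have seg: "\<bar>Re u\<bar> < 1 \<and> Im u = y" if "u \<in> closed_segment v v'" for u
        using that \<open>v = _\<close> \<open>v' = _\<close> \<open>{x, x'} = _\<close> c
        by (auto simp: closed_segment_same_Im closed_segment_eq_real_ivl doubleton_eq_iff split: if_splits)
      have "closed_segment v v' \<subseteq> S - {0}" using seg Y \<open>\<bar>y\<bar> = Y\<close> by (fastforce simp: S_def)
      then have "sine_kernel w contour_integrable_on linepath v v'"
        using S(1) by (intro contour_integrable_holomorphic_simple[OF holo]) auto
      then have "cmod (contour_integral (linepath v v') (sine_kernel w)) \<le> C * exp (- k * Y) * cmod (v' - v)"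
      proof (rule contour_integral_bound_linepath)
        fix u assume "u \<in> closed_segment v v'"
        then have "\<bar>Re u\<bar> < 1" "\<bar>Im u\<bar> = Y" using seg \<open>\<bar>y\<bar> = Y\<close> by auto
        then show "cmod (sine_kernel w u) \<le> C * exp (- k * Y)"
          using C(3)[of u] Y by simp
      qed (use C in auto)
      also have "cmod (v' - v) = 1"
      proof -
        have "v' - v = of_real (x' - x)" using \<open>v = _\<close> \<open>v' = _\<close> by (simp add: complex_eq_iff)
        moreover have "\<bar>x' - x\<bar> = 1" using \<open>{x, x'} = _\<close> by (auto simp: doubleton_eq_iff)
        ultimately show ?thesis by (metis norm_of_real)
      qed
      finally show ?thesis by simp
    qed
    from this[of _ "c - 1" "- Y" _ c] this[of _ c Y _ "c - 1"] Y
    have "cmod (B Y) \<le> C * exp (- k * Y)" "cmod (T Y) \<le> C * exp (- k * Y)"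
      unfolding B_def T_def by auto
    then show ?thesis using norm_triangle_ineq[of "B Y" "T Y"] by linarith
  qed
  have "((\<lambda>Y. exp (- k * Y)) \<longlongrightarrow> 0) at_top" using C(2) by real_asymp
  from tendsto_mult_right_zero[OF this, of "2 * C"]
  have "((\<lambda>Y. B Y + T Y) \<longlongrightarrow> 0) at_top"
    by (rule Lim_null_comparison[rotated])
      (use small in \<open>auto intro!: eventually_mono[OF eventually_ge_at_top[of 1]]\<close>)
  moreover have "((\<lambda>Y. \<i> * (1 + w) * J Y) \<longlongrightarrow> \<i> * (1 + w) * (LINT y|lborel. sine_kernel w (Complex c y))) at_top"
    unfolding J_def by (intro tendsto_intros tendsto_integral_symmetric_interval int)
  ultimately have "((\<lambda>Y. \<i> * (1 + w) * J Y + (B Y + T Y)) \<longlongrightarrow>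
      \<i> * (1 + w) * (LINT y|lborel. sine_kernel w (Complex c y)) + 0) at_top"
    by (intro tendsto_add)
  moreover have "((\<lambda>Y. \<i> * (1 + w) * J Y + (B Y + T Y)) \<longlongrightarrow> 2 * of_real pi * \<i>) at_top"
    by (intro tendsto_eventually eventually_mono[OF eventually_gt_at_top[of 0]] rect)
  ultimately have "\<i> * (1 + w) * (LINT y|lborel. sine_kernel w (Complex c y)) + 0 = 2 * of_real pi * \<i>"
    using tendsto_unique trivial_limit_at_top_linorder by blast
  then have "\<i> * ((1 + w) * (LINT y|lborel. sine_kernel w (Complex c y))) = \<i> * (2 * of_real pi)"
    by (simp add: mult_ac)
  then have "(1 + w) * (LINT y|lborel. sine_kernel w (Complex c y)) = 2 * of_real pi"
    by (subst (asm) mult_left_cancel) auto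
  moreover have "1 + w \<noteq> 0"
  proof
    assume "1 + w = 0"
    then have "w = - 1" by (simp add: add_eq_0_iff)
    then show False using w by simp
  qed
  ultimately show "(LINT y|lborel. sine_kernel w (Complex c y)) = 2 * of_real pi / (1 + w)"
    by (simp add: eq_divide_eq mult.commute)
qed

text \<open>
  Fubini's theorem, the inner integral being \<open>sine_kernel_integral\<close> for \<open>w = z / \<tau>\<close>. The measure space is
  arbitrary because the application has two variables, of which only one enters the Mellin transform.
\<close>

lemma Mellin_Parseval:
  fixes M :: "'a measure" and \<phi> :: "'a \<Rightarrow> complex" and \<tau> :: "'a \<Rightarrow> real"
  assumes "sigma_finite_measure M"
    and [measurable]: "\<phi> \<in> borel_measurable M" "\<tau> \<in> borel_measurable M"
    and \<tau>: "\<And>x. x \<in> space M \<Longrightarrow> \<tau> x > 0"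
    and int: "integrable M (\<lambda>x. cmod (\<phi> x) * \<tau> x powr (c - 1))"
    and z: "z \<notin> \<real>\<^sub>\<le>\<^sub>0" and c: "0 < c" "c < 1"
  shows "integrable lborel (\<lambda>y. sine_kernel z (Complex c y) * (LINT x|M. \<phi> x * of_real (\<tau> x) powr (Complex c y - 1)))"
    and "(LINT y|lborel. sine_kernel z (Complex c y) * (LINT x|M. \<phi> x * of_real (\<tau> x) powr (Complex c y - 1)))
       = 2 * of_real pi * (LINT x|M. \<phi> x / (z + of_real (\<tau> x)))"
proof -
  interpret M: sigma_finite_measure M by fact
  interpret pair_sigma_finite lborel M ..
  have "z \<noteq> 0" using z by auto
  define h where "h y x = sine_kernel z (Complex c y) * (\<phi> x * exp ((Complex c y - 1) * of_real (ln (\<tau> x))))" for y x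
  have h: "h y x = sine_kernel z (Complex c y) * (\<phi> x * of_real (\<tau> x) powr (Complex c y - 1))"
    if "x \<in> space M" for y x
    using \<tau>[OF that] by (simp add: h_def powr_def Ln_of_real)
  have [measurable]: "(\<lambda>y. sine_kernel z (Complex c y)) \<in> borel_measurable borel"
    using borel_measurable_integrable[OF sine_kernel_integral(1)[OF z c]] by simp
  have [measurable]: "(\<lambda>y. Complex c y) \<in> borel_measurable borel"
    unfolding Complex_eq by measurable
  have meas: "case_prod h \<in> borel_measurable (lborel \<Otimes>\<^sub>M M)"
    unfolding h_def by measurable
  have nh: "cmod (h y x) = cmod (sine_kernel z (Complex c y)) * (cmod (\<phi> x) * \<tau> x powr (c - 1))" if "x \<in> space M" for y x
    using \<tau>[OF that] by (simp add: h_def norm_mult norm_exp_eq_Re powr_def)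
  have inth: "integrable M (h y)" for y
  proof (rule Bochner_Integration.integrable_bound)
    show "integrable M (\<lambda>x. cmod (sine_kernel z (Complex c y)) * (cmod (\<phi> x) * \<tau> x powr (c - 1)))"
      by (intro integrable_mult_right int)
    show "h y \<in> borel_measurable M" unfolding h_def by measurable
  qed (auto simp: nh intro!: AE_I2)
  have prod: "integrable (lborel \<Otimes>\<^sub>M M) (case_prod h)"
  proof (rule Fubini_integrable[OF meas])
    have "(LINT x|M. cmod (case_prod h (y, x))) = cmod (sine_kernel z (Complex c y)) * (LINT x|M. cmod (\<phi> x) * \<tau> x powr (c - 1))" for y
    proof -
      have "(LINT x|M. cmod (case_prod h (y, x))) = (LINT x|M. cmod (sine_kernel z (Complex c y)) * (cmod (\<phi> x) * \<tau> x powr (c - 1)))"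
        by (rule Bochner_Integration.integral_cong) (auto simp: nh)
      then show ?thesis by simp
    qed
    then show "integrable lborel (\<lambda>y. LINT x|M. cmod (case_prod h (y, x)))"
      using sine_kernel_integral(1)[OF z c] by simp
  qed (use inth in auto)
  have inner_x: "(LINT x|M. h y x) = sine_kernel z (Complex c y) * (LINT x|M. \<phi> x * of_real (\<tau> x) powr (Complex c y - 1))" for y
  proof -
    have "(LINT x|M. h y x) = (LINT x|M. sine_kernel z (Complex c y) * (\<phi> x * of_real (\<tau> x) powr (Complex c y - 1)))"
      by (rule Bochner_Integration.integral_cong) (auto simp: h)
    then show ?thesis by simp
  qed
  have inner_y: "(LINT y|lborel. h y x) = 2 * of_real pi * (\<phi> x / (z + of_real (\<tau> x)))" if x: "x \<in> space M" for x
  proof -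
    let ?t = "\<tau> x" and ?w = "z / of_real (\<tau> x)"
    have t: "?t > 0" using \<tau> x .
    have w: "?w \<notin> \<real>\<^sub>\<le>\<^sub>0" using z t by (simp add: complex_nonpos_Reals_iff divide_le_0_iff) 
    have "h y x = \<phi> x / of_real ?t * sine_kernel ?w (Complex c y)" for y
    proof -
      have e1: "?w powr (- u) = z powr (- u) * exp (u * of_real (ln ?t))" for u
        using \<open>z \<noteq> 0\<close> t by (simp add: powr_def Ln_divide_of_real algebra_simps flip: exp_add)
      have e2: "exp ((u - 1) * of_real (ln ?t)) = exp (u * of_real (ln ?t)) / of_real ?t" for u :: complex
      proof -
        have "exp (of_real (ln ?t) :: complex) = of_real ?t" using t by (metis exp_ln exp_of_real)
        then show ?thesis by (simp add: algebra_simps exp_diff)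
      qed
      show ?thesis unfolding h_def sine_kernel_def e1 e2 by (simp add: mult_ac)
    qed
    then have "(LINT y|lborel. h y x) = \<phi> x / of_real ?t * (2 * of_real pi / (1 + ?w))"
      using sine_kernel_integral(2)[OF w c] by simp
    also have "of_real ?t * (1 + ?w) = z + of_real ?t" using t by (simp add: field_simps)
    then have "\<phi> x / of_real ?t * (2 * of_real pi / (1 + ?w)) = 2 * of_real pi * (\<phi> x / (z + of_real ?t))"
      by (simp add: mult.commute)
    finally show ?thesis .
  qed
  show "integrable lborel (\<lambda>y. sine_kernel z (Complex c y) * (LINT x|M. \<phi> x * of_real (\<tau> x) powr (Complex c y - 1)))"
    using integrable_fst'[OF prod] by (simp add: inner_x)
  have "(LINT y|lborel. (LINT x|M. h y x)) = (LINT x|M. (LINT y|lborel. h y x))"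
    using Fubini_integral[OF prod] by simp
  also have "\<dots> = (LINT x|M. 2 * of_real pi * (\<phi> x / (z + of_real (\<tau> x))))"
    by (rule Bochner_Integration.integral_cong) (auto simp: inner_y)
  also have "\<dots> = 2 * of_real pi * (LINT x|M. \<phi> x / (z + of_real (\<tau> x)))"
    by (rule integral_mult_right_zero)
  finally show "(LINT y|lborel. sine_kernel z (Complex c y) * (LINT x|M. \<phi> x * of_real (\<tau> x) powr (Complex c y - 1)))
       = 2 * of_real pi * (LINT x|M. \<phi> x / (z + of_real (\<tau> x)))"
    unfolding inner_x .
qed

section \<open>Moments of the Cauchy-Laguerre weight\<close>

lemma (in pair_sigma_finite) product_of_integrable:
  fixes g :: "'a \<Rightarrow> complex" and h :: "'b \<Rightarrow> complex"
  assumes g: "integrable M1 g" and h: "integrable M2 h"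
  shows "integrable (M1 \<Otimes>\<^sub>M M2) (\<lambda>(x, y). g x * h y)"
    and "(LINT (x, y)|(M1 \<Otimes>\<^sub>M M2). g x * h y) = (LINT x|M1. g x) * (LINT y|M2. h y)"
proof -
  have [measurable]: "g \<in> borel_measurable M1" "h \<in> borel_measurable M2"
    using g h by auto
  show int: "integrable (M1 \<Otimes>\<^sub>M M2) (\<lambda>(x, y). g x * h y)"
    by (rule Fubini_integrable) (use g h in \<open>auto simp: norm_mult\<close>)
  show "(LINT (x, y)|(M1 \<Otimes>\<^sub>M M2). g x * h y) = (LINT x|M1. g x) * (LINT y|M2. h y)"
    using integral_fst'[OF int] by simp
qed

lemma set_integrable_lborel_if_absolutely_integrable:
  fixes f :: "real \<Rightarrow> 'a :: euclidean_space"
  assumes f: "f absolutely_integrable_on S" and S: "S \<in> sets borel"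
    and meas: "set_borel_measurable borel S f"
  shows "set_integrable lborel S f"
proof -
  have "(\<lambda>x. indicator S x *\<^sub>R f x) \<in> borel_measurable lborel"
    using meas by (simp add: set_borel_measurable_def)
  from integrable_completion[OF this] f show ?thesis by (simp add: set_integrable_def)
qed

lemma borel_measurable_real_powr_complex [measurable]:
  "(\<lambda>t. indicator {0<..} t *\<^sub>R (complex_of_real t powr s)) \<in> borel_measurable borel"
proof -
  have "(\<lambda>t. indicator {0<..} t *\<^sub>R (complex_of_real t powr s))
    = (\<lambda>t. indicator {0<..} t *\<^sub>R exp (s * of_real (ln t)))"
    by (auto simp: fun_eq_iff indicator_def powr_def Ln_of_real)
  also have "\<dots> \<in> borel_measurable borel" by measurable
  finally show ?thesis .
qed

definition gamma_density :: "complex \<Rightarrow> real \<Rightarrow> real \<Rightarrow> complex" where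
  "gamma_density s \<tau> t = indicator {0<..} t *\<^sub>R (of_real t powr (s - 1)) * of_real (exp (- \<tau> * t))"

lemma measurable_gamma_density [measurable]: "gamma_density s \<tau> \<in> borel_measurable borel"
  unfolding gamma_density_def by measurable

lemma gamma_density_integral:
  assumes s: "Re s > 0" and \<tau>: "\<tau> > 0"
  shows "integrable lborel (gamma_density s \<tau>)"
    and "(LINT t|lborel. gamma_density s \<tau> t) = Gamma s * of_real \<tau> powr (- s)"
proof -
  let ?f = "\<lambda>t. of_real t powr (s - 1) / of_real (exp t) :: complex"
  have eq: "gamma_density s 1 = (\<lambda>t. indicator {0<..} t *\<^sub>R ?f t)"
    by (auto simp: gamma_density_def fun_eq_iff exp_minus divide_inverse)
  have I: "set_integrable lborel {0<..} ?f"
    by (rule set_integrable_lborel_if_absolutely_integrable[OF absolutely_integrable_Gamma_integral'[OF s]])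
      (use measurable_gamma_density[of s 1] in \<open>auto simp: set_borel_measurable_def eq\<close>)
  then have int1: "integrable lborel (gamma_density s 1)"
    by (simp add: set_integrable_def eq)
  have val1: "(LINT t|lborel. gamma_density s 1 t) = Gamma s"
    using set_borel_integral_eq_integral(2)[OF I] integral_unique[OF Gamma_integral_complex'[OF s]]
    by (simp add: set_lebesgue_integral_def eq)
  have scale: "gamma_density s 1 (0 + \<tau> * t) = of_real \<tau> powr (s - 1) * gamma_density s \<tau> t" for t
    using \<tau> by (auto simp: gamma_density_def indicator_def zero_less_mult_iff powr_times_real)
  have nz: "of_real \<tau> powr (s - 1) \<noteq> (0 :: complex)" using \<tau> by simp
  have "integrable lborel (\<lambda>t. gamma_density s 1 (0 + \<tau> * t))"
    using \<tau> by (intro lborel_integrable_real_affine int1) auto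
  then have "integrable lborel (\<lambda>t. inverse (of_real \<tau> powr (s - 1)) * (of_real \<tau> powr (s - 1) * gamma_density s \<tau> t))"
    unfolding scale by (rule integrable_mult_right)
  then show "integrable lborel (gamma_density s \<tau>)"
    using nz by (simp add: mult.assoc[symmetric])
  have "Gamma s = \<bar>\<tau>\<bar> *\<^sub>R (LINT t|lborel. gamma_density s 1 (0 + \<tau> * t))"
    unfolding val1[symmetric] using \<tau> by (intro lborel_integral_real_affine) auto
  also have "\<dots> = of_real \<tau> * of_real \<tau> powr (s - 1) * (LINT t|lborel. gamma_density s \<tau> t)"
    unfolding scale using \<tau> by (simp add: scaleR_conv_of_real)
  also have "of_real \<tau> * of_real \<tau> powr (s - 1) = (of_real \<tau> powr s :: complex)"
    using \<tau> powr_add[of "of_real \<tau> :: complex" 1 "s - 1"] by simp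
  finally show "(LINT t|lborel. gamma_density s \<tau> t) = Gamma s * of_real \<tau> powr (- s)"
    using \<tau> by (simp add: powr_minus field_simps)
qed

lemma norm_gamma_density: "cmod (gamma_density s \<tau> t) = Re (gamma_density (of_real (Re s)) \<tau> t)"
  "gamma_density (of_real r) \<tau> t = of_real (Re (gamma_density (of_real r) \<tau> t))"
proof -
  have *: "gamma_density (of_real r) \<tau> t = of_real (indicator {0<..} t * t powr (r - 1) * exp (- \<tau> * t))" for r
  proof (cases "t > 0")
    case True
    then have "complex_of_real t powr (of_real r - 1) = of_real (t powr (r - 1))"
      using powr_of_real[of t "r - 1"] by simp
    then show ?thesis using True by (simp add: gamma_density_def)
  qed (simp add: gamma_density_def)
  show "gamma_density (of_real r) \<tau> t = of_real (Re (gamma_density (of_real r) \<tau> t))"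
    unfolding * by simp
  show "cmod (gamma_density s \<tau> t) = Re (gamma_density (of_real (Re s)) \<tau> t)"
    unfolding * by (auto simp: gamma_density_def indicator_def norm_mult norm_powr_real_powr)
qed

lemma integral_norm_gamma_density:
  assumes s: "Re s > 0" and \<tau>: "\<tau> > 0"
  shows "(LINT t|lborel. cmod (gamma_density s \<tau> t)) = Gamma (Re s) * \<tau> powr (- Re s)"
proof -
  have eq: "complex_of_real (cmod (gamma_density s \<tau> t)) = gamma_density (of_real (Re s)) \<tau> t" for t
    unfolding norm_gamma_density(1) by (rule norm_gamma_density(2)[symmetric])
  have "complex_of_real (LINT t|lborel. cmod (gamma_density s \<tau> t))
      = (LINT t|lborel. complex_of_real (cmod (gamma_density s \<tau> t)))"
    by (rule integral_complex_of_real[symmetric])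
  also have "\<dots> = (LINT t|lborel. gamma_density (of_real (Re s)) \<tau> t)" by (simp only: eq)
  also have "\<dots> = of_real (Gamma (Re s) * \<tau> powr (- Re s))"
    using s \<tau> by (simp add: gamma_density_integral Gamma_complex_of_real powr_of_real flip: of_real_minus)
  finally show ?thesis by (simp only: of_real_eq_iff)
qed

lemma powr_integral_to_infinity:
  fixes q :: complex
  assumes q: "Re q > 1"
  shows "integrable lborel (\<lambda>\<tau>. indicator {1<..} \<tau> *\<^sub>R (of_real \<tau> powr (- q)))"
    and "(LINT \<tau>|lborel. indicator {1<..} \<tau> *\<^sub>R (of_real \<tau> powr (- q))) = 1 / (q - 1)"
proof -
  let ?f = "\<lambda>\<tau>. of_real \<tau> powr (- q) :: complex"
  have q1: "q - 1 \<noteq> 0" using q by auto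
  have meas: "(\<lambda>\<tau>. indicator {1<..} \<tau> *\<^sub>R ?f \<tau>) \<in> borel_measurable borel"
  proof -
    have "(\<lambda>\<tau>. indicator {1<..} \<tau> *\<^sub>R ?f \<tau>)
        = (\<lambda>\<tau>. indicator {1<..} \<tau> *\<^sub>R (indicator {0<..} \<tau> *\<^sub>R ?f \<tau>))"
      by (auto simp: fun_eq_iff indicator_def)
    also have "\<dots> \<in> borel_measurable borel" by measurable
    finally show ?thesis .
  qed
  have "(\<lambda>\<tau>. \<tau> powr (- Re q)) absolutely_integrable_on {1..}"
    using has_integral_powr_to_inf[of "- Re q" 1] q
    by (intro nonnegative_absolutely_integrable_1) (auto intro: has_integral_integrable)
  then have "set_integrable lborel {1..} (\<lambda>\<tau>. \<tau> powr (- Re q))"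
    by (rule set_integrable_lborel_if_absolutely_integrable) (auto simp: set_borel_measurable_def)
  then show int: "integrable lborel (\<lambda>\<tau>. indicator {1<..} \<tau> *\<^sub>R ?f \<tau>)"
    unfolding set_integrable_def
    by (rule Bochner_Integration.integrable_bound)
      (use meas in \<open>auto intro!: AE_I2 simp: indicator_def norm_powr_real_powr\<close>)
  have "(LBINT \<tau>=ereal 1..\<infinity>. ?f \<tau>) = 0 - (- (1 / (q - 1)))"
  proof (rule interval_integral_FTC_integrable[where F = "\<lambda>\<tau>. - (exp ((1 - q) * of_real (ln \<tau>)) / (q - 1))"])
    fix \<tau> assume "ereal 1 < ereal \<tau>"
    then have \<tau>: "\<tau> > 1" by simp
    have "((\<lambda>\<tau>. of_real (ln \<tau>) :: complex) has_vector_derivative of_real (1 / \<tau>)) (at \<tau>)"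
      using \<tau> by (auto intro!: has_vector_derivative_of_real derivative_eq_intros simp: has_real_derivative_iff_has_vector_derivative[symmetric])
    moreover have "((\<lambda>w. - (exp ((1 - q) * w) / (q - 1))) has_field_derivative exp ((1 - q) * of_real (ln \<tau>))) (at (of_real (ln \<tau>)))"
    proof -
      have "((\<lambda>w. - (exp ((1 - q) * w) / (q - 1))) has_field_derivative
          - (exp ((1 - q) * of_real (ln \<tau>)) * (1 - q) / (q - 1))) (at (of_real (ln \<tau>)))"
        using q1 by (auto intro!: derivative_eq_intros)
      moreover have "- (E * (1 - q) / (q - 1)) = E" for E
      proof -
        have "E * (1 - q) = (- E) * (q - 1)" by (simp add: algebra_simps)
        then show ?thesis by (simp only: nonzero_mult_div_cancel_right[OF q1] minus_minus)
      qed
      ultimately show ?thesis by simp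
    qed
    ultimately have "((\<lambda>w. - (exp ((1 - q) * w) / (q - 1))) \<circ> (\<lambda>\<tau>. of_real (ln \<tau>)) has_vector_derivative
        of_real (1 / \<tau>) * exp ((1 - q) * of_real (ln \<tau>))) (at \<tau>)"
      by (rule field_vector_diff_chain_at)
    moreover have "of_real (1 / \<tau>) * exp ((1 - q) * of_real (ln \<tau>)) = ?f \<tau>"
    proof -
      have "exp (of_real (ln \<tau>) :: complex) = of_real \<tau>" using \<tau> by (metis exp_ln exp_of_real less_trans zero_less_one)
      then show ?thesis using \<tau> by (simp add: powr_def Ln_of_real algebra_simps exp_diff exp_minus divide_inverse)
    qed
    ultimately show "((\<lambda>\<tau>. - (exp ((1 - q) * of_real (ln \<tau>)) / (q - 1))) has_vector_derivative ?f \<tau>) (at \<tau>)"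
      by (simp add: comp_def)
    show "isCont ?f \<tau>" using \<tau> by (intro continuous_intros) auto
  next
    show "set_integrable lborel (einterval (ereal 1) \<infinity>) ?f"
      using int by (simp add: set_integrable_def einterval_eq)
    have "((\<lambda>\<tau>. - (exp ((1 - q) * of_real (ln \<tau>)) / (q - 1))) \<longlongrightarrow> - (exp ((1 - q) * of_real (ln 1)) / (q - 1))) (at_right 1)"
      using q1 by (intro tendsto_intros) auto
    then show "(((\<lambda>\<tau>. - (exp ((1 - q) * of_real (ln \<tau>)) / (q - 1))) \<circ> real_of_ereal) \<longlongrightarrow> - (1 / (q - 1))) (at_right (ereal 1))"
      by (simp add: ereal_tendsto_simps)
    have "((\<lambda>\<tau>. exp ((1 - q) * of_real (ln \<tau>))) \<longlongrightarrow> 0) at_top"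
    proof (rule tendsto_norm_zero_cancel)
      have "((\<lambda>\<tau>. exp ((1 - Re q) * ln \<tau>)) \<longlongrightarrow> 0) at_top" using q by real_asymp
      then show "((\<lambda>\<tau>. cmod (exp ((1 - q) * of_real (ln \<tau>)))) \<longlongrightarrow> 0) at_top"
        by (simp add: norm_exp_eq_Re)
    qed
    then have "((\<lambda>\<tau>. - (exp ((1 - q) * of_real (ln \<tau>)) / (q - 1))) \<longlongrightarrow> - (0 / (q - 1))) at_top"
      using q1 by (intro tendsto_intros)
    then show "(((\<lambda>\<tau>. - (exp ((1 - q) * of_real (ln \<tau>)) / (q - 1))) \<circ> real_of_ereal) \<longlongrightarrow> 0) (at_left \<infinity>)"
      by (simp add: ereal_tendsto_simps)
  qed simp
  then show "(LINT \<tau>|lborel. indicator {1<..} \<tau> *\<^sub>R ?f \<tau>) = 1 / (q - 1)"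
    by (simp add: interval_lebesgue_integral_def set_lebesgue_integral_def einterval_eq)
qed

lemma exp_integral_from_one:
  fixes m :: real
  assumes m: "m > 0"
  shows "(LINT \<tau>|lborel. indicator {1<..} \<tau> *\<^sub>R complex_of_real (exp (- \<tau> * m))) = of_real (exp (- m) / m)"
proof -
  have I: "((\<lambda>\<tau>. exp (- m * \<tau>)) has_integral exp (- m * 1) / m) {1..}"
    by (rule has_integral_exp_minus_to_infinity[OF m])
  then have "(\<lambda>\<tau>. exp (- m * \<tau>)) absolutely_integrable_on {1..}"
    by (intro nonnegative_absolutely_integrable_1) auto
  then have "set_integrable lborel {1..} (\<lambda>\<tau>. exp (- m * \<tau>))"
    by (rule set_integrable_lborel_if_absolutely_integrable) (auto simp: set_borel_measurable_def)
  from set_borel_integral_eq_integral(2)[OF this]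
  have "(LINT \<tau>|lborel. indicator {1..} \<tau> * exp (- m * \<tau>)) = exp (- m) / m"
    using I by (simp add: set_lebesgue_integral_def integral_unique)
  moreover have "(LINT \<tau>|lborel. indicator {1<..} \<tau> *\<^sub>R complex_of_real (exp (- \<tau> * m)))
     = (LINT \<tau>|lborel. complex_of_real (indicator {1..} \<tau> * exp (- m * \<tau>)))"
  proof (rule integral_cong_AE)
    show "AE \<tau> in lborel. indicator {1<..} \<tau> *\<^sub>R complex_of_real (exp (- \<tau> * m)) = complex_of_real (indicator {1..} \<tau> * exp (- m * \<tau>))"
      using AE_lborel_singleton[of "1::real"] by eventually_elim (auto simp: indicator_def mult.commute)
  qed measurable
  ultimately show ?thesis by (simp only: integral_complex_of_real)
qed

text \<open>
  Writing \<open>e\<^bsup>-(x+y)\<^esup> / (x + y)\<close> as the integral of \<open>e\<^bsup>-\<tau>(x+y)\<^esup>\<close> over \<open>\<tau> > 1\<close> separates the variables: the inner double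
  integral is \<open>\<Gamma>(p) \<Gamma>(s) \<tau>\<^bsup>-p-s\<^esup>\<close>, whose integral over \<open>\<tau> > 1\<close> converges exactly for
  \<open>Re (p + s) > 1\<close>.
\<close>

theorem Cauchy_Gamma_integral:
  fixes p s :: complex
  assumes p: "Re p > 0" and s: "Re s > 0" and ps: "Re p + Re s > 1"
  defines "f \<equiv> \<lambda>(x, y). indicator ({0<..} \<times> {0<..}) (x, y) *\<^sub>R
      (of_real x powr (p - 1) * of_real y powr (s - 1) * of_real (exp (- x - y) / (x + y)))"
  shows "integrable lborel f" and "(LINT v|lborel. f v) = Gamma p * Gamma s / (p + s - 1)"
proof -
  have lp: "(lborel :: (real \<times> real) measure) = lborel \<Otimes>\<^sub>M lborel" by (simp add: lborel_prod)
  define g where "g \<tau> v = indicator {1<..} \<tau> *\<^sub>R (gamma_density p \<tau> (fst v) * gamma_density s \<tau> (snd v))"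
    for \<tau> and v :: "real \<times> real"
  have meas: "case_prod g \<in> borel_measurable (lborel \<Otimes>\<^sub>M lborel)"
  proof -
    have "case_prod g = (\<lambda>(\<tau>, v). indicator {1<..} \<tau> *\<^sub>R
       ((indicator {0<..} (fst v) *\<^sub>R (of_real (fst v) powr (p - 1)) * of_real (exp (- \<tau> * fst v)))
       * (indicator {0<..} (snd v) *\<^sub>R (of_real (snd v) powr (s - 1)) * of_real (exp (- \<tau> * snd v)))))"
      by (simp add: g_def gamma_density_def fun_eq_iff)
    also have "\<dots> \<in> borel_measurable (lborel \<Otimes>\<^sub>M lborel)"
      unfolding lp by measurable
    finally show ?thesis .
  qed
  have gint: "integrable lborel (g \<tau>)"
    and gval: "(LINT v|lborel. g \<tau> v) = Gamma p * Gamma s * (indicator {1<..} \<tau> *\<^sub>R (of_real \<tau> powr (- (p + s))))"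
    and gnorm: "(LINT v|lborel. cmod (g \<tau> v)) = Gamma (Re p) * Gamma (Re s) * (indicator {1<..} \<tau> * \<tau> powr (- (Re p + Re s)))" for \<tau>
  proof -
    have "integrable lborel (g \<tau>) \<and> (LINT v|lborel. g \<tau> v) = Gamma p * Gamma s * (indicator {1<..} \<tau> *\<^sub>R (of_real \<tau> powr (- (p + s))))
      \<and> (LINT v|lborel. cmod (g \<tau> v)) = Gamma (Re p) * Gamma (Re s) * (indicator {1<..} \<tau> * \<tau> powr (- (Re p + Re s)))"
    proof (cases "\<tau> > 1")
      case False
      then have "g \<tau> = (\<lambda>v. 0)" by (simp add: g_def fun_eq_iff)
      then show ?thesis using False by simp
    next
      case True
      then have \<tau>: "\<tau> > 0" by simp
      have g1: "g \<tau> = (\<lambda>(x, y). gamma_density p \<tau> x * gamma_density s \<tau> y)"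
        using True by (auto simp: g_def fun_eq_iff)
      have n1: "(\<lambda>v. complex_of_real (cmod (g \<tau> v))) = (\<lambda>(x, y). of_real (cmod (gamma_density p \<tau> x)) * of_real (cmod (gamma_density s \<tau> y)))"
        using True by (auto simp: g_def fun_eq_iff norm_mult)
      note jp = gamma_density_integral[OF p \<tau>] and js = gamma_density_integral[OF s \<tau>]
      have 1: "integrable lborel (g \<tau>)" "(LINT v|lborel. g \<tau> v) = Gamma p * of_real \<tau> powr (- p) * (Gamma s * of_real \<tau> powr (- s))"
        using lborel_pair.product_of_integrable[OF jp(1) js(1)] jp(2) js(2) by (simp_all add: g1 lborel_prod)
      have "complex_of_real (LINT v|lborel. cmod (g \<tau> v)) = (LINT x|lborel. of_real (cmod (gamma_density p \<tau> x))) * (LINT y|lborel. of_real (cmod (gamma_density s \<tau> y)))"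
        unfolding integral_complex_of_real[symmetric] n1
        using lborel_pair.product_of_integrable(2)[of "\<lambda>x. of_real (cmod (gamma_density p \<tau> x))" "\<lambda>y. of_real (cmod (gamma_density s \<tau> y))"] jp(1) js(1)
        by (simp add: lborel_prod)
      also have "\<dots> = of_real (Gamma (Re p) * \<tau> powr (- Re p) * (Gamma (Re s) * \<tau> powr (- Re s)))"
        unfolding integral_complex_of_real integral_norm_gamma_density[OF p \<tau>] integral_norm_gamma_density[OF s \<tau>] by simp
      finally have 2: "(LINT v|lborel. cmod (g \<tau> v)) = Gamma (Re p) * \<tau> powr (- Re p) * (Gamma (Re s) * \<tau> powr (- Re s))"
        by (simp only: of_real_eq_iff)
      have "of_real \<tau> powr (- (p + s)) = (of_real \<tau> powr (- p) * of_real \<tau> powr (- s) :: complex)"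
        using \<tau> by (simp add: powr_def algebra_simps flip: exp_add)
      moreover have "\<tau> powr (- (Re p + Re s)) = \<tau> powr (- Re p) * \<tau> powr (- Re s)"
        by (simp flip: powr_add)
      ultimately show ?thesis using 1 2 True by simp
    qed
    then show "integrable lborel (g \<tau>)"
      "(LINT v|lborel. g \<tau> v) = Gamma p * Gamma s * (indicator {1<..} \<tau> *\<^sub>R (of_real \<tau> powr (- (p + s))))"
      "(LINT v|lborel. cmod (g \<tau> v)) = Gamma (Re p) * Gamma (Re s) * (indicator {1<..} \<tau> * \<tau> powr (- (Re p + Re s)))"
      by blast+
  qed
  have prod: "integrable (lborel \<Otimes>\<^sub>M lborel) (case_prod g)"
  proof (rule lborel_pair.Fubini_integrable[OF meas])
    have "integrable lborel (\<lambda>\<tau>. norm (indicator {1<..} \<tau> *\<^sub>R (of_real \<tau> powr (- of_real (Re p + Re s)) :: complex)))"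
      using ps by (intro integrable_norm powr_integral_to_infinity) simp
    also have "(\<lambda>\<tau>. norm (indicator {1<..} \<tau> *\<^sub>R (of_real \<tau> powr (- of_real (Re p + Re s)) :: complex)))
        = (\<lambda>\<tau>. indicator {1<..} \<tau> * \<tau> powr (- (Re p + Re s)))"
      by (auto simp: fun_eq_iff indicator_def norm_powr_real_powr)
    finally show "integrable lborel (\<lambda>\<tau>. LINT v|lborel. cmod (case_prod g (\<tau>, v)))"
      by (simp add: gnorm)
  qed (use gint in auto)
  have inner: "(LINT \<tau>|lborel. g \<tau> v) = f v" for v
  proof (cases "fst v > 0 \<and> snd v > 0")
    case False
    then show ?thesis by (auto simp: g_def f_def gamma_density_def case_prod_unfold indicator_def)
  next
    case True
    let ?K = "of_real (fst v) powr (p - 1) * of_real (snd v) powr (s - 1) :: complex"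
    have "g \<tau> v = ?K * (indicator {1<..} \<tau> *\<^sub>R complex_of_real (exp (- \<tau> * (fst v + snd v))))" for \<tau>
    proof -
      have "exp (- \<tau> * (fst v + snd v)) = exp (- \<tau> * fst v) * exp (- \<tau> * snd v)"
        by (simp add: algebra_simps flip: exp_add)
      then show ?thesis using True by (simp add: g_def gamma_density_def indicator_def del: of_real_exp)
    qed
    then have "(LINT \<tau>|lborel. g \<tau> v) = (LINT \<tau>|lborel. ?K * (indicator {1<..} \<tau> *\<^sub>R complex_of_real (exp (- \<tau> * (fst v + snd v)))))"
      by (simp only:)
    also have "\<dots> = ?K * of_real (exp (- (fst v + snd v)) / (fst v + snd v))"
      using exp_integral_from_one[of "fst v + snd v"] True by (simp only: integral_mult_right_zero) auto
    also have "\<dots> = f v" using True by (auto simp: f_def case_prod_unfold indicator_def)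
    finally show ?thesis .
  qed
  show "integrable lborel f"
    using lborel_pair.integrable_snd[of g] prod by (simp add: inner)
  have "(LINT v|lborel. f v) = (LINT v|lborel. (LINT \<tau>|lborel. g \<tau> v))" by (simp add: inner)
  also have "\<dots> = (LINT \<tau>|lborel. (LINT v|lborel. g \<tau> v))"
    by (rule lborel_pair.Fubini_integral[OF prod])
  also have "\<dots> = Gamma p * Gamma s * (1 / (p + s - 1))"
    using powr_integral_to_infinity(2)[of "p + s"] ps by (simp only: gval integral_mult_right_zero) auto
  finally show "(LINT v|lborel. f v) = Gamma p * Gamma s / (p + s - 1)" by simp
qed

section \<open>The biorthogonal polynomials\<close>

text \<open>
  Lagrange interpolation of \<open>B\<close> at the nodes \<open>0, -1, ..., -n\<close>, divided by the node polynomial.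
\<close>

lemma sum_partial_fractions_at_negative_integers:
  fixes B :: "complex poly" and v :: complex
  assumes deg: "degree B \<le> n" and v: "\<And>i. i \<le> n \<Longrightarrow> v + of_nat i \<noteq> 0"
  shows "(\<Sum>i\<le>n. poly B (- of_nat i) / (\<Prod>j\<in>{..n} - {i}. of_nat j - of_nat i) / (v + of_nat i))
       = poly B v / (\<Prod>j\<le>n. v + of_nat j)"
proof -
  define d where "d i = poly B (- of_nat i) / (\<Prod>j\<in>{..n} - {i}. of_nat j - of_nat i)" for i
  define L where "L i = (\<Prod>j\<in>{..n} - {i}. [:of_nat j, 1:] :: complex poly)" for i
  have L: "poly (L i) w = (\<Prod>j\<in>{..n} - {i}. w + of_nat j)" for i w
    by (simp add: L_def poly_prod add.commute)
  have degL: "degree (L i) \<le> n" if "i \<le> n" for i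
  proof -
    have "degree (L i) \<le> (\<Sum>j\<in>{..n} - {i}. degree [:of_nat j, 1 :: complex:])"
      unfolding L_def by (rule order_trans[OF degree_prod_sum_le]) (auto simp: o_def)
    also have "\<dots> = n" using that by simp
    finally show ?thesis .
  qed
  have "(\<Sum>i\<le>n. smult (d i) (L i)) = B"
  proof (rule poly_eqI_degree[where A = "(\<lambda>k. - of_nat k) ` {..n}"])
    have card: "card ((\<lambda>k. - of_nat k :: complex) ` {..n}) = n + 1"
      by (subst card_image) (auto simp: inj_on_def)
    show "degree B < card ((\<lambda>k. - of_nat k :: complex) ` {..n})" using deg card by simp
    have "degree (\<Sum>i\<le>n. smult (d i) (L i)) \<le> n"
      by (intro degree_sum_le) (auto intro: order_trans[OF degree_smult_le] degL)
    then show "degree (\<Sum>i\<le>n. smult (d i) (L i)) < card ((\<lambda>k. - of_nat k :: complex) ` {..n})"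
      using card by simp
    fix w :: complex assume "w \<in> (\<lambda>k. - of_nat k) ` {..n}"
    then obtain k where k: "k \<le> n" "w = - of_nat k" by auto
    have "poly (\<Sum>i\<le>n. smult (d i) (L i)) w = (\<Sum>i\<le>n. d i * poly (L i) w)"
      by (simp add: poly_sum)
    also have "\<dots> = (\<Sum>i\<le>n. if i = k then d k * poly (L k) w else 0)"
    proof (rule sum.cong)
      fix i assume "i \<in> {..n}"
      have "poly (L i) w = 0" if "i \<noteq> k"
        unfolding L using that k by (intro prod_zero) (auto intro!: bexI[of _ k])
      then show "d i * poly (L i) w = (if i = k then d k * poly (L k) w else 0)" by auto
    qed simp
    also have "\<dots> = d k * poly (L k) w" using k by simp
    also have "poly (L k) w = (\<Prod>j\<in>{..n} - {k}. of_nat j - of_nat k)"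
      unfolding L k by (rule prod.cong) auto
    also have "d k * \<dots> = poly B w"
    proof -
      have "(\<Prod>j\<in>{..n} - {k}. of_nat j - of_nat k :: complex) \<noteq> 0" by (auto simp: prod_zero_iff)
      then show ?thesis by (simp add: d_def k)
    qed
    finally show "poly (\<Sum>i\<le>n. smult (d i) (L i)) w = poly B w" .
  qed
  then have "poly B v = (\<Sum>i\<le>n. d i * poly (L i) v)" by (metis (no_types, lifting) poly_smult poly_sum sum.cong)
  also have "\<dots> = (\<Sum>i\<le>n. d i / (v + of_nat i)) * (\<Prod>j\<le>n. v + of_nat j)"
    unfolding sum_distrib_right
  proof (rule sum.cong)
    fix i assume i: "i \<in> {..n}"
    have "(\<Prod>j\<le>n. v + of_nat j) = (v + of_nat i) * (\<Prod>j\<in>{..n} - {i}. v + of_nat j)"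
      using i by (simp add: prod.remove)
    then show "d i * poly (L i) v = d i / (v + of_nat i) * (\<Prod>j\<le>n. v + of_nat j)"
      using v[of i] i by (simp add: L)
  qed simp
  finally have "(\<Sum>i\<le>n. d i / (v + of_nat i)) = poly B v / (\<Prod>j\<le>n. v + of_nat j)"
    using v by (subst eq_divide_eq) (auto simp: prod_zero_iff)
  then show ?thesis by (simp only: d_def)
qed

text \<open>
  In the basis of the \<open>p k\<close> the coefficient of a polynomial at \<open>p m\<close> is its pairing with \<open>q m\<close>, so only the
  coefficient at \<open>p n\<close> survives. The basis is used through division of the leading term: polynomials of
  degree below \<open>m\<close> pair to \<open>0\<close> with \<open>q m\<close>, and a polynomial of degree below \<open>k\<close> that pairs to \<open>0\<close> with
  \<open>q 0, ..., q (k - 1)\<close> is \<open>0\<close>.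
\<close>

lemma biorthogonal_left_unique:
  fixes form :: "real poly \<Rightarrow> real poly \<Rightarrow> real"
  assumes add: "\<And>P R Q. form (P + R) Q = form P Q + form R Q"
    and smult: "\<And>c P Q. form (smult c P) Q = c * form P Q"
    and deg: "\<And>k. degree (p k) = k" and nz: "\<And>k. p k \<noteq> 0"
    and biorth: "\<And>l m. form (p l) (q m) = (if l = m then 1 else 0)"
    and P: "degree P \<le> n" "\<And>m. m < n \<Longrightarrow> form P (q m) = 0"
  shows "P = smult (form P (q n)) (p n)"
proof -
  have zero: "form 0 Q = 0" for Q using smult[of 0 0 Q] by simp
  have lead: "coeff (p k) k \<noteq> 0" for k using nz[of k] deg[of k] by (metis leading_coeff_0_iff)
  have split: "\<exists>c R. P = smult c (p k) + R \<and> (\<forall>i\<ge>k. coeff R i = 0) \<and> (c = 0 \<longleftrightarrow> coeff P k = 0)"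
    if "\<forall>i\<ge>Suc k. coeff P i = 0" for P k
  proof (intro exI conjI allI impI)
    let ?c = "coeff P k / coeff (p k) k"
    show "P = smult ?c (p k) + (P - smult ?c (p k))" by simp
    show "coeff (P - smult ?c (p k)) i = 0" if "i \<ge> k" for i
    proof (cases "i = k")
      case True
      then show ?thesis using lead[of k] by simp
    next
      case False
      then have "coeff P i = 0" "coeff (p k) i = 0"
        using that \<open>\<forall>i\<ge>Suc k. coeff P i = 0\<close> deg[of k] by (auto intro: coeff_eq_0)
      then show ?thesis by simp
    qed
    show "?c = 0 \<longleftrightarrow> coeff P k = 0" using lead[of k] by simp
  qed
  have low: "form R (q m) = 0" if "\<forall>i\<ge>k. coeff R i = 0" "k \<le> m" for R k m
    using that
  proof (induction k arbitrary: R)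
    case 0
    then have "R = 0" by (simp add: poly_eq_iff)
    then show ?case using zero by simp
  next
    case (Suc k)
    obtain c R' where R': "R = smult c (p k) + R'" "\<forall>i\<ge>k. coeff R' i = 0"
      using split[OF Suc.prems(1)] by blast
    have "form R' (q m) = 0" using Suc.IH R'(2) Suc.prems(2) by simp
    then show ?case using Suc.prems(2) biorth by (simp add: R'(1) add smult)
  qed
  have vanish: "R = 0" if "\<forall>i\<ge>k. coeff R i = 0" "\<And>m. m < k \<Longrightarrow> form R (q m) = 0" for R k
    using that
  proof (induction k arbitrary: R)
    case 0
    then show ?case by (simp add: poly_eq_iff)
  next
    case (Suc k)
    obtain c R' where R': "R = smult c (p k) + R'" "\<forall>i\<ge>k. coeff R' i = 0" "c = 0 \<longleftrightarrow> coeff R k = 0"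
      using split[OF Suc.prems(1)] by blast
    have "form R (q k) = c" using low[OF R'(2), of k] biorth by (simp add: R'(1) add smult)
    then have "c = 0" using Suc.prems(2)[of k] by simp
    then have "R = R'" using R'(1) by simp
    then show ?case using Suc.IH[OF R'(2)] Suc.prems(2) by simp
  qed
  have "\<forall>i\<ge>Suc n. coeff P i = 0" using P(1) by (auto intro: coeff_eq_0)
  from split[OF this] obtain c R where R: "P = smult c (p n) + R" "\<forall>i\<ge>n. coeff R i = 0" by blast
  have "form R (q m) = 0" if "m < n" for m
    using P(2)[OF that] biorth that by (simp add: R(1) add smult)
  then have "R = 0" using vanish[OF R(2)] by simp
  moreover have "form P (q n) = c" using biorth by (simp add: R(1) add smult \<open>R = 0\<close> zero)
  ultimately show ?thesis using R(1) by simp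
qed

locale cauchy_laguerre =
  fixes a b :: real
  assumes ab: "a > - 1" "b > - 1" "a + b > - 1"
begin

text \<open>
  Integration over both variables yields the Mellin transform at \<open>s\<close> of the function of \<open>y\<close> that results
  from integrating the weight against \<open>P\<close>. The power \<open>y\<^sup>b\<close> of the weight is part of \<open>y\<^bsup>s-1\<^esup>\<close>: in the
  application \<open>s = b + u\<close>.
\<close>

definition mellin_integrand :: "real poly \<Rightarrow> complex \<Rightarrow> real \<times> real \<Rightarrow> complex" where
  "mellin_integrand P s = (\<lambda>(x, y). indicator ({0<..} \<times> {0<..}) (x, y) *\<^sub>R
      (of_real (poly P x * x powr a * (exp (- x - y) / (x + y))) * of_real y powr (s - 1)))"

lemma mellin_integrand_integral:
  assumes s: "Re s > 0" "a + Re s > 0"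
  shows "integrable lborel (mellin_integrand P s)"
    and "(LINT v|lborel. mellin_integrand P s v)
      = Gamma s * (\<Sum>i\<le>degree P. of_real (coeff P i * Gamma (a + real i + 1)) / (of_real a + s + of_nat i))"
proof -
  define f where "f i = (\<lambda>(x, y). indicator ({0<..} \<times> {0<..}) (x, y) *\<^sub>R
      (of_real x powr (of_real (a + real i + 1) - 1) * of_real y powr (s - 1) * of_real (exp (- x - y) / (x + y))) :: complex)" for i
  have f: "integrable lborel (f i)" "(LINT v|lborel. f i v)
      = Gamma (of_real (a + real i + 1)) * Gamma s / (of_real (a + real i + 1) + s - 1)" for i
  proof -
    have *: "Re (of_real (a + real i + 1)) > 0" "Re (of_real (a + real i + 1)) + Re s > 1"
      using ab s by simp_all
    show "integrable lborel (f i)"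
      unfolding f_def by (rule Cauchy_Gamma_integral(1)[OF *(1) s(1) *(2)])
    show "(LINT v|lborel. f i v) = Gamma (of_real (a + real i + 1)) * Gamma s / (of_real (a + real i + 1) + s - 1)"
      unfolding f_def by (rule Cauchy_Gamma_integral(2)[OF *(1) s(1) *(2)])
  qed
  have expand: "mellin_integrand P s = (\<lambda>v. \<Sum>i\<le>degree P. of_real (coeff P i) * f i v)"
  proof
    fix v :: "real \<times> real"
    obtain x y where v: "v = (x, y)" by force
    show "mellin_integrand P s v = (\<Sum>i\<le>degree P. of_real (coeff P i) * f i v)"
    proof (cases "x > 0 \<and> y > 0")
      case False
      then show ?thesis by (auto simp: v mellin_integrand_def f_def indicator_def)
    next
      case True
      have "of_real x powr (of_real (a + real i + 1) - 1) = complex_of_real (x powr a * x ^ i)" for i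
        using True powr_of_real[of x "a + real i"] by (simp add: powr_add powr_realpow)
      then have "f i v = of_real (x ^ i) * (of_real (x powr a * (exp (- x - y) / (x + y))) * of_real y powr (s - 1))" for i
        using True by (simp add: v f_def mult_ac)
      then show ?thesis
        using True by (simp add: v mellin_integrand_def poly_altdef sum_distrib_left sum_distrib_right sum_divide_distrib mult_ac)
    qed
  qed
  show "integrable lborel (mellin_integrand P s)"
    unfolding expand by (intro Bochner_Integration.integrable_sum integrable_mult_right f)
  have "(LINT v|lborel. mellin_integrand P s v) = (\<Sum>i\<le>degree P. of_real (coeff P i) * (LINT v|lborel. f i v))"
    unfolding expand using f(1) by (subst Bochner_Integration.integral_sum) auto
  also have "\<dots> = (\<Sum>i\<le>degree P. Gamma s * (of_real (coeff P i * Gamma (a + real i + 1)) / (of_real a + s + of_nat i)))"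
  proof (rule sum.cong)
    fix i
    have "complex_of_real (a + real i + 1) + s - 1 = of_real a + s + of_nat i" by simp
    then show "of_real (coeff P i) * (LINT v|lborel. f i v)
        = Gamma s * (of_real (coeff P i * Gamma (a + real i + 1)) / (of_real a + s + of_nat i))"
      unfolding f(2) Gamma_complex_of_real by (simp add: add_ac mult_ac)
  qed simp
  finally show "(LINT v|lborel. mellin_integrand P s v)
      = Gamma s * (\<Sum>i\<le>degree P. of_real (coeff P i * Gamma (a + real i + 1)) / (of_real a + s + of_nat i))"
    by (simp only: sum_distrib_left)
qed

definition form :: "real poly \<Rightarrow> real poly \<Rightarrow> real" where
  "form P Q = (LINT (x, y):{0<..} \<times> {0<..}|lborel. cauchy_laguerre_weight a b x y * poly P x * poly Q y)"

definition form_integrand :: "real poly \<Rightarrow> real poly \<Rightarrow> real \<times> real \<Rightarrow> real" where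
  "form_integrand P Q = (\<lambda>(x, y). indicator ({0<..} \<times> {0<..}) (x, y) *
      (cauchy_laguerre_weight a b x y * poly P x * poly Q y))"

lemma form_eq_integral: "form P Q = (LINT v|lborel. form_integrand P Q v)"
  by (simp add: form_def form_integrand_def set_lebesgue_integral_def case_prod_unfold)

lemma form_integrand_expand:
  "complex_of_real (form_integrand P Q v) = (\<Sum>j\<le>degree Q. of_real (coeff Q j) * mellin_integrand P (of_real (b + real j + 1)) v)"
proof -
  obtain x y where v: "v = (x, y)" by force
  show ?thesis
  proof (cases "x > 0 \<and> y > 0")
    case False
    then show ?thesis by (auto simp: v mellin_integrand_def form_integrand_def indicator_def)
  next
    case True
    have "of_real y powr (of_real (b + real j + 1) - 1) = complex_of_real (y powr b * y ^ j)" for j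
      using True powr_of_real[of y "b + real j"] by (simp add: powr_add powr_realpow)
    then have "mellin_integrand P (of_real (b + real j + 1)) v
        = of_real (poly P x * cauchy_laguerre_weight a b x y * y ^ j)" for j
      using True by (simp add: v mellin_integrand_def cauchy_laguerre_weight_def)
    then show ?thesis
      using True by (simp add: v form_integrand_def poly_altdef[of Q] sum_distrib_left mult_ac)
  qed
qed

lemma integrable_form_integrand: "integrable lborel (form_integrand P Q)"
  and form_eq_moments: "complex_of_real (form P Q)
    = (\<Sum>j\<le>degree Q. of_real (coeff Q j) * (LINT v|lborel. mellin_integrand P (of_real (b + real j + 1)) v))"
proof -
  have m: "integrable lborel (mellin_integrand P (of_real (b + real j + 1)))" for j
    using ab by (intro mellin_integrand_integral) auto
  have "integrable lborel (\<lambda>v. complex_of_real (form_integrand P Q v))"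
    unfolding form_integrand_expand by (intro Bochner_Integration.integrable_sum integrable_mult_right m)
  then have "integrable lborel (\<lambda>v. Re (complex_of_real (form_integrand P Q v)))" by (rule integrable_Re)
  then show "integrable lborel (form_integrand P Q)" by simp
  have "complex_of_real (form P Q) = (LINT v|lborel. complex_of_real (form_integrand P Q v))"
    unfolding form_eq_integral by (rule integral_complex_of_real[symmetric])
  also have "\<dots> = (\<Sum>j\<le>degree Q. of_real (coeff Q j) * (LINT v|lborel. mellin_integrand P (of_real (b + real j + 1)) v))"
    unfolding form_integrand_expand using m by (subst Bochner_Integration.integral_sum) auto
  finally show "complex_of_real (form P Q)
    = (\<Sum>j\<le>degree Q. of_real (coeff Q j) * (LINT v|lborel. mellin_integrand P (of_real (b + real j + 1)) v))" .
qed

lemma form_add_left: "form (P + R) Q = form P Q + form R Q"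
proof -
  have "form_integrand (P + R) Q = (\<lambda>v. form_integrand P Q v + form_integrand R Q v)"
    by (auto simp: form_integrand_def fun_eq_iff algebra_simps)
  then show ?thesis unfolding form_eq_integral
    by (simp add: integrable_form_integrand)
qed

lemma form_smult_left: "form (smult k P) Q = k * form P Q"
proof -
  have "form_integrand (smult k P) Q = (\<lambda>v. k * form_integrand P Q v)"
    by (auto simp: form_integrand_def fun_eq_iff)
  then show ?thesis unfolding form_eq_integral by simp
qed

text \<open>
  The residue at \<open>u = -(a + b) - i\<close> of the rational factor of the integrand of \<open>G\<close>, in the form that
  Lagrange interpolation gives it.
\<close>

definition residue_coeff :: "nat \<Rightarrow> nat \<Rightarrow> real" where
  "residue_coeff n i = pochhammer (1 + (a + b) + real i) n / (\<Prod>j\<in>{..n} - {i}. real j - real i)"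

text \<open>
  Division by \<open>\<Gamma>(a + i + 1)\<close> compensates the factor that the \<open>i\<close>-th moment contributes, so that
  the Mellin transform has the prescribed residues.
\<close>

definition cl_poly :: "nat \<Rightarrow> real poly" where
  "cl_poly n = (\<Sum>i\<le>n. monom (residue_coeff n i / Gamma (a + real i + 1)) i)"

lemma coeff_cl_poly: "coeff (cl_poly n) i = (if i \<le> n then residue_coeff n i / Gamma (a + real i + 1) else 0)"
  by (simp add: cl_poly_def coeff_sum)

lemma Gamma_a_pos: "Gamma (a + real i + 1) > 0" and Gamma_b_pos: "Gamma (b + real i + 1) > 0"
  using ab by (auto intro!: Gamma_real_pos)

lemma residue_coeff_top: "residue_coeff n n = (- 1) ^ n * pochhammer (1 + (a + b) + real n) n / fact n"
proof -
  have "(\<Prod>j\<in>{..n} - {n}. real j - real n) = (\<Prod>j<n. - real (n - j))"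
    by (rule prod.cong) auto
  also have "\<dots> = (\<Prod>j<n. (- 1) * real (n - j))" by simp
  also have "\<dots> = (- 1) ^ n * (\<Prod>j<n. real (n - j))"
    by (simp only: prod.distrib prod_constant card_lessThan)
  also have "(\<Prod>j<n. real (n - j)) = fact n"
    by (simp add: fact_prod_rev lessThan_atLeast0)
  finally show ?thesis
    unfolding residue_coeff_def by (cases "even n") simp_all
qed

lemma degree_cl_poly: "degree (cl_poly n) = n"
proof (rule antisym)
  show "degree (cl_poly n) \<le> n" by (rule degree_le) (simp add: coeff_cl_poly)
  have "pochhammer (1 + (a + b) + real n) n > 0" using ab by (intro pochhammer_pos) simp
  then have "coeff (cl_poly n) n \<noteq> 0"
    using Gamma_a_pos[of n] by (simp add: coeff_cl_poly residue_coeff_top)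
  then show "n \<le> degree (cl_poly n)" by (rule le_degree)
qed

text \<open>
  The coefficients of \<open>cl_poly n\<close> were chosen as the residues of the right-hand side, which therefore is the
  sum of its partial fractions.
\<close>

lemma mellin_cl_poly:
  assumes u: "Re u > - b" "Re u > - (a + b)"
  shows "(LINT v|lborel. mellin_integrand (cl_poly n) (of_real b + u) v)
    = Gamma (of_real b + u) * (pochhammer (1 - u) n / pochhammer (of_real (a + b) + u) (n + 1))"
proof -
  define w where "w = of_real (a + b) + u"
  define B where "B = (\<Prod>j<n. [:of_real (1 + (a + b)) + of_nat j, - 1:] :: complex poly)"
  have B: "poly B x = pochhammer (of_real (1 + (a + b)) - x) n" for x
    by (simp add: B_def poly_prod pochhammer_prod lessThan_atLeast0 algebra_simps)
  have "degree B \<le> (\<Sum>j<n. degree [:of_real (1 + (a + b)) + of_nat j, - 1 :: complex:])"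
    unfolding B_def by (rule order_trans[OF degree_prod_sum_le]) (auto simp: o_def)
  then have degB: "degree B \<le> n" by simp
  have nz: "w + of_nat i \<noteq> 0" for i
  proof
    assume "w + of_nat i = 0"
    then have "Re (w + of_nat i) = 0" by simp
    then show False using u by (simp add: w_def)
  qed
  have d: "complex_of_real (coeff (cl_poly n) i * Gamma (a + real i + 1)) =
      poly B (- of_nat i) / (\<Prod>j\<in>{..n} - {i}. of_nat j - of_nat i)" if "i \<le> n" for i
  proof -
    have "complex_of_real (pochhammer (1 + (a + b) + real i) n) = poly B (- of_nat i)"
      unfolding B by (simp add: pochhammer_of_real[symmetric])
    then show ?thesis
      using that Gamma_a_pos[of i] by (simp add: coeff_cl_poly residue_coeff_def of_real_prod)
  qed
  have "(LINT v|lborel. mellin_integrand (cl_poly n) (of_real b + u) v) = Gamma (of_real b + u) *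
     (\<Sum>i\<le>n. of_real (coeff (cl_poly n) i * Gamma (a + real i + 1)) / (of_real a + (of_real b + u) + of_nat i))"
    using u ab by (subst mellin_integrand_integral(2)) (auto simp: degree_cl_poly)
  also have "(\<Sum>i\<le>n. of_real (coeff (cl_poly n) i * Gamma (a + real i + 1)) / (of_real a + (of_real b + u) + of_nat i))
     = (\<Sum>i\<le>n. poly B (- of_nat i) / (\<Prod>j\<in>{..n} - {i}. of_nat j - of_nat i) / (w + of_nat i))"
    by (intro sum.cong refl, subst d) (auto simp: w_def add_ac)
  also have "\<dots> = poly B w / (\<Prod>j\<le>n. w + of_nat j)"
    by (rule sum_partial_fractions_at_negative_integers[OF degB nz])
  also have "poly B w = pochhammer (1 - u) n" unfolding B by (simp add: w_def)
  also have "(\<Prod>j\<le>n. w + of_nat j) = pochhammer w (n + 1)"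
    by (simp only: pochhammer_prod atLeast0LessThan Suc_eq_plus1[symmetric] lessThan_Suc_atMost)
  finally show ?thesis by (simp only: w_def)
qed

lemma moment_cl_poly:
  "(LINT v|lborel. mellin_integrand (cl_poly n) (of_real (b + real j + 1)) v)
    = of_real (Gamma (b + real j + 1) * pochhammer (- real j) n / pochhammer (a + b + real j + 1) (n + 1))"
proof -
  have "(LINT v|lborel. mellin_integrand (cl_poly n) (of_real b + (of_nat j + 1)) v)
    = Gamma (of_real b + (of_nat j + 1)) * (pochhammer (1 - (of_nat j + 1)) n / pochhammer (of_real (a + b) + (of_nat j + 1)) (n + 1))"
    using ab by (intro mellin_cl_poly) auto
  moreover have "of_real b + (of_nat j + 1) = complex_of_real (b + real j + 1)"
    "1 - (of_nat j + 1) = complex_of_real (- real j)"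
    "of_real (a + b) + (of_nat j + 1) = complex_of_real (a + b + real j + 1)" by simp_all
  ultimately show ?thesis
    by (simp only: Gamma_complex_of_real pochhammer_of_real of_real_mult of_real_divide times_divide_eq_right)
qed

text \<open>
  The moments with \<open>j < n\<close> vanish because \<open>pochhammer (-j) n\<close> contains the factor \<open>0\<close>.
\<close>

lemma form_cl_poly:
  assumes "degree Q \<le> n"
  shows "form (cl_poly n) Q = coeff Q n * (Gamma (b + real n + 1) * ((- 1) ^ n * fact n) / pochhammer (a + b + real n + 1) (n + 1))"
proof -
  let ?m = "\<lambda>j. Gamma (b + real j + 1) * pochhammer (- real j) n / pochhammer (a + b + real j + 1) (n + 1)"
  have "complex_of_real (form (cl_poly n) Q) = of_real (\<Sum>j\<le>degree Q. coeff Q j * ?m j)"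
    unfolding form_eq_moments moment_cl_poly by simp
  then have "form (cl_poly n) Q = (\<Sum>j\<le>degree Q. coeff Q j * ?m j)"
    by (simp only: of_real_eq_iff)
  also have "\<dots> = (\<Sum>j\<le>n. coeff Q j * ?m j)"
    using assms by (intro sum.mono_neutral_left) (auto intro: coeff_eq_0)
  also have "\<dots> = (\<Sum>j\<le>n. if j = n then coeff Q n * ?m n else 0)"
    by (intro sum.cong refl) (auto simp: pochhammer_of_nat_eq_0_iff)
  also have "\<dots> = coeff Q n * ?m n" by simp
  finally show ?thesis by (simp add: pochhammer_same)
qed

text \<open>
  By uniqueness \<open>cl_poly n\<close> is a multiple \<open>l M\<close> of \<open>p n\<close>, where \<open>l\<close> is the common leading coefficient of \<open>p n\<close> and
  \<open>q n\<close> and \<open>M\<close> pairs \<open>cl_poly n\<close> with \<open>y\<^sup>n\<close>. Comparing leading coefficients gives \<open>l\<^sup>2 M\<close>, hence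
  \<open>(l M)\<^sup>2\<close>; the sign of \<open>l M\<close> is that of \<open>M\<close>, since \<open>l\<close> is positive.
\<close>

lemma biorthogonal_eq_cl_poly:
  assumes bi: "cauchy_laguerre_biorthogonal a b p q"
  shows "p n = smult ((- 1) ^ n * cauchy_laguerre_pi a b n) (cl_poly n)"
proof -
  have deg: "degree (p k) = k" "degree (q k) = k" for k
    using bi unfolding cauchy_laguerre_biorthogonal_def by simp_all
  have lead: "lead_coeff (p k) = lead_coeff (q k)" "lead_coeff (p k) > 0" for k
    using bi unfolding cauchy_laguerre_biorthogonal_def by (blast, blast)
  have biorth: "form (p l) (q m) = (if l = m then 1 else 0)" for l m
    using bi unfolding cauchy_laguerre_biorthogonal_def form_def by blast
  define M where "M = Gamma (b + real n + 1) * ((- 1) ^ n * fact n) / pochhammer (a + b + real n + 1) (n + 1)"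
  define l where "l = lead_coeff (p n)"
  have l: "l > 0" using lead by (simp add: l_def)
  have val: "form (cl_poly n) (q m) = coeff (q m) n * M" if "m \<le> n" for m
    using form_cl_poly[of "q m" n] that by (simp add: deg M_def)
  have "coeff (q n) n = l" using lead[of n] deg[of n] by (simp add: l_def)
  then have val_n: "form (cl_poly n) (q n) = l * M" using val[of n] by simp
  have "cl_poly n = smult (form (cl_poly n) (q n)) (p n)"
  proof (rule biorthogonal_left_unique[OF form_add_left form_smult_left deg(1) _ biorth])
    show "p k \<noteq> 0" for k using lead(2)[of k] by auto
    show "form (cl_poly n) (q m) = 0" if "m < n" for m
      using val[of m] that by (simp add: coeff_eq_0 deg)
  qed (simp add: degree_cl_poly)
  then have eq: "cl_poly n = smult (l * M) (p n)" by (simp only: val_n)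
  have poch: "pochhammer (a + b + real n + 1) n > 0" using ab by (intro pochhammer_pos) simp
  have "coeff (cl_poly n) n = l * M * l" using eq deg by (simp add: l_def)
  moreover have "coeff (cl_poly n) n = (- 1) ^ n * pochhammer (a + b + real n + 1) n / (fact n * Gamma (a + real n + 1))"
    by (simp add: coeff_cl_poly residue_coeff_top add_ac)
  ultimately have lM: "l * M * l = (- 1) ^ n * pochhammer (a + b + real n + 1) n / (fact n * Gamma (a + real n + 1))"
    by simp
  define N where "N = Gamma (b + real n + 1) * fact n / (pochhammer (a + b + real n + 1) n * (2 * real n + (a + b) + 1))"
  have M: "M = (- 1) ^ n * N"
    by (simp add: M_def N_def pochhammer_Suc algebra_simps)
  have pos: "2 * real n + (a + b) + 1 > 0" using ab by linarith
  have "N > 0" unfolding N_def by (intro divide_pos_pos mult_pos_pos poch pos Gamma_b_pos) simp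
  define \<mu> where "\<mu> = l * N"
  have "\<mu> > 0" using l \<open>N > 0\<close> by (simp add: \<mu>_def)
  have lN: "l * N * l = pochhammer (a + b + real n + 1) n / (fact n * Gamma (a + real n + 1))"
    using lM unfolding M by (cases "even n") simp_all
  have "\<mu>\<^sup>2 = l * N * l * N" by (simp add: \<mu>_def power2_eq_square)
  also have "\<dots> = pochhammer (a + b + real n + 1) n / (fact n * Gamma (a + real n + 1)) * N"
    by (simp only: lN)
  also have "\<dots> = Gamma (b + real n + 1) / (Gamma (a + real n + 1) * (2 * real n + (a + b) + 1))"
  proof -
    have "P / (f * A) * (B * f / (P * K)) = B / (A * K)" if "P > 0" "f > 0" for P f A B K :: real
      using that by (simp add: field_simps)
    then show ?thesis unfolding N_def using poch by simp
  qed
  finally have mu2: "(1 / \<mu>)\<^sup>2 = (2 * real n + (a + b) + 1) * (Gamma (a + real n + 1) / Gamma (b + real n + 1))"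
    by (simp add: power_divide field_simps)
  have "1 / \<mu> = sqrt ((1 / \<mu>)\<^sup>2)" using \<open>\<mu> > 0\<close> by simp
  then have pi: "cauchy_laguerre_pi a b n = 1 / \<mu>"
    unfolding mu2 by (simp only: cauchy_laguerre_pi_def real_sqrt_mult)
  have "(- 1) ^ n * cauchy_laguerre_pi a b n * (l * M) = 1"
    unfolding pi M using l \<open>N > 0\<close> by (cases "even n") (simp_all add: \<mu>_def)
  then show ?thesis by (simp add: eq)
qed

lemma second_kind_2_smult: "second_kind_2 a b (smult k P) z = of_real k * second_kind_2 a b P z"
proof -
  have "(LINT (x, y):{0<..} \<times> {0<..}|lborel. of_real (poly (smult k P) x * cauchy_laguerre_weight a b x y) / (z + of_real y))
    = (LINT (x, y):{0<..} \<times> {0<..}|lborel. of_real k * (of_real (poly P x * cauchy_laguerre_weight a b x y) / (z + of_real y)))"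
    by (simp add: mult_ac)
  also have "\<dots> = of_real k * (LINT (x, y):{0<..} \<times> {0<..}|lborel. of_real (poly P x * cauchy_laguerre_weight a b x y) / (z + of_real y))"
    by (simp only: case_prod_unfold set_integral_mult_right)
  finally show ?thesis by (simp add: second_kind_2_def)
qed

text \<open>
  Parseval's formula for the measure space of the pairs \<open>(x, y)\<close>. On the line \<open>Re u = c\<close> the product of the
  sine kernel and of the Mellin transform is the integrand of \<open>G\<close>.
\<close>

lemma second_kind_2_cl_poly:
  assumes z: "z \<notin> \<real>\<^sub>\<le>\<^sub>0"
  shows "second_kind_2 a b (cl_poly n) z
     = - meijer_G 3 1 [- of_nat n, of_real (a + b) + of_nat n + 1] [0, of_real (a + b), of_real b] z"
proof -
  define m where "m = max 0 (max (- (a + b)) (- b))"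
  \<comment> \<open>Any \<open>c\<close> strictly between the rightmost left pole \<open>m\<close> and \<open>1\<close> would do.\<close>
  define c where "c = (m + 1) / 2"
  have m: "0 \<le> m" "m < 1" "- (a + b) \<le> m" "- b \<le> m" using ab by (auto simp: m_def)
  have c: "0 < c" "c < 1" "- (a + b) < c" "- b < c" using m by (auto simp: c_def)
  interpret G: cauchy_laguerre_G "a + b" b c n z by unfold_locales (use c z in auto)
  \<comment> \<open>The value \<open>1\<close> off the quadrant, where \<open>\<phi>\<close> vanishes, makes \<open>\<tau>\<close> positive everywhere.\<close>
  define \<tau> where "\<tau> v = (if snd v > 0 then snd v else 1 :: real)" for v :: "real \<times> real"
  define \<phi> where "\<phi> = mellin_integrand (cl_poly n) (of_real (b + 1))"
  have shift: "\<phi> v * of_real (\<tau> v) powr (u - 1) = mellin_integrand (cl_poly n) (of_real b + u) v" for v u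
  proof -
    obtain x y where v: "v = (x, y)" by force
    show ?thesis
    proof (cases "x > 0 \<and> y > 0")
      case False
      then show ?thesis by (auto simp: v \<phi>_def mellin_integrand_def indicator_def)
    next
      case True
      have "complex_of_real y powr (of_real b + u - 1) = of_real y powr (of_real (b + 1) - 1) * of_real y powr (u - 1)"
        using True by (simp add: powr_def algebra_simps flip: exp_add)
      then show ?thesis using True by (simp add: v \<phi>_def \<tau>_def mellin_integrand_def)
    qed
  qed
  have \<phi>_int: "integrable lborel \<phi>"
    unfolding \<phi>_def using ab by (intro mellin_integrand_integral) auto
  have norm_int: "integrable lborel (\<lambda>v. cmod (\<phi> v) * \<tau> v powr (c - 1))"
  proof -
    have "integrable lborel (mellin_integrand (cl_poly n) (of_real b + of_real c))"
      using c by (intro mellin_integrand_integral) auto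
    then have "integrable lborel (\<lambda>v. cmod (\<phi> v * of_real (\<tau> v) powr (of_real c - 1)))"
      unfolding shift by (rule integrable_norm)
    moreover have "\<tau> v > 0" for v by (simp add: \<tau>_def)
    ultimately show ?thesis by (simp add: norm_mult norm_powr_real_powr less_imp_le)
  qed
  have sf: "sigma_finite_measure (lborel :: (real \<times> real) measure)" ..
  have meas: "\<phi> \<in> borel_measurable lborel" "\<tau> \<in> borel_measurable lborel"
  proof -
    show "\<phi> \<in> borel_measurable lborel" using \<phi>_int by auto
    have [measurable]: "snd \<in> borel_measurable (borel :: (real \<times> real) measure)"
      by (intro borel_measurable_continuous_onI continuous_on_snd continuous_on_id)
    have "\<tau> \<in> borel_measurable borel" unfolding \<tau>_def by measurable
    then show "\<tau> \<in> borel_measurable lborel" by simp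
  qed
  have Phi: "sine_kernel z (Complex c y) * (LINT v|lborel. \<phi> v * of_real (\<tau> v) powr (Complex c y - 1)) = G.\<Phi> (Complex c y)" for y
  proof -
    have "Complex c y \<notin> G.left" using G.left_pole_real by force
    then have "G.\<Phi> (Complex c y) = pochhammer (1 - Complex c y) n / pochhammer (of_real (a + b) + Complex c y) (n + 1)
           * (of_real pi / sin (of_real pi * Complex c y)) * Gamma (of_real b + Complex c y) * z powr (- Complex c y)"
      using c by (intro G.Phi_sine_form) auto
    moreover have "(LINT v|lborel. \<phi> v * of_real (\<tau> v) powr (Complex c y - 1))
       = Gamma (of_real b + Complex c y) * (pochhammer (1 - Complex c y) n / pochhammer (of_real (a + b) + Complex c y) (n + 1))"
      unfolding shift using c by (intro mellin_cl_poly) auto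
    ultimately show ?thesis by (simp add: sine_kernel_def mult_ac)
  qed
  note MP = Mellin_Parseval[OF sf meas _ norm_int z c(1,2), unfolded Phi]
  have \<tau>_pos: "\<tau> v > 0" for v by (simp add: \<tau>_def)
  define V where "V = (LINT y|lborel. G.\<Phi> (Complex c y))"
  have int: "integrable lborel (\<lambda>y. G.\<Phi> (Complex c y))" by (rule MP(1)[OF \<tau>_pos])
  have V: "V = 2 * of_real pi * (LINT v|lborel. \<phi> v / (z + of_real (\<tau> v)))"
    unfolding V_def by (rule MP(2)[OF \<tau>_pos])
  have "((\<lambda>Y. \<i> * integral {- Y..Y} (\<lambda>y. G.\<Phi> (Complex c y))) \<longlongrightarrow> \<i> * V) at_top"
    unfolding V_def by (intro tendsto_mult_left tendsto_integral_symmetric_interval int)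
  then have "((\<lambda>Y. contour_integral (linepath (Complex c (- Y)) (Complex c Y)) G.\<Phi>) \<longlongrightarrow> \<i> * V) at_top"
  proof (rule Lim_transform_eventually)
    have "\<i> * integral {- Y..Y} (\<lambda>y. G.\<Phi> (Complex c y))
        = contour_integral (linepath (Complex c (- Y)) (Complex c Y)) G.\<Phi>" if "Y > 0" for Y
      using that contour_integral_linepath_same_Re[of "Complex c (- Y)" c "Complex c Y" "- Y" Y] by simp
    then show "\<forall>\<^sub>F Y in at_top. \<i> * integral {- Y..Y} (\<lambda>y. G.\<Phi> (Complex c y))
        = contour_integral (linepath (Complex c (- Y)) (Complex c Y)) G.\<Phi>"
      by (rule eventually_mono[OF eventually_gt_at_top[of 0]])
  qed
  then have "meijer_G 3 1 G.upper G.lower z = \<i> * V / (2 * of_real pi * \<i>)"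
    by (rule G.meijer_G_eq_vertical_integral)
  also have "\<dots> = (LINT v|lborel. \<phi> v / (z + of_real (\<tau> v)))" by (simp add: V)
  also have "\<dots> = - second_kind_2 a b (cl_poly n) z"
  proof -
    have "\<phi> v / (z + of_real (\<tau> v)) = indicator ({0<..} \<times> {0<..}) v *\<^sub>R
        (case v of (x, y) \<Rightarrow> of_real (poly (cl_poly n) x * cauchy_laguerre_weight a b x y) / (z + of_real y))" for v
    proof -
      obtain x y where v: "v = (x, y)" by force
      show ?thesis
      proof (cases "x > 0 \<and> y > 0")
        case False
        then show ?thesis by (auto simp: v \<phi>_def mellin_integrand_def indicator_def)
      next
        case True
        have "complex_of_real y powr (of_real (b + 1) - 1) = of_real (y powr b)"
          using True powr_of_real[of y b] by simp
        then show ?thesis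
          using True by (simp add: v \<phi>_def \<tau>_def mellin_integrand_def cauchy_laguerre_weight_def)
      qed
    qed
    then show ?thesis by (simp add: second_kind_2_def set_lebesgue_integral_def)
  qed
  finally show ?thesis by simp
qed

end

theorem theorem5p4:
  fixes a b \<alpha> :: real and p q :: "nat \<Rightarrow> real poly" and n :: nat and z :: complex
  assumes "a > -1" and "b > -1" and "\<alpha> = a + b" and "\<alpha> > -1"
    and "cauchy_laguerre_biorthogonal a b p q"
    and "z \<notin> \<real>\<^sub>\<le>\<^sub>0"
  shows "second_kind_2 a b (p n) z =
           (-1) ^ (n + 1) * of_real (cauchy_laguerre_pi a b n) *
           meijer_G 3 1 [- of_nat n, of_real \<alpha> + of_nat n + 1] [0, of_real \<alpha>, of_real b] z"
proof -
  interpret cauchy_laguerre a b by unfold_locales (use assms in auto)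
  have "second_kind_2 a b (p n) z = of_real ((- 1) ^ n * cauchy_laguerre_pi a b n) * second_kind_2 a b (cl_poly n) z"
    by (subst biorthogonal_eq_cl_poly[OF assms(5)]) (rule second_kind_2_smult)
  then show ?thesis
    unfolding second_kind_2_cl_poly[OF assms(6)] by (simp add: assms(3))
qed

end
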